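(* Let $\phi\in PSH(\mathbb D^n)$, where $\mathbb D^n$ is the unit polydisc in $\mathbb C^n$. For each $a=(a_1,\dots,a_n)$ with all $a_j>0$, there exists a number $\varepsilon_0=\varepsilon_0(a,\phi)>0$ such that $$\lim_{r\to0+}\frac{\sup_{t\in P_{r^a}}F(\varepsilon\phi)(t,0)/\varepsilon}{\log r}=\lim_{r\to0+}\frac{\sup_{z\in P_{r^a}}\phi(z)}{\log r}$$ holds for all $0<\varepsilon\le\varepsilon_0$.
   Context: $PSH(\Omega)$ is the set of plurisubharmonic functions on $\Omega$ (not identically $-\infty$). For a domain $\Omega\subset\mathbb C^n$ and a plurisubharmonic weight $\phi$ on $\Omega$, the weighted Bergman kernel is $$K_{\phi,\Omega}(z)=\sup\left\{|f(z)|^2:\ f\in\mathcal O(\Omega),\ \int_\Omega|f|^2e^{-\phi}\le1\right\}$$ (integral with respect to Lebesgue measure). For $t\in\mathbb D^n$, $\phi^t(z):=\phi(t_1z_1,\dots,t_nz_n)$, and $$F(\phi)(t,z):=\log K_{\phi^t,\mathbb D^n}(z),\qquad(t,z)\in\mathbb D^n\times\mathbb D^n,$$ with the convention $\log0=-\infty$ (if $\phi^t\equiv-\infty$, which can only happen when some $t_j=0$, then $e^{-\phi^t}\equiv+\infty$ and $K_{\phi^t,\mathbb D^n}=0$). For $a=(a_1,\dots,a_n)$ with all $a_j>0$ and $r>0$, $P_{r^a}:=\{z\in\mathbb C^n:|z_j|\le r^{a_j},\ 1\le j\le n\}$. *)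

theory Defs
  imports "HOL-Analysis.Analysis"
begin

section \<open>Plurisubharmonic functions\<close>

text \<open>Functions with values in \<open>[-\<infinity>,\<infinity>)\<close> are modelled by \<^typ>\<open>ereal\<close>-valued functions that avoid
  \<open>\<infinity>\<close> on their domain; values outside the domain are irrelevant.\<close>

definition upper_semicontinuous_on :: "'a::topological_space set \<Rightarrow> ('a \<Rightarrow> ereal) \<Rightarrow> bool" where
  "upper_semicontinuous_on S u \<longleftrightarrow>
     (\<forall>x\<in>S. \<forall>c>u x. \<forall>\<^sub>F y in at x within S. u y < c)"

text \<open>The integral is the difference of the integrals of the positive and negative parts
  (\<^const>\<open>e2ennreal\<close> truncates negative values to 0). For an upper semicontinuous \<open>u\<close> without
  value \<open>\<infinity>\<close>, the first one is finite, so the difference is well defined in \<open>[-\<infinity>,\<infinity>)\<close>.\<close>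

definition circle_mean :: "(complex \<Rightarrow> ereal) \<Rightarrow> complex \<Rightarrow> real \<Rightarrow> ereal" where
  "circle_mean u c r =
     (enn2ereal (\<integral>\<^sup>+\<theta>\<in>{0..2*pi}. e2ennreal (u (c + complex_of_real r * cis \<theta>)) \<partial>lborel)
      - enn2ereal (\<integral>\<^sup>+\<theta>\<in>{0..2*pi}. e2ennreal (- u (c + complex_of_real r * cis \<theta>)) \<partial>lborel))
     / ereal (2 * pi)"

text \<open>With this convention, the constant \<open>-\<infinity>\<close> is subharmonic.\<close>

definition subharmonic_on :: "complex set \<Rightarrow> (complex \<Rightarrow> ereal) \<Rightarrow> bool" where
  "subharmonic_on U u \<longleftrightarrow>
     (\<forall>x\<in>U. u x \<noteq> \<infinity>) \<and> upper_semicontinuous_on U u \<and>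
     (\<forall>c r. 0 < r \<and> cball c r \<subseteq> U \<longrightarrow> u c \<le> circle_mean u c r)"

definition plurisubharmonic_on :: "(complex ^ 'n) set \<Rightarrow> (complex ^ 'n \<Rightarrow> ereal) \<Rightarrow> bool" where
  "plurisubharmonic_on \<Omega> \<phi> \<longleftrightarrow>
     (\<forall>z\<in>\<Omega>. \<phi> z \<noteq> \<infinity>) \<and> upper_semicontinuous_on \<Omega> \<phi> \<and>
     (\<forall>a b. subharmonic_on {\<tau>. a + \<tau> *s b \<in> \<Omega>} (\<lambda>\<tau>. \<phi> (a + \<tau> *s b)))"

definition PSH :: "(complex ^ 'n) set \<Rightarrow> (complex ^ 'n \<Rightarrow> ereal) set" where
  "PSH \<Omega> = {\<phi>. plurisubharmonic_on \<Omega> \<phi> \<and> (\<exists>z\<in>\<Omega>. \<phi> z \<noteq> -\<infinity>)}"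

section \<open>Weighted Bergman kernels\<close>

definition holomorphic_functions :: "(complex ^ 'n) set \<Rightarrow> (complex ^ 'n \<Rightarrow> complex) set" where
  "holomorphic_functions \<Omega> =
     {f. \<forall>z\<in>\<Omega>. \<exists>f'. (f has_derivative f') (at z) \<and> (\<forall>c v. f' (c *s v) = c * f' v)}"

definition exp_ext :: "ereal \<Rightarrow> ennreal" where
  "exp_ext x = (if x = -\<infinity> then 0 else if x = \<infinity> then \<infinity> else ennreal (exp (real_of_ereal x)))"

definition ln_ext :: "ennreal \<Rightarrow> ereal" where
  "ln_ext x = (if x = 0 then -\<infinity> else if x = \<infinity> then \<infinity> else ereal (ln (enn2real x)))"

text \<open>Since \<open>0 * \<infinity> = 0\<close> in \<^typ>\<open>ennreal\<close>, for \<open>\<phi> = -\<infinity>\<close> identically on a nonempty open \<open>\<Omega>\<close> only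
  the functions vanishing on \<open>\<Omega>\<close> compete in the supremum, and the kernel is 0.\<close>

definition bergman_kernel ::
    "(complex ^ 'n \<Rightarrow> ereal) \<Rightarrow> (complex ^ 'n) set \<Rightarrow> complex ^ 'n \<Rightarrow> ennreal" where
  "bergman_kernel \<phi> \<Omega> z =
     (SUP f \<in> {f \<in> holomorphic_functions \<Omega>.
                (\<integral>\<^sup>+w\<in>\<Omega>. ennreal ((cmod (f w))\<^sup>2) * exp_ext (- \<phi> w) \<partial>lborel) \<le> 1}.
        ennreal ((cmod (f z))\<^sup>2))"

definition unit_polydisc :: "(complex ^ 'n) set" where
  "unit_polydisc = {z. \<forall>j. cmod (z $ j) < 1}"

definition dilate :: "(complex ^ 'n \<Rightarrow> ereal) \<Rightarrow> complex ^ 'n \<Rightarrow> complex ^ 'n \<Rightarrow> ereal" where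
  "dilate \<phi> t z = \<phi> (\<chi> j. t $ j * z $ j)"

definition log_bergman ::
    "(complex ^ 'n \<Rightarrow> ereal) \<Rightarrow> complex ^ 'n \<Rightarrow> complex ^ 'n \<Rightarrow> ereal" where
  "log_bergman \<phi> t z = ln_ext (bergman_kernel (dilate \<phi> t) unit_polydisc z)"

definition weighted_polydisc :: "real ^ 'n \<Rightarrow> real \<Rightarrow> (complex ^ 'n) set" where
  "weighted_polydisc a r = {z. \<forall>j. cmod (z $ j) \<le> r powr (a $ j)}"

end

theory Submission
  imports Defs "HOL-Complex_Analysis.Cauchy_Integral_Formula"
begin

text \<open>Let \<open>N s\<close> be the supremum of \<open>\<phi>\<close> over the polydisc \<open>|z\<^sub>j| < exp (s a\<^sub>j)\<close>. It is convex in \<open>s\<close>, so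
  \<open>N s / s\<close> has a limit as \<open>s \<rightarrow> -\<infinity>\<close>, and both quotients are compared with \<open>N (ln r) / ln r\<close>. Since
  \<open>\<phi>\<^sup>t \<le> N (ln r)\<close> on the unit polydisc for \<open>t \<in> P\<close>, the mean value property of holomorphic functions
  gives \<open>F(\<epsilon>\<phi>)(t,0) / \<epsilon> \<le> N (ln r) + O(1)\<close>. Conversely, for \<open>t\<^sub>j = r powr a\<^sub>j\<close>, testing the kernel with
  constants reduces the claim to \<open>\<integral> exp (-\<epsilon> \<phi>\<^sup>t) \<le> const * exp (-\<epsilon> N (ln r))\<close>, uniformly in \<open>r\<close>. By convexity,
  the increments of \<open>N\<close> are bounded as \<open>s \<rightarrow> -\<infinity>\<close>, and so are the oscillations of all \<open>\<phi>\<^sup>t\<close> at all smaller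
  scales; the integral bound is then a John-Nirenberg inequality over dyadic cubes.\<close>

section \<open>Submean inequality along complex lines\<close>

text \<open>Two geometries have to be reconciled: the growth of \<phi> is measured on polydiscs with
  weights \<open>a\<close>, the integral bound on cubes. The dilation with entries
  \<open>r powr a $ j\<close> turns the former into isotropic polydiscs of fixed size, so the
  weights survive only in the length \<open>H\<close> of the increment of N that corresponds to
  enlarging the unit polydisc by the factor 14. Convexity bounds these increments by a constant
  \<open>C\<close> for all small r, and \<open>C\<close> and the dimension alone fix
  \<open>\<epsilon>\<^sub>0\<close>. Smallness of \<epsilon> enters only through the integrability
  of the exponentials. A second obstacle is infinite values: \<phi> may be unbounded above near the
  boundary of the polydisc and -\<infinity> inside. So N is used at negative scales only, and that
  it is never -\<infinity> there is itself a consequence of the three polydiscs theorem.\<close>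

lemma usc_open_sublevel:
  assumes "open \<Omega>" "upper_semicontinuous_on \<Omega> u"
  shows "open {z\<in>\<Omega>. u z < c}"
proof (subst open_subopen, safe)
  fix z assume z: "z \<in> \<Omega>" "u z < c"
  then have "\<forall>\<^sub>F y in at z within \<Omega>. u y < c"
    using assms(2) unfolding upper_semicontinuous_on_def by auto
  then have "\<forall>\<^sub>F y in at z. u y < c"
    using at_within_open[OF z(1) assms(1)] by simp
  then obtain U where "open U" "z \<in> U" "\<forall>y\<in>U. y \<noteq> z \<longrightarrow> u y < c"
    unfolding eventually_at_topological by auto
  then show "\<exists>T. open T \<and> z \<in> T \<and> T \<subseteq> {z \<in> \<Omega>. u z < c}"
    using assms(1) z by (intro exI[of _ "U \<inter> \<Omega>"]) auto
qed

lemma usc_onI_open: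
  assumes "open \<Omega>" "\<And>c. open {z\<in>\<Omega>. u z < c}"
  shows "upper_semicontinuous_on \<Omega> u"
  unfolding upper_semicontinuous_on_def
proof (intro ballI allI impI)
  fix x c assume x: "x \<in> \<Omega>" "u x < c"
  then have "\<forall>\<^sub>F y in nhds x. y \<in> {z\<in>\<Omega>. u z < c}"
    by (intro eventually_nhds_in_open assms(2)) auto
  then have "\<forall>\<^sub>F y in nhds x. u y < c"
    by (rule eventually_mono) auto
  then show "\<forall>\<^sub>F y in at x within \<Omega>. u y < c"
    unfolding eventually_at_filter by (rule eventually_mono) auto
qed

text \<open>Values off \<Omega> are unconstrained, so measurability is only available after
  overwriting them. Overwriting by 0 gives the extension called \<open>U\<close> in the later
  integral estimates.\<close>

lemma usc_borel_measurable:
  fixes u :: "'a::topological_space \<Rightarrow> ereal"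
  assumes "open \<Omega>" "upper_semicontinuous_on \<Omega> u"
  shows "(\<lambda>z. if z \<in> \<Omega> then u z else 0) \<in> borel_measurable borel"
proof (rule borel_measurableI_less)
  fix c :: ereal
  have "{z \<in> space borel. (if z \<in> \<Omega> then u z else 0) < c} =
      {z\<in>\<Omega>. u z < c} \<union> (if 0 < c then - \<Omega> else {})" by auto
  also have "\<dots> \<in> sets borel"
    using usc_open_sublevel[OF assms] assms(1) by auto
  finally show "{z \<in> space borel. (if z \<in> \<Omega> then u z else 0) < c} \<in> sets borel" .
qed

text \<open>The continuous summand \<open>g\<close> makes room for the barriers added to
  \<open>u\<close> in the maximum arguments. Without a maximum, each \<open>p\<close> has a
  neighbourhood on which the sum stays below its value at some \<open>Z p\<close>; among finitely
  many covering neighbourhoods, the largest of these values is attained inside one of them, hence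
  exceeded by another.\<close>

lemma usc_attains_sup:
  fixes u :: "'a::topological_space \<Rightarrow> ereal" and g :: "'a \<Rightarrow> real"
  assumes K: "compact K" "K \<noteq> {}" "K \<subseteq> \<Omega>" and u: "upper_semicontinuous_on \<Omega> u"
    and fin: "\<And>z. z \<in> \<Omega> \<Longrightarrow> u z \<noteq> \<infinity>" and g: "continuous_on K g"
  obtains p where "p \<in> K" "\<And>z. z \<in> K \<Longrightarrow> u z + ereal (g z) \<le> u p + ereal (g p)"
proof -
  define v where "v z = u z + ereal (g z)" for z
  have usc: "\<forall>\<^sub>F y in at x within K. v y < c" if x: "x \<in> K" "v x < c" for x c
  proof -
    obtain c' where c': "v x < ereal c'" "ereal c' < c"
      using ereal_dense2[OF x(2)] by auto
    have "u x < ereal (c' - g x)" using c'(1) x K fin[of x] unfolding v_def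
      by (cases "u x") auto
    then obtain d where d: "u x < ereal d" "ereal d < ereal (c' - g x)"
      using ereal_dense2 by blast
    have "\<forall>\<^sub>F y in at x within \<Omega>. u y < ereal d"
      using u x K d unfolding upper_semicontinuous_on_def by auto
    then have 1: "\<forall>\<^sub>F y in at x within K. u y < ereal d"
      by (rule filter_leD[OF at_le[OF K(3)]])
    have 2: "\<forall>\<^sub>F y in at x within K. g y < c' - d"
      using g x d by (intro order_tendstoD(2)) (auto simp: continuous_on_def)
    from 1 2 show ?thesis
    proof eventually_elim
      case (elim y)
      have "v y \<le> ereal d + ereal (g y)" unfolding v_def
        using elim by (intro add_right_mono) auto
      also have "\<dots> < ereal c'" using elim by auto
      finally show ?case using c' by simp
    qed
  qed
  have "\<exists>p\<in>K. \<forall>z\<in>K. v z \<le> v p"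
  proof (rule ccontr)
    assume "\<not> ?thesis"
    then have *: "\<forall>p\<in>K. \<exists>z\<in>K. v p < v z" by (auto simp: not_le)
    have "\<forall>p\<in>K. \<exists>U. open U \<and> p \<in> U \<and> (\<exists>z\<in>K. \<forall>y\<in>U\<inter>K. v y < v z)"
    proof
      fix p assume p: "p \<in> K"
      then obtain z where z: "z \<in> K" "v p < v z" using * by auto
      obtain U where U: "open U" "p \<in> U" "\<forall>y\<in>U. y \<noteq> p \<longrightarrow> y \<in> K \<longrightarrow> v y < v z"
        using usc[OF p z(2)] unfolding eventually_at_topological by auto
      have "v y < v z" if "y \<in> U \<inter> K" for y
        using U(3) z(2) that by (cases "y = p") auto
      then show "\<exists>U. open U \<and> p \<in> U \<and> (\<exists>z\<in>K. \<forall>y\<in>U\<inter>K. v y < v z)"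
        using U(1,2) z(1) by auto
    qed
    then obtain U where U: "\<And>p. p \<in> K \<Longrightarrow> open (U p) \<and> p \<in> U p \<and> (\<exists>z\<in>K. \<forall>y\<in>U p\<inter>K. v y < v z)"
      by metis
    then have "\<exists>Z. \<forall>p\<in>K. Z p \<in> K \<and> (\<forall>y\<in>U p\<inter>K. v y < v (Z p))" by metis
    then obtain Z where Z: "\<And>p. p \<in> K \<Longrightarrow> Z p \<in> K" "\<And>p y. p \<in> K \<Longrightarrow> y \<in> U p \<inter> K \<Longrightarrow> v y < v (Z p)"
      by blast
    obtain F where F: "F \<subseteq> K" "finite F" "K \<subseteq> (\<Union>p\<in>F. U p)"
      using compactE_image[OF K(1), of K U] U by blast
    have "F \<noteq> {}" using F K by auto
    have "Max ((v \<circ> Z) ` F) \<in> (v \<circ> Z) ` F" using F \<open>F \<noteq> {}\<close> by simp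
    then obtain q where q: "q \<in> F" "v (Z q) = Max ((v \<circ> Z) ` F)" by auto
    obtain p where p: "p \<in> F" "Z q \<in> U p" using F q Z by blast
    have "v (Z q) < v (Z p)" using p q Z F by blast
    moreover have "v (Z p) \<le> Max ((v \<circ> Z) ` F)" using F p by (intro Max_ge) auto
    ultimately show False using q by simp
  qed
  then show thesis using that unfolding v_def by blast
qed

lemma continuous_cis_smult: "continuous_on UNIV (\<lambda>\<theta>. z + cis \<theta> *s (b::complex^'n))"
proof -
  have "(\<lambda>\<theta>. z + cis \<theta> *s b) = (\<lambda>\<theta>. \<chi> j. z $ j + cis \<theta> * b $ j)"
    by (auto simp: vec_eq_iff)
  then show ?thesis by (simp only:) (intro continuous_intros)
qed

lemma plurisubharmonic_circle_mean:
  assumes "plurisubharmonic_on \<Omega> u" "\<And>\<tau>. cmod \<tau> \<le> 1 \<Longrightarrow> z + \<tau> *s b \<in> \<Omega>"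
  shows "u z \<le> circle_mean (\<lambda>\<tau>. u (z + \<tau> *s b)) 0 1"
proof -
  have "subharmonic_on {\<tau>. z + \<tau> *s b \<in> \<Omega>} (\<lambda>\<tau>. u (z + \<tau> *s b))"
    using assms unfolding plurisubharmonic_on_def by auto
  moreover have "cball 0 1 \<subseteq> {\<tau>. z + \<tau> *s b \<in> \<Omega>}" using assms by auto
  ultimately have "u (z + 0 *s b) \<le> circle_mean (\<lambda>\<tau>. u (z + \<tau> *s b)) 0 1"
    unfolding subharmonic_on_def using zero_less_one by blast
  then show ?thesis by simp
qed

text \<open>\<open>circle_mean\<close> is a difference of two integrals, the second possibly
  infinite. Comparison with a continuous majorant \<open>g\<close> leaves a single nonnegative
  deficit integral, which can later be integrated by Tonelli; if it is infinite, it forces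
  \<open>u z\<close> to be -\<infinity>.\<close>

lemma plurisubharmonic_submean:
  fixes u :: "complex^'n \<Rightarrow> ereal"
  assumes u: "plurisubharmonic_on \<Omega> u" and \<Omega>: "open \<Omega>"
    and disc: "\<And>\<tau>. cmod \<tau> \<le> 1 \<Longrightarrow> z + \<tau> *s b \<in> \<Omega>"
    and g: "continuous_on {0..2*pi} g"
    and le: "\<And>\<theta>. \<theta> \<in> {0..2*pi} \<Longrightarrow> u (z + cis \<theta> *s b) \<le> ereal (g \<theta>)"
  shows "ereal (2*pi) * u z \<le> ereal (integral {0..2*pi} g)
     - enn2ereal (\<integral>\<^sup>+\<theta>\<in>{0..2*pi}. e2ennreal (ereal (g \<theta>) - u (z + cis \<theta> *s b)) \<partial>lborel)"
proof -
  let ?I = "{0..2*pi}"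
  define f where "f \<theta> = u (z + cis \<theta> *s b)" for \<theta>
  define J where "J = (\<integral>\<^sup>+\<theta>\<in>?I. e2ennreal (ereal (g \<theta>) - f \<theta>) \<partial>lborel)"
  define P where "P = (\<integral>\<^sup>+\<theta>\<in>?I. e2ennreal (f \<theta>) \<partial>lborel)"
  define N where "N = (\<integral>\<^sup>+\<theta>\<in>?I. e2ennreal (- f \<theta>) \<partial>lborel)"
  define G where "G = (\<integral>\<^sup>+\<theta>\<in>?I. ennreal (g \<theta>) \<partial>lborel)"
  define H where "H = (\<integral>\<^sup>+\<theta>\<in>?I. ennreal (- g \<theta>) \<partial>lborel)"
  have usc: "upper_semicontinuous_on \<Omega> u" and fin: "\<And>z. z \<in> \<Omega> \<Longrightarrow> u z \<noteq> \<infinity>"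
    using u unfolding plurisubharmonic_on_def by auto
  have f_eq: "f = (\<lambda>z. if z \<in> \<Omega> then u z else 0) \<circ> (\<lambda>\<theta>. z + cis \<theta> *s b)"
    unfolding f_def using disc by auto
  have f[measurable]: "f \<in> borel_measurable borel"
    unfolding f_eq using continuous_cis_smult
    by (intro measurable_comp[OF borel_measurable_continuous_onI usc_borel_measurable] \<Omega> usc)
  have gm: "(\<lambda>\<theta>. g \<theta> * indicator ?I \<theta>) \<in> borel_measurable borel"
    using borel_measurable_continuous_on_indicator[OF _ g] by (auto simp: mult.commute)
  have gi: "set_integrable lborel ?I g"
    by (rule borel_integrable_atLeastAtMost') (rule g)
  have gi': "integrable lborel (\<lambda>\<theta>. indicator ?I \<theta> * g \<theta>)"
    using gi unfolding set_integrable_def by simp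
  have mult_ind: "ennreal c * indicator ?I \<theta> = ennreal (indicator ?I \<theta> * c)" for c \<theta>
    by (auto simp: indicator_def)
  have Geq: "G = (\<integral>\<^sup>+\<theta>. ennreal (indicator ?I \<theta> * g \<theta>) \<partial>lborel)"
    and Heq: "H = (\<integral>\<^sup>+\<theta>. ennreal (- (indicator ?I \<theta> * g \<theta>)) \<partial>lborel)"
    unfolding G_def H_def mult_ind by auto
  have GH: "G < \<infinity>" "H < \<infinity>"
    using gi' unfolding Geq Heq real_integrable_def by (auto simp: less_top)
  have int: "integral ?I g = enn2real G - enn2real H"
  proof -
    have "integral ?I g = (LINT \<theta>|lborel. indicator ?I \<theta> * g \<theta>)"
      using set_borel_integral_eq_integral(2)[OF gi] unfolding set_lebesgue_integral_def by simp
    also have "\<dots> = enn2real G - enn2real H"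
      unfolding Geq Heq by (rule real_lebesgue_integral_def[OF gi'])
    finally show ?thesis .
  qed
  have meas: "(\<lambda>\<theta>. ennreal (g \<theta>) * indicator ?I \<theta>) \<in> borel_measurable borel"
       "(\<lambda>\<theta>. ennreal (- g \<theta>) * indicator ?I \<theta>) \<in> borel_measurable borel"
    using gm unfolding mult_ind by (auto simp: mult.commute)
  have meas2: "(\<lambda>\<theta>. e2ennreal (ereal (g \<theta>) - f \<theta>) * indicator ?I \<theta>) \<in> borel_measurable borel"
  proof -
    have "(\<lambda>\<theta>. e2ennreal (ereal (g \<theta>) - f \<theta>) * indicator ?I \<theta>) =
      (\<lambda>\<theta>. e2ennreal (ereal (g \<theta> * indicator ?I \<theta>) - f \<theta>) * indicator ?I \<theta>)"
      by (auto simp: indicator_def)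
    then show ?thesis using gm by simp
  qed
  have fle: "f \<theta> \<le> ereal (g \<theta>)" if "\<theta> \<in> ?I" for \<theta> using le that unfolding f_def by auto
  \<comment> \<open>The identity (g - f) + f^+ + g^- = f^- + g^+, integrated. It avoids subtraction,
    which \<open>ennreal\<close> truncates.\<close>
  have "J + (P + H) = N + G"
  proof -
    have pt: "e2ennreal (ereal (g \<theta>) - f \<theta>) * indicator ?I \<theta> + (e2ennreal (f \<theta>) * indicator ?I \<theta>
        + ennreal (- g \<theta>) * indicator ?I \<theta>)
        = e2ennreal (- f \<theta>) * indicator ?I \<theta> + ennreal (g \<theta>) * indicator ?I \<theta>" for \<theta>
    proof (cases "\<theta> \<in> ?I")
      case True
      show ?thesis
      proof (cases "f \<theta>")
        case (real x)
        then have "x \<le> g \<theta>" using fle[OF True] by simp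
        then show ?thesis using True real
          by (cases "x \<ge> 0"; cases "g \<theta> \<ge> 0")
             (auto simp: e2ennreal_ereal ennreal_neg simp flip: ennreal_plus)
      qed (use True fle[OF True] in auto)
    qed auto
    have "J + (P + H) = (\<integral>\<^sup>+\<theta>. e2ennreal (ereal (g \<theta>) - f \<theta>) * indicator ?I \<theta> + (e2ennreal (f \<theta>) * indicator ?I \<theta>
        + ennreal (- g \<theta>) * indicator ?I \<theta>) \<partial>lborel)"
      unfolding J_def P_def H_def using meas meas2
      by (subst nn_integral_add; (subst nn_integral_add)?) auto
    also have "\<dots> = N + G"
      unfolding pt N_def G_def using meas meas2 by (subst nn_integral_add) auto
    finally show ?thesis .
  qed
  have "P \<le> G" unfolding P_def G_def
  proof (intro nn_integral_mono)
    fix \<theta>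
    show "e2ennreal (f \<theta>) * indicator ?I \<theta> \<le> ennreal (g \<theta>) * indicator ?I \<theta>"
      using e2ennreal_mono[OF fle[of \<theta>]] by (auto simp: indicator_def)
  qed
  then have P: "P < \<infinity>" using GH(1) by (rule order.strict_trans1)
  have mean: "u z \<le> (enn2ereal P - enn2ereal N) / ereal (2*pi)"
    using plurisubharmonic_circle_mean[OF u disc]
    unfolding circle_mean_def P_def N_def f_def by simp
  have "ereal (2*pi) * u z \<le> enn2ereal P - enn2ereal N"
  proof -
    have "ereal (2*pi) * u z \<le> ereal (2*pi) * ((enn2ereal P - enn2ereal N) / ereal (2*pi))"
      by (intro ereal_mult_left_mono mean) auto
    also have "\<dots> = enn2ereal P - enn2ereal N"
      by (cases "enn2ereal P - enn2ereal N") auto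
    finally show ?thesis .
  qed
  also have "\<dots> \<le> ereal (integral ?I g) - enn2ereal J"
  proof (cases "N = \<infinity>")
    case True
    then show ?thesis using P by (cases P) auto
  next
    case False
    obtain p h n g' where r: "P = ennreal p" "p \<ge> 0" "H = ennreal h" "h \<ge> 0" "N = ennreal n" "n \<ge> 0"
       "G = ennreal g'" "g' \<ge> 0"
      using P GH False by (cases P; cases H; cases N; cases G) auto
    obtain j where j: "J = ennreal j" "j \<ge> 0"
      using \<open>J + (P + H) = N + G\<close> r by (cases J) (auto simp flip: ennreal_plus)
    have "j + (p + h) = n + g'" using \<open>J + (P + H) = N + G\<close> r j
      by (simp flip: ennreal_plus)
    then show ?thesis using r j int by simp
  qed
  finally show ?thesis unfolding J_def f_def .
qed

text \<open>The contradiction device of both maximum arguments: at a maximum of \<open>u\<close>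
  plus a barrier, \<open>g\<close> dominates the decrease of the barrier along a circle, and its
  mean cannot be negative. The deficit integral is dropped and the finite value \<open>u z\<close>
  cancels.\<close>

lemma plurisubharmonic_touch:
  fixes u :: "complex^'n \<Rightarrow> ereal"
  assumes u: "plurisubharmonic_on \<Omega> u" and \<Omega>: "open \<Omega>"
    and disc: "\<And>\<tau>. cmod \<tau> \<le> 1 \<Longrightarrow> z + \<tau> *s b \<in> \<Omega>"
    and g: "(g has_integral I) {0..2*pi}" "continuous_on {0..2*pi} g"
    and fin: "u z \<noteq> -\<infinity>"
    and le: "\<And>\<theta>. \<theta> \<in> {0..2*pi} \<Longrightarrow> u (z + cis \<theta> *s b) \<le> u z + ereal (g \<theta>)"
  shows "0 \<le> I"
proof -
  have "u z \<noteq> \<infinity>" using u disc[of 0] unfolding plurisubharmonic_on_def by auto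
  with fin obtain x where x: "u z = ereal x" by (cases "u z") auto
  let ?J = "\<integral>\<^sup>+\<theta>\<in>{0..2*pi}. e2ennreal (ereal (x + g \<theta>) - u (z + cis \<theta> *s b)) \<partial>lborel"
  have "ereal (2*pi) * u z \<le> ereal (integral {0..2*pi} (\<lambda>\<theta>. x + g \<theta>)) - enn2ereal ?J"
    using le x by (intro plurisubharmonic_submean[OF u \<Omega> disc] continuous_intros g) auto
  also have "\<dots> \<le> ereal (integral {0..2*pi} (\<lambda>\<theta>. x + g \<theta>))"
    by (simp add: ereal_diff_le_self)
  also have "integral {0..2*pi} (\<lambda>\<theta>. x + g \<theta>) = 2*pi*x + I"
    using has_integral_add[OF has_integral_const_real[of x 0 "2*pi"] g(1)]
    by (simp add: integral_unique)
  finally show ?thesis using x by simp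
qed

section \<open>Mean values over circles\<close>

text \<open>Cauchy's formula at the centre, with the parameter rescaled from \<open>{0..1}\<close>
  to \<open>{0..2*pi}\<close>.\<close>

lemma holomorphic_circle_mean_value:
  fixes f :: "complex \<Rightarrow> complex"
  assumes "f holomorphic_on S" "open S" "cball 0 1 \<subseteq> S"
  shows "((\<lambda>\<theta>. f (cis \<theta>)) has_integral 2 * pi * f 0) {0..2*pi}"
proof -
  have f: "f holomorphic_on cball 0 1" using assms holomorphic_on_subset by blast
  have "((\<lambda>w. f w / (w - 0)) has_contour_integral (2 * pi * \<i> * f 0)) (circlepath 0 1)"
    using Cauchy_integral_circlepath_simple[OF f, of 0] by simp
  then have "((\<lambda>x. f (exp (2 * pi * \<i> * complex_of_real x)) * (2 * pi * \<i>)) has_integral (2 * pi * \<i> * f 0)) {0..1}"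
    unfolding has_contour_integral_def
    by (rule has_integral_eq[rotated]) 
       (simp add: vector_derivative_circlepath01, simp add: circlepath)
  then have "((\<lambda>x. f (exp (2 * pi * \<i> * complex_of_real x)) * (2 * pi * \<i>) * (1 / (2 * pi * \<i>))) has_integral (2 * pi * \<i> * f 0) * (1 / (2 * pi * \<i>))) {0..1}"
    by (rule has_integral_mult_left)
  then have "((\<lambda>x. f (exp (2 * pi * \<i> * complex_of_real x))) has_integral f 0) {0..1}"
    by simp
  then have "((\<lambda>x. f (exp (2 * pi * \<i> * complex_of_real (x * (1/(2*pi)) + 0)))) has_integral
      (1 / \<bar>1 / (2*pi)\<bar>) *\<^sub>R f 0) ((\<lambda>x. (1/(1/(2*pi))) *\<^sub>R x + - ((1/(1/(2*pi))) *\<^sub>R 0)) ` cbox 0 1)"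
    using has_integral_affinity[of "\<lambda>x::real. f (exp (2 * pi * \<i> * complex_of_real x))" "f 0" 0 1 "1/(2*pi)" 0]
    by (auto simp: cbox_interval)
  moreover have "(\<lambda>x. (1/(1/(2*pi))) *\<^sub>R x + - ((1/(1/(2*pi))) *\<^sub>R 0)) ` cbox 0 (1::real) = {0..2*pi}"
    by (auto simp: cbox_interval image_iff intro!: bexI[of _ "_ / (2*pi)"])
  ultimately show ?thesis
    by (simp add: cis_conv_exp scaleR_conv_of_real mult_ac)
qed

text \<open>For |c| < 1, the function Ln (1 + c w) is holomorphic near the closed unit disc and
  vanishes at 0; the integrand is its real part on the circle.\<close>

lemma has_integral_ln_norm_circle:
  assumes "\<bar>c\<bar> < 1"
  shows "((\<lambda>\<theta>. ln (cmod (1 + of_real c * cis \<theta>))) has_integral 0) {0..2*pi}"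
proof (cases "c = 0")
  case False
  let ?S = "ball 0 (1 / \<bar>c\<bar>) :: complex set"
  have pos: "Re (1 + of_real c * w) > 0" if "w \<in> ?S" for w
  proof -
    have "\<bar>Re (of_real c * w)\<bar> \<le> \<bar>c\<bar> * cmod w"
      using abs_Re_le_cmod[of "of_real c * w"] by (simp add: norm_mult)
    also have "\<dots> < 1" using that False by (simp add: field_simps)
    finally show ?thesis by simp
  qed
  have "(\<lambda>w. Ln (1 + of_real c * w)) holomorphic_on ?S"
    using pos by (intro holomorphic_intros) (fastforce simp: complex_nonpos_Reals_iff)
  moreover have "cball 0 1 \<subseteq> ?S"
  proof
    fix x :: complex assume "x \<in> cball 0 1"
    moreover have "1 < 1 / \<bar>c\<bar>" using assms False by (simp add: field_simps)
    ultimately show "x \<in> ?S" by simp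
  qed
  ultimately have "((\<lambda>\<theta>. Ln (1 + of_real c * cis \<theta>)) has_integral 2 * pi * Ln (1 + of_real c * 0)) {0..2*pi}"
    by (intro holomorphic_circle_mean_value[of _ ?S]) auto
  then have "((\<lambda>\<theta>. Re (Ln (1 + of_real c * cis \<theta>))) has_integral Re (2 * pi * Ln (1 + of_real c * 0))) {0..2*pi}"
    by (rule has_integral_Re)
  moreover have "Re (Ln (1 + of_real c * cis \<theta>)) = ln (cmod (1 + of_real c * cis \<theta>))" for \<theta>
  proof (subst Re_Ln)
    show "1 + of_real c * cis \<theta> \<noteq> 0"
      using pos[of "cis \<theta>"] assms False by (metis \<open>cball 0 1 \<subseteq> ?S\<close> less_irrefl mem_cball_0 norm_cis order_refl subsetD zero_complex.sel(1))
  qed simp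
  ultimately show ?thesis by simp
qed auto

lemma has_integral_cos_sin: "((\<lambda>\<theta>. c * cos \<theta> + d * sin \<theta>) has_integral 0) {0..2*pi}"
proof -
  have "((\<lambda>\<theta>. c * cos \<theta> + d * sin \<theta>) has_integral ((c * sin (2*pi) - d * cos (2*pi)) - (c * sin 0 - d * cos 0))) {0..2*pi}"
    by (intro fundamental_theorem_of_calculus)
       (auto intro!: derivative_eq_intros simp flip: has_real_derivative_iff_has_vector_derivative)
  then show ?thesis by simp
qed

lemma has_integral_cos_sq: "((\<lambda>\<theta>. (cos \<theta>)\<^sup>2) has_integral pi) {0..2*pi}"
proof -
  have "((\<lambda>\<theta>. (cos \<theta>)\<^sup>2) has_integral ((2*pi/2 + sin (2*pi) * cos (2*pi) / 2) - (0/2 + sin 0 * cos 0/2))) {0..2*pi}"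
  proof (intro fundamental_theorem_of_calculus)
    fix x assume "x \<in> {0..2*pi}"
    have "((\<lambda>x. x/2 + sin x * cos x / 2) has_real_derivative (cos x)\<^sup>2) (at x within {0..2*pi})"
    proof -
      have eq: "1/2 + (cos x * cos x + (- sin x) * sin x) / 2 = (cos x)\<^sup>2"
        using sin_cos_squared_add[of x] unfolding power2_eq_square by argo
      have "((\<lambda>x. x/2 + sin x * cos x / 2) has_real_derivative
          1/2 + (cos x * cos x + (- sin x) * sin x) / 2) (at x within {0..2*pi})"
        by (auto intro!: derivative_eq_intros)
      then show ?thesis unfolding eq .
    qed
    then show "((\<lambda>x. x/2 + sin x * cos x / 2) has_vector_derivative (cos x)\<^sup>2) (at x within {0..2*pi})"
      by (simp add: has_real_derivative_iff_has_vector_derivative)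
  qed auto
  then show ?thesis by simp
qed

text \<open>With c = \<rho> a_j, division by a_j makes the first-order term \<rho> cos \<theta> the
  same for all coordinates; only the quadratic error distinguishes them.\<close>

lemma ln_norm_approx:
  assumes "\<bar>c\<bar> \<le> 1/2"
  shows "\<bar>ln (cmod (1 + of_real c * cis \<theta>)) - c * cos \<theta>\<bar> \<le> 2 * c\<^sup>2"
proof -
  let ?w = "of_real c * cis \<theta>"
  have w: "cmod ?w = \<bar>c\<bar>" by (simp add: norm_mult)
  have nz: "1 + ?w \<noteq> 0"
  proof
    assume "1 + ?w = 0"
    then have "cmod ?w = 1" by (metis add_eq_0_iff norm_minus_cancel norm_one)
    then show False using w assms by simp
  qed
  have "cmod (ln (1 + ?w) - ?w) \<le> (cmod ?w)\<^sup>2 / (1 - cmod ?w)"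
    using w assms by (intro Ln_approx_linear) auto
  also have "\<dots> \<le> c\<^sup>2 / (1/2)"
    using w assms by (intro frac_le) auto
  finally have "\<bar>Re (ln (1 + ?w) - ?w)\<bar> \<le> 2 * c\<^sup>2"
    using abs_Re_le_cmod order_trans by fastforce
  then show ?thesis using nz by simp
qed

section \<open>The three polydiscs theorem\<close>

text \<open>The parameter \<open>s\<close> is a logarithmic scale, with radii r powr a_j for s = ln
  r. In this variable the suprema are convex, and weights 1 with s = ln \<rho> give the isotropic
  polydisc of radius \<rho>.\<close>

definition open_polydisc :: "complex^'n \<Rightarrow> real^'n \<Rightarrow> real \<Rightarrow> (complex^'n) set" where
  "open_polydisc x a s = {z. \<forall>j. cmod (z $ j - x $ j) < exp (s * a $ j)}"

definition closed_polydisc :: "complex^'n \<Rightarrow> real^'n \<Rightarrow> real \<Rightarrow> (complex^'n) set" where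
  "closed_polydisc x a s = {z. \<forall>j. cmod (z $ j - x $ j) \<le> exp (s * a $ j)}"

lemma open_open_polydisc: "open (open_polydisc x a s)"
proof -
  have "open_polydisc x a s = (\<Inter>j. {z. cmod (z $ j - x $ j) < exp (s * a $ j)})"
    by (auto simp: open_polydisc_def)
  then show ?thesis by (auto intro!: open_INT open_Collect_less continuous_intros)
qed

lemma compact_closed_polydisc: "compact (closed_polydisc x a s)"
proof -
  have "closed_polydisc x a s = (\<Inter>j. {z. cmod (z $ j - x $ j) \<le> exp (s * a $ j)})"
    by (auto simp: closed_polydisc_def)
  then have cl: "closed (closed_polydisc x a s)"
    by (auto intro!: closed_INT closed_Collect_le continuous_intros)
  have "closed_polydisc x a s \<subseteq> cball x (\<Sum>j\<in>UNIV. exp (s * a $ j))"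
  proof
    fix z assume z: "z \<in> closed_polydisc x a s"
    have "norm (z - x) \<le> (\<Sum>j\<in>UNIV. cmod ((z - x) $ j))"
      unfolding norm_vec_def by (rule L2_set_le_sum) auto
    also have "\<dots> \<le> (\<Sum>j\<in>UNIV. exp (s * a $ j))"
      using z by (intro sum_mono) (auto simp: closed_polydisc_def)
    finally show "z \<in> cball x (\<Sum>j\<in>UNIV. exp (s * a $ j))"
      by (simp add: dist_norm norm_minus_commute)
  qed
  then show ?thesis using cl bounded_subset[OF bounded_cball] compact_eq_bounded_closed by blast
qed

lemma open_polydisc_mono:
  assumes "\<And>j. 0 < a $ j" "s \<le> t"
  shows "open_polydisc x a s \<subseteq> open_polydisc x a t"
proof -
  have "exp (s * a $ j) \<le> exp (t * a $ j)" for j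
    using assms(1)[of j] assms(2) by (simp add: mult_right_mono)
  then show ?thesis unfolding open_polydisc_def by (auto intro: less_le_trans)
qed

lemma closed_polydisc_subset_open:
  assumes "\<And>j. 0 < a $ j" "s < t"
  shows "closed_polydisc x a s \<subseteq> open_polydisc x a t"
proof -
  have "exp (s * a $ j) < exp (t * a $ j)" for j
    using assms(1)[of j] assms(2) by simp
  then show ?thesis unfolding open_polydisc_def closed_polydisc_def by (auto intro: le_less_trans)
qed

lemma open_polydisc_subset_closed: "open_polydisc x a s \<subseteq> closed_polydisc x a s"
  by (auto simp: open_polydisc_def closed_polydisc_def less_imp_le)

lemma open_polydisc_shrink:
  assumes z: "z \<in> open_polydisc x a s"
  obtains \<eta> where "\<eta> > 0" "z \<in> open_polydisc x a (s - \<eta>)"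
proof -
  have "\<forall>\<^sub>F \<eta> in at_right (0::real). \<forall>j. cmod (z $ j - x $ j) < exp ((s - \<eta>) * a $ j)"
  proof (rule eventually_all_finite)
    fix j
    have "((\<lambda>\<eta>. exp ((s - \<eta>) * a $ j)) \<longlongrightarrow> exp ((s - 0) * a $ j)) (at_right 0)"
      by (intro tendsto_intros)
    then show "\<forall>\<^sub>F \<eta> in at_right 0. cmod (z $ j - x $ j) < exp ((s - \<eta>) * a $ j)"
      using z by (intro order_tendstoD(1)) (auto simp: open_polydisc_def)
  qed
  moreover have "\<forall>\<^sub>F \<eta> in at_right (0::real). \<eta> > 0" by (rule eventually_at_right_less)
  ultimately have "\<forall>\<^sub>F \<eta> in at_right (0::real). \<eta> > 0 \<and> z \<in> open_polydisc x a (s - \<eta>)"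
    by eventually_elim (auto simp: open_polydisc_def)
  then show thesis using that by (auto dest!: eventually_happens)
qed

text \<open>Adding a small multiple of the strictly plurisubharmonic function \<open>|z - x|\<^sup>2\<close> forces the maximum
  over the closed polydisc to lie on the torus.\<close>

lemma plurisubharmonic_max_torus:
  fixes u :: "complex^'n \<Rightarrow> ereal"
  assumes u: "plurisubharmonic_on \<Omega> u" and \<Omega>: "open \<Omega>" "closed_polydisc x a s \<subseteq> \<Omega>"
    and z: "z \<in> closed_polydisc x a s" "ereal c < u z"
  obtains p where "\<And>j. cmod (p $ j - x $ j) = exp (s * a $ j)" "ereal c < u p"
proof -
  have usc: "upper_semicontinuous_on \<Omega> u" and fin: "\<And>z. z \<in> \<Omega> \<Longrightarrow> u z \<noteq> \<infinity>"
    using u unfolding plurisubharmonic_on_def by auto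
  have "u z \<noteq> \<infinity>" using fin z \<Omega> by auto
  then obtain w where w: "u z = ereal w" "c < w" using z(2) by (cases "u z") auto
  define B where "B = (\<Sum>j\<in>UNIV. (exp (s * a $ j))\<^sup>2)"
  have B: "B \<ge> 0" unfolding B_def by (intro sum_nonneg) auto
  \<comment> \<open>\<open>B\<close> bounds |z - x|^2 on the closed polydisc, so the perturbation
    stays within half of the gap \<open>w - c\<close>, and the maximum point still has a value above
    \<open>c\<close>.\<close>
  define \<delta> where "\<delta> = (w - c) / (2 * (B + 1))"
  have \<delta>: "\<delta> > 0" "\<delta> * B < w - c"
  proof -
    show "\<delta> > 0" using w B by (simp add: \<delta>_def)
    have "\<delta> * B \<le> \<delta> * (B + 1)" using \<open>\<delta> > 0\<close> by simp
    also have "\<dots> = (w - c) / 2" using B by (simp add: \<delta>_def field_simps)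
    finally show "\<delta> * B < w - c" using w by simp
  qed
  define g where "g z = \<delta> * (\<Sum>j\<in>UNIV. (cmod (z $ j - x $ j))\<^sup>2)" for z :: "complex^'n"
  have gc: "continuous_on K g" for K unfolding g_def by (intro continuous_intros)
  obtain p where p: "p \<in> closed_polydisc x a s"
    and max: "\<And>z. z \<in> closed_polydisc x a s \<Longrightarrow> u z + ereal (g z) \<le> u p + ereal (g p)"
    using usc_attains_sup[OF compact_closed_polydisc _ \<Omega>(2) usc fin gc] z(1) by blast
  have "u p \<noteq> \<infinity>" using fin p \<Omega> by auto
  moreover have up: "ereal w \<le> u p + ereal (g p)"
  proof -
    have "ereal w \<le> u z + ereal (g z)"
      using w \<delta> by (auto simp: g_def intro!: mult_nonneg_nonneg sum_nonneg)
    then show ?thesis using max[OF z(1)] by simp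
  qed
  ultimately obtain v where v: "u p = ereal v" by (cases "u p") auto
  have "g p \<le> \<delta> * B" unfolding g_def B_def
    using \<delta> p by (intro mult_left_mono sum_mono power_mono) (auto simp: closed_polydisc_def)
  then have "c < v" using up v \<delta> by simp
  moreover have "cmod (p $ j - x $ j) = exp (s * a $ j)" for j
  proof (rule ccontr)
    assume *: "cmod (p $ j - x $ j) \<noteq> exp (s * a $ j)"
    define \<rho> where "\<rho> = exp (s * a $ j) - cmod (p $ j - x $ j)"
    have \<rho>: "\<rho> > 0" using * p unfolding \<rho>_def closed_polydisc_def by (auto simp: less_le)
    \<comment> \<open>Only the coordinate that is off its circle is moved, over a circle of radius
      \<rho> that stays in its disc. The mean of |z - x|^2 over it exceeds the value at
      \<open>p\<close> by \<rho>^2, since the first-order terms average out.\<close>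
    define b :: "complex^'n" where "b = axis j (of_real \<rho>)"
    have in_pd: "p + \<tau> *s b \<in> closed_polydisc x a s" if "cmod \<tau> \<le> 1" for \<tau>
      unfolding closed_polydisc_def
    proof (intro CollectI allI)
      fix i
      show "cmod ((p + \<tau> *s b) $ i - x $ i) \<le> exp (s * a $ i)"
      proof (cases "i = j")
        case True
        have "cmod ((p + \<tau> *s b) $ i - x $ i) = cmod ((p $ j - x $ j) + \<tau> * of_real \<rho>)"
          using True by (simp add: b_def axis_def algebra_simps)
        also have "\<dots> \<le> cmod (p $ j - x $ j) + cmod \<tau> * \<rho>"
          using norm_triangle_ineq[of "p $ j - x $ j" "\<tau> * of_real \<rho>"] \<rho> by (simp add: norm_mult)
        also have "\<dots> \<le> cmod (p $ j - x $ j) + 1 * \<rho>"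
          using that \<rho> by (intro add_left_mono mult_right_mono) auto
        finally show ?thesis using True by (simp add: \<rho>_def)
      next
        case False
        then show ?thesis using p by (simp add: b_def axis_def closed_polydisc_def)
      qed
    qed
    let ?w = "p $ j - x $ j"
    define c1 where "c1 = - 2 * \<delta> * \<rho> * Re ?w"
    define c2 where "c2 = - 2 * \<delta> * \<rho> * Im ?w"
    have diff: "g p - g (p + cis \<theta> *s b) = (c1 * cos \<theta> + c2 * sin \<theta>) + - \<delta> * \<rho>\<^sup>2" for \<theta>
    proof -
      have "(\<Sum>i\<in>UNIV. (cmod ((p + cis \<theta> *s b) $ i - x $ i))\<^sup>2) =
          (cmod (?w + cis \<theta> * of_real \<rho>))\<^sup>2 + (\<Sum>i\<in>UNIV-{j}. (cmod (p $ i - x $ i))\<^sup>2)"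
        by (subst sum.remove[of _ j]) (auto simp: b_def axis_def algebra_simps intro!: sum.cong)
      moreover have "(\<Sum>i\<in>UNIV. (cmod (p $ i - x $ i))\<^sup>2) =
          (cmod ?w)\<^sup>2 + (\<Sum>i\<in>UNIV-{j}. (cmod (p $ i - x $ i))\<^sup>2)"
        by (subst sum.remove[of _ j]) auto
      ultimately have "g p - g (p + cis \<theta> *s b) = \<delta> * ((cmod ?w)\<^sup>2 - (cmod (?w + cis \<theta> * of_real \<rho>))\<^sup>2)"
        by (simp add: g_def algebra_simps)
      also have "(cmod (?w + cis \<theta> * of_real \<rho>))\<^sup>2 =
          (cmod ?w)\<^sup>2 + 2 * \<rho> * (Re ?w * cos \<theta> + Im ?w * sin \<theta>) + \<rho>\<^sup>2 * ((sin \<theta>)\<^sup>2 + (cos \<theta>)\<^sup>2)"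
        unfolding cmod_power2 unfolding power2_eq_square
        by (simp add: algebra_simps del: sin_cos_squared_add3)
      finally show ?thesis by (simp add: c1_def c2_def algebra_simps)
    qed
    have "0 \<le> 0 + (2 * pi - 0) *\<^sub>R (- \<delta> * \<rho>\<^sup>2)"
    proof (rule plurisubharmonic_touch[OF u \<Omega>(1)])
      show "p + \<tau> *s b \<in> \<Omega>" if "cmod \<tau> \<le> 1" for \<tau> using in_pd[OF that] \<Omega> by auto
      show "((\<lambda>\<theta>. (c1 * cos \<theta> + c2 * sin \<theta>) + - \<delta> * \<rho>\<^sup>2) has_integral
         0 + (2 * pi - 0) *\<^sub>R (- \<delta> * \<rho>\<^sup>2)) {0..2*pi}"
        using has_integral_const_real[of "- \<delta> * \<rho>\<^sup>2" 0 "2*pi"]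
        by (intro has_integral_add has_integral_cos_sin) simp
      show "u p \<noteq> -\<infinity>" using v by simp
      fix \<theta> assume "\<theta> \<in> {0..2*pi}"
      have "u (p + cis \<theta> *s b) + ereal (g (p + cis \<theta> *s b)) \<le> u p + ereal (g p)"
        by (intro max in_pd) simp
      then have "u (p + cis \<theta> *s b) \<le> u p + ereal (g p - g (p + cis \<theta> *s b))"
        using v by (cases "u (p + cis \<theta> *s b)") auto
      then show "u (p + cis \<theta> *s b) \<le> u p + ereal ((c1 * cos \<theta> + c2 * sin \<theta>) + - \<delta> * \<rho>\<^sup>2)"
        unfolding diff .
    qed (intro continuous_intros)
    then have "2 * pi * (\<delta> * \<rho>\<^sup>2) \<le> 0" by simp
    moreover have "2 * pi * (\<delta> * \<rho>\<^sup>2) > 0" using \<delta> \<rho> by simp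
    ultimately show False by simp
  qed
  ultimately show thesis using that[of p] v by simp
qed

text \<open>A Hadamard three circles theorem for arbitrary real weights \<open>a\<close>. Let \<open>X = ln |z\<^sub>k - x\<^sub>k| / a\<^sub>k\<close> and
  \<open>y\<^sub>j = ln |z\<^sub>j - x\<^sub>j| / a\<^sub>j - X\<close>. If the claim fails, then \<open>u\<close> minus the chord \<open>l X\<close>, plus a small multiple of
  \<open>(X - s\<^sub>0) (X - s\<^sub>2)\<close>, minus a large multiple of \<open>\<Sum> y\<^sub>j\<^sup>2\<close>, has an interior maximum at some \<open>q\<close>. On a small
  circle in the direction \<open>(a\<^sub>j (q\<^sub>j - x\<^sub>j))\<^sub>j\<close>, the increments of \<open>X\<close> and \<open>y\<^sub>j\<close> have mean 0, and those of
  the \<open>y\<^sub>j\<close> are of second order in the radius, which contradicts the submean inequality.\<close>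

lemma plurisubharmonic_three_polydiscs:
  fixes u :: "complex^'n \<Rightarrow> ereal"
  assumes u: "plurisubharmonic_on \<Omega> u" and \<Omega>: "open \<Omega>" "open_polydisc x a \<sigma>\<^sub>2 \<subseteq> \<Omega>"
    and a: "\<And>j. 0 < a $ j" and \<sigma>: "\<sigma>\<^sub>0 < \<sigma>\<^sub>1" "\<sigma>\<^sub>1 < \<sigma>\<^sub>2"
    and le0: "\<And>z. z \<in> open_polydisc x a \<sigma>\<^sub>0 \<Longrightarrow> u z \<le> ereal (\<alpha> * \<sigma>\<^sub>0 + \<beta>)"
    and le2: "\<And>z. z \<in> open_polydisc x a \<sigma>\<^sub>2 \<Longrightarrow> u z \<le> ereal (\<alpha> * \<sigma>\<^sub>2 + \<beta>)"
    and z: "z \<in> open_polydisc x a \<sigma>\<^sub>1"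
  shows "u z \<le> ereal (\<alpha> * \<sigma>\<^sub>1 + \<beta>)"
proof (rule ccontr)
  assume "\<not> ?thesis"
  then have zgt: "ereal (\<alpha> * \<sigma>\<^sub>1 + \<beta>) < u z" by simp
  have usc: "upper_semicontinuous_on \<Omega> u" and fin: "\<And>z. z \<in> \<Omega> \<Longrightarrow> u z \<noteq> \<infinity>"
    using u unfolding plurisubharmonic_on_def by auto
  obtain \<eta> where \<eta>: "\<eta> > 0" "z \<in> open_polydisc x a (\<sigma>\<^sub>1 - \<eta>)"
    using open_polydisc_shrink[OF z] .
  \<comment> \<open>Lowering the three scales by \<eta> gives room for the y_j: with |y_j| \<le>
    \<eta>/2, points with X = s0 or X = s2 still lie in the open polydiscs where \<open>le0\<close>
    and \<open>le2\<close> apply. The chord \<open>l\<close> is shifted by the same \<eta>.\<close>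
  define s0 s1 s2 where s: "s0 = \<sigma>\<^sub>0 - \<eta>" "s1 = \<sigma>\<^sub>1 - \<eta>" "s2 = \<sigma>\<^sub>2 - \<eta>"
  have s012: "s0 < s1" "s1 < s2" using \<sigma> s by auto
  have "closed_polydisc x a s1 \<subseteq> \<Omega>"
    using closed_polydisc_subset_open[OF a, of s1 \<sigma>\<^sub>2 x] \<Omega> s \<sigma> \<eta> by auto
  moreover have "z \<in> closed_polydisc x a s1" using \<eta>(2) open_polydisc_subset_closed s by blast
  \<comment> \<open>On the torus all \<open>L j\<close> equal \<open>s1\<close>, so the penalty in
    the y_j vanishes at \<open>p\<close>.\<close>
  ultimately obtain p where p: "\<And>j. cmod (p $ j - x $ j) = exp (s1 * a $ j)"
    and pgt: "ereal (\<alpha> * \<sigma>\<^sub>1 + \<beta>) < u p"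
    using plurisubharmonic_max_torus[OF u \<Omega>(1) _ _ zgt] by metis
  have "p \<in> closed_polydisc x a s1" using p by (simp add: closed_polydisc_def)
  then have "u p \<noteq> \<infinity>" using \<open>closed_polydisc x a s1 \<subseteq> \<Omega>\<close> fin by auto
  then obtain w where w: "u p = ereal w" "\<alpha> * \<sigma>\<^sub>1 + \<beta> < w" using pgt by (cases "u p") auto

  \<comment> \<open>Logarithmic coordinates and the compact region of comparison\<close>
  obtain k :: 'n where True by auto
  define L where "L j z = ln (cmod (z $ j - x $ j)) / a $ j" for j and z :: "complex^'n"
  define X where "X = L k"
  define y where "y j z = L j z - X z" for j z
  \<comment> \<open>The lower bound keeps the logarithms away from their singularity. The bounds of
    \<open>K1\<close> follow from those on X and the y_j (this is \<open>KI\<close>), so only the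
    faces of \<open>K\<close> in X and the y_j have to be excluded later.\<close>
  define K1 where "K1 = {z. \<forall>j. exp ((s0 - \<eta>) * a $ j) \<le> cmod (z $ j - x $ j)} \<inter> closed_polydisc x a (s2 + \<eta>/2)"
  define K where "K = {z \<in> K1. s0 \<le> X z \<and> X z \<le> s2 \<and> (\<forall>j. \<bar>y j z\<bar> \<le> \<eta>/2)}"
  have Lc: "continuous_on K1 (L j)" for j
  proof -
    have "z $ j - x $ j \<noteq> 0" if "z \<in> K1" for z
    proof -
      have "0 < exp ((s0 - \<eta>) * a $ j)" by simp
      also have "\<dots> \<le> cmod (z $ j - x $ j)" using that unfolding K1_def by auto
      finally show ?thesis by auto
    qed
    then show ?thesis unfolding L_def using less_imp_neq[OF a] by (intro continuous_intros) auto
  qed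
  have K1: "compact K1"
  proof -
    have "{z. \<forall>j. exp ((s0 - \<eta>) * a $ j) \<le> cmod (z $ j - x $ j)} =
       (\<Inter>j. {z. exp ((s0 - \<eta>) * a $ j) \<le> cmod (z $ j - x $ j)})" by auto
    then have "closed {z. \<forall>j. exp ((s0 - \<eta>) * a $ j) \<le> cmod (z $ j - x $ j)}"
      by (auto intro!: closed_INT closed_Collect_le continuous_intros)
    then show ?thesis unfolding K1_def by (intro closed_Int_compact compact_closed_polydisc)
  qed
  have K: "compact K"
  proof -
    have "K = (K1 \<inter> X -` {s0..s2}) \<inter> (\<Inter>j. K1 \<inter> (\<lambda>z. y j z) -` {-(\<eta>/2)..\<eta>/2})"
    proof -
      have "\<bar>t\<bar> \<le> \<eta>/2 \<longleftrightarrow> t \<in> {-(\<eta>/2)..\<eta>/2}" for t :: real by auto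
      then show ?thesis unfolding K_def by auto
    qed
    moreover have "closed (K1 \<inter> X -` {s0..s2})"
      unfolding X_def using K1 Lc by (intro continuous_closed_preimage compact_imp_closed) auto
    moreover have "closed (\<Inter>j. K1 \<inter> (\<lambda>z. y j z) -` {-(\<eta>/2)..\<eta>/2})"
      unfolding y_def X_def using K1 Lc
      by (intro closed_INT ballI continuous_closed_preimage compact_imp_closed continuous_intros) auto
    ultimately have "closed K" by auto
    moreover have "K = K1 \<inter> K" by (auto simp: K_def)
    ultimately show ?thesis using K1 compact_Int_closed by metis
  qed
  have norm_L: "cmod (z $ j - x $ j) = exp (L j z * a $ j)" if "z $ j \<noteq> x $ j" for z j
    using that a[of j] unfolding L_def by simp
  have KI: "z \<in> K" if "\<And>j. z $ j \<noteq> x $ j" "s0 \<le> X z" "X z \<le> s2" "\<And>j. \<bar>y j z\<bar> \<le> \<eta>/2" for z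
  proof -
    have "L j z \<ge> s0 - \<eta>" "L j z \<le> s2 + \<eta>/2" for j
      using that(4)[of j] that(2,3) \<eta>(1) unfolding y_def by linarith+
    then have "(s0 - \<eta>) * a $ j \<le> L j z * a $ j" "L j z * a $ j \<le> (s2 + \<eta>/2) * a $ j" for j
      using less_imp_le[OF a[of j]] by (auto intro!: mult_right_mono)
    then show ?thesis using that norm_L unfolding K_def K1_def closed_polydisc_def by auto
  qed
  have Knz: "z $ j \<noteq> x $ j" if "z \<in> K" for z j
  proof
    assume "z $ j = x $ j"
    moreover have "0 < exp ((s0 - \<eta>) * a $ j)" by simp
    ultimately show False using that unfolding K_def K1_def by (auto simp: not_le dest!: spec[of _ j])
  qed
  have Kpd: "z \<in> open_polydisc x a \<sigma>" if "z \<in> K" "X z + \<eta>/2 < \<sigma>" for z \<sigma>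
  proof -
    have "L j z * a $ j < \<sigma> * a $ j" for j
    proof -
      have "\<bar>y j z\<bar> \<le> \<eta>/2" using that(1) unfolding K_def by auto
      then have "L j z < \<sigma>" using that(2) unfolding y_def by linarith
      then show ?thesis using a[of j] by simp
    qed
    then show ?thesis unfolding open_polydisc_def using norm_L[OF Knz[OF that(1)]] by auto
  qed
  have K\<Omega>: "K \<subseteq> open_polydisc x a \<sigma>\<^sub>2"
  proof
    fix z assume "z \<in> K"
    moreover from this have "X z + \<eta>/2 < \<sigma>\<^sub>2" using s \<eta> unfolding K_def by auto
    ultimately show "z \<in> open_polydisc x a \<sigma>\<^sub>2" by (rule Kpd)
  qed
  \<comment> \<open>At X = s1 the quadratic term costs \<delta> (s1 - s0) (s2 - s1), which this
    choice makes half of the amount by which \<open>u p\<close> exceeds the chord.\<close>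
  define \<delta> where "\<delta> = (w - (\<alpha> * \<sigma>\<^sub>1 + \<beta>)) / (2 * ((s1 - s0) * (s2 - s1)))"
  have \<delta>: "\<delta> > 0" "\<delta> * ((s1 - s0) * (s2 - s1)) < w - (\<alpha> * \<sigma>\<^sub>1 + \<beta>)"
  proof -
    show "\<delta> > 0" unfolding \<delta>_def using w s012 by (intro divide_pos_pos) auto
    have "\<delta> * ((s1 - s0) * (s2 - s1)) = (w - (\<alpha> * \<sigma>\<^sub>1 + \<beta>)) / 2" unfolding \<delta>_def using s012 by simp
    then show "\<delta> * ((s1 - s0) * (s2 - s1)) < w - (\<alpha> * \<sigma>\<^sub>1 + \<beta>)" using w by simp
  qed
  \<comment> \<open>\<open>B\<close> bounds the variation of the chord over [s0, s2], and
    \<open>C\<close> makes the penalty at |y_j| = \<eta>/2 equal to \<open>B\<close>.\<close>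
  define B where "B = \<bar>\<alpha>\<bar> * (s2 - s0)"
  define C where "C = 4 * B / \<eta>\<^sup>2"
  have B: "B \<ge> 0" and C: "C \<ge> 0" "C * (\<eta>/2)\<^sup>2 = B"
    unfolding B_def C_def using s012 \<eta>(1) by (auto simp: power2_eq_square)
  define l where "l t = \<alpha> * (t + \<eta>) + \<beta>" for t
  define g where "g z = \<delta> * ((X z - s0) * (X z - s2)) - l (X z) - C * (\<Sum>j\<in>UNIV. (y j z)\<^sup>2)" for z
  have gc: "continuous_on K g"
  proof -
    have "continuous_on K (L j)" for j using Lc by (rule continuous_on_subset) (auto simp: K_def)
    then show ?thesis unfolding g_def l_def y_def X_def by (intro continuous_intros) auto
  qed
  have pL: "L j p = s1" for j unfolding L_def p using a[of j] by simp
  have pK: "p \<in> K"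
  proof (rule KI)
    show "p $ j \<noteq> x $ j" for j using p[of j] by (metis diff_self exp_not_eq_zero norm_zero)
  qed (use pL s012 \<eta>(1) in \<open>auto simp: X_def y_def\<close>)
  have gp: "g p = \<delta> * ((s1 - s0) * (s1 - s2)) - (\<alpha> * \<sigma>\<^sub>1 + \<beta>)"
    using pL by (simp add: g_def X_def y_def l_def s)
  obtain q where q: "q \<in> K" and max: "\<And>z. z \<in> K \<Longrightarrow> u z + ereal (g z) \<le> u q + ereal (g q)"
    using usc_attains_sup[OF K _ _ usc fin gc] pK K\<Omega> \<Omega> by blast
  have "0 < w + g p" using \<delta>(2) unfolding gp by (simp add: algebra_simps)
  then have "0 < ereal (w + g p)" by simp
  also have "\<dots> \<le> u q + ereal (g q)" using max[OF pK] w by simp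
  finally have pos: "0 < u q + ereal (g q)" .
  have "u q \<noteq> \<infinity>" using q K\<Omega> \<Omega> fin by auto
  then obtain v where v: "u q = ereal v" using pos by (cases "u q") auto
  have vg: "v + g q > 0" using pos v by simp
  have Xq: "s0 \<le> X q" "X q \<le> s2" and yq: "\<And>j. \<bar>y j q\<bar> \<le> \<eta>/2" using q by (auto simp: K_def)
  have gle: "g q \<le> - l (X q) - C * (y j q)\<^sup>2" for j
  proof -
    have "\<delta> * ((X q - s0) * (X q - s2)) \<le> 0"
      using \<delta> Xq by (intro mult_nonneg_nonpos) auto
    moreover have "(y j q)\<^sup>2 \<le> (\<Sum>j\<in>UNIV. (y j q)\<^sup>2)"
      by (rule member_le_sum) auto
    ultimately show ?thesis using C(1) unfolding g_def
      by (smt (verit) mult_left_mono)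
  qed
  \<comment> \<open>A maximum on a face of \<open>K\<close> would violate
    \<open>v + g q > 0\<close>: for X = s0 and X = s2, \<open>u\<close> is below the chord by
    hypothesis, and for |y_j| = \<eta>/2 the penalty offsets the variation of the chord.\<close>
  have X0: "s0 < X q"
  proof (rule ccontr)
    assume "\<not> ?thesis"
    then have "X q = s0" using Xq by simp
    then have "u q \<le> ereal (\<alpha> * \<sigma>\<^sub>0 + \<beta>)" using q \<eta> s by (intro le0 Kpd) auto
    then show False using vg gle[of k] \<open>X q = s0\<close> v C by (simp add: l_def s y_def X_def)
  qed
  have X2: "X q < s2"
  proof (rule ccontr)
    assume "\<not> ?thesis"
    then have "X q = s2" using Xq by simp
    moreover have "u q \<le> ereal (\<alpha> * \<sigma>\<^sub>2 + \<beta>)" using q K\<Omega> by (intro le2) auto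
    ultimately show False using vg gle[of k] v C by (simp add: l_def s y_def X_def)
  qed
  have y2: "\<bar>y j q\<bar> < \<eta>/2" for j
  proof (rule ccontr)
    assume "\<not> ?thesis"
    then have "\<bar>y j q\<bar> = \<eta>/2" using yq[of j] by simp
    then have "(y j q)\<^sup>2 = (\<eta>/2)\<^sup>2" by (metis power2_abs)
    moreover have "u q \<le> ereal (\<alpha> * \<sigma>\<^sub>2 + \<beta>)" using q K\<Omega> by (intro le2) auto
    ultimately have "0 < \<alpha> * \<sigma>\<^sub>2 + \<beta> - l (X q) - B" using vg gle[of j] v C by simp
    also have "\<alpha> * \<sigma>\<^sub>2 + \<beta> - l (X q) = \<alpha> * (s2 - X q)" by (simp add: l_def s algebra_simps)
    also have "\<dots> \<le> \<bar>\<alpha>\<bar> * (s2 - s0)" using Xq by (intro mult_mono) auto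
    finally show False by (simp add: B_def)
  qed

  \<comment> \<open>Perturbation along a small circle around the interior maximum\<close>
  define A where "A = (\<Sum>j\<in>UNIV. a $ j)"
  have aA: "a $ j \<le> A" for j unfolding A_def using a by (intro member_le_sum) (auto simp: less_imp_le)
  \<comment> \<open>\<open>D\<close> collects the errors of order \<rho>^4: the first term from
    replacing \<Lambda>_k by \<rho> cos \<theta>, the second from the penalty. The gain has mean
    \<delta> \<rho>^2 / 4, so it wins once 4 D \<rho>^2 < \<delta>.\<close>
  define D where "D = 4 * \<delta> * A\<^sup>2 + C * (\<Sum>j\<in>(UNIV::'n set). 16 * A\<^sup>2)"
  obtain \<rho> where \<rho>: "\<rho> > 0" "\<rho> * A < 1/2" "\<rho> < \<eta>/2" "2 * \<rho> < X q - s0" "2 * \<rho> < s2 - X q"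
     "\<And>j. 4 * A * \<rho>\<^sup>2 < \<eta>/2 - \<bar>y j q\<bar>" "4 * D * \<rho>\<^sup>2 < \<delta>"
  proof -
    have ev: "\<forall>\<^sub>F \<rho> in at_right (0::real). c * \<rho> < d" "\<forall>\<^sub>F \<rho> in at_right (0::real). c * \<rho>\<^sup>2 < d"
      if "d > 0" for c d
    proof -
      have "((\<lambda>\<rho>. c * \<rho>) \<longlongrightarrow> c * 0) (at_right 0)" "((\<lambda>\<rho>. c * \<rho>\<^sup>2) \<longlongrightarrow> c * 0\<^sup>2) (at_right 0)"
        by (intro tendsto_intros)+
      then show "\<forall>\<^sub>F \<rho> in at_right (0::real). c * \<rho> < d" "\<forall>\<^sub>F \<rho> in at_right (0::real). c * \<rho>\<^sup>2 < d"
        using that by (auto intro: order_tendstoD(2))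
    qed
    have "\<forall>\<^sub>F \<rho> in at_right (0::real). \<forall>j. 4 * A * \<rho>\<^sup>2 < \<eta>/2 - \<bar>y j q\<bar>"
      using y2 by (intro eventually_all_finite ev) auto
    moreover have "\<forall>\<^sub>F \<rho> in at_right (0::real). \<rho> > 0" by (rule eventually_at_right_less)
    moreover have "\<forall>\<^sub>F \<rho> in at_right (0::real). A * \<rho> < 1/2" by (rule ev) simp
    moreover have "\<forall>\<^sub>F \<rho> in at_right (0::real). 1 * \<rho> < \<eta>/2" using \<eta>(1) by (intro ev) simp
    moreover have "\<forall>\<^sub>F \<rho> in at_right (0::real). 2 * \<rho> < X q - s0" using X0 by (intro ev) simp
    moreover have "\<forall>\<^sub>F \<rho> in at_right (0::real). 2 * \<rho> < s2 - X q" using X2 by (intro ev) simp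
    moreover have "\<forall>\<^sub>F \<rho> in at_right (0::real). 4 * D * \<rho>\<^sup>2 < \<delta>" using \<delta> by (intro ev) simp
    ultimately have "\<forall>\<^sub>F \<rho> in at_right (0::real). \<rho> > 0 \<and> \<rho> * A < 1/2 \<and> \<rho> < \<eta>/2 \<and> 2 * \<rho> < X q - s0 \<and>
        2 * \<rho> < s2 - X q \<and> (\<forall>j. 4 * A * \<rho>\<^sup>2 < \<eta>/2 - \<bar>y j q\<bar>) \<and> 4 * D * \<rho>\<^sup>2 < \<delta>"
      by eventually_elim (auto simp: mult.commute)
    then show thesis using that by (auto dest!: eventually_happens)
  qed
  \<comment> \<open>Moving by \<tau> b multiplies the j-th entry of q - x by 1 + \<rho> a_j \<tau>.
    To first order every \<open>L j\<close> changes by \<rho> Re \<tau>, which cancels in the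
    y_j.\<close>
  define b :: "complex^'n" where "b = (\<chi> j. of_real (\<rho> * a $ j) * (q $ j - x $ j))"
  have qb: "(q + \<tau> *s b) $ j - x $ j = (q $ j - x $ j) * (1 + of_real (\<rho> * a $ j) * \<tau>)" for \<tau> j
    by (simp add: b_def algebra_simps)
  define \<Lambda> where "\<Lambda> j \<theta> = ln (cmod (1 + of_real (\<rho> * a $ j) * cis \<theta>)) / a $ j" for j \<theta>
  have \<rho>a: "0 < \<rho> * a $ j" "\<rho> * a $ j < 1/2" for j
    using \<rho>(1,2) a[of j] mult_left_mono[OF aA[of j], of \<rho>] by (simp, linarith)
  have nz: "1 + of_real (\<rho> * a $ j) * cis \<theta> \<noteq> 0" for j \<theta>
  proof
    assume "1 + of_real (\<rho> * a $ j) * cis \<theta> = 0"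
    then have "cmod (of_real (\<rho> * a $ j) * cis \<theta>) = 1" by (metis add_eq_0_iff norm_minus_cancel norm_one)
    then show False using \<rho>a[of j] by (simp add: norm_mult)
  qed
  have L\<Lambda>: "L j (q + cis \<theta> *s b) = L j q + \<Lambda> j \<theta>" for j \<theta>
    using Knz[OF q, of j] nz[of j \<theta>] unfolding L_def qb \<Lambda>_def
    by (simp add: norm_mult ln_mult add_divide_distrib)
  have \<Lambda>1: "\<bar>\<Lambda> j \<theta> - \<rho> * cos \<theta>\<bar> \<le> 2 * A * \<rho>\<^sup>2" for j \<theta>
  proof -
    have "\<bar>\<Lambda> j \<theta> - \<rho> * cos \<theta>\<bar> = \<bar>ln (cmod (1 + of_real (\<rho> * a $ j) * cis \<theta>)) - \<rho> * a $ j * cos \<theta>\<bar> / a $ j"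
      using a[of j] by (simp add: \<Lambda>_def field_simps)
    also have "\<dots> \<le> (2 * (\<rho> * a $ j)\<^sup>2) / a $ j"
      using \<rho>a[of j] a[of j] by (intro divide_right_mono ln_norm_approx) auto
    also have "\<dots> = 2 * a $ j * \<rho>\<^sup>2" using a[of j] by (simp add: power2_eq_square field_simps)
    also have "\<dots> \<le> 2 * A * \<rho>\<^sup>2" using aA[of j] by (intro mult_right_mono) auto
    finally show ?thesis .
  qed
  have \<Lambda>2: "\<bar>\<Lambda> j \<theta>\<bar> \<le> 2 * \<rho>" for j \<theta>
  proof -
    have "\<bar>\<rho> * cos \<theta>\<bar> \<le> \<rho>" using \<rho>(1) by (simp add: abs_mult)
    moreover have "2 * A * \<rho>\<^sup>2 \<le> \<rho>" using mult_right_mono[of "2 * (\<rho> * A)" 1 \<rho>] \<rho>(1,2)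
      by (simp add: power2_eq_square mult_ac)
    ultimately show ?thesis using \<Lambda>1[of j \<theta>] by linarith
  qed
  have \<mu>: "\<bar>\<Lambda> j \<theta> - \<Lambda> k \<theta>\<bar> \<le> 4 * A * \<rho>\<^sup>2" for j \<theta>
    using \<Lambda>1[of j \<theta>] \<Lambda>1[of k \<theta>] by linarith
  have inK: "q + cis \<theta> *s b \<in> K" for \<theta>
  proof (rule KI)
    show "(q + cis \<theta> *s b) $ j \<noteq> x $ j" for j
      using qb[of "cis \<theta>" j] Knz[OF q, of j] nz[of j \<theta>] by (metis eq_iff_diff_eq_0 mult_eq_0_iff)
    show "s0 \<le> X (q + cis \<theta> *s b)" "X (q + cis \<theta> *s b) \<le> s2"
      using \<Lambda>2[of k \<theta>] \<rho>(4,5) unfolding X_def L\<Lambda> by (auto simp: X_def[symmetric] abs_le_iff)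
    show "\<bar>y j (q + cis \<theta> *s b)\<bar> \<le> \<eta>/2" for j
      using \<mu>[of j \<theta>] \<rho>(6)[of j] unfolding y_def X_def L\<Lambda> by linarith
  qed
  \<comment> \<open>The derivative at \<open>X q\<close> of the chord minus the quadratic term.
    \<open>lin\<close> gathers everything linear in the \<Lambda>_j and integrates to exactly 0, so
    the size of its coefficients does not matter.\<close>
  define c where "c = \<alpha> - \<delta> * (2 * X q - s0 - s2)"
  define lin where "lin \<theta> = c * \<Lambda> k \<theta> + (\<Sum>j\<in>UNIV. 2 * C * y j q * (\<Lambda> j \<theta> - \<Lambda> k \<theta>))" for \<theta>
  define G where "G \<theta> = lin \<theta> + (- (\<delta> * \<rho>\<^sup>2 / 2) * (cos \<theta>)\<^sup>2 + D * \<rho>^4)" for \<theta>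
  have \<Lambda>int: "(\<Lambda> j has_integral 0) {0..2*pi}" for j
  proof -
    have "((\<lambda>\<theta>. ln (cmod (1 + of_real (\<rho> * a $ j) * cis \<theta>)) / a $ j) has_integral 0 / a $ j) {0..2*pi}"
      using \<rho>a[of j] by (intro has_integral_divide has_integral_ln_norm_circle) auto
    then show ?thesis by (simp add: \<Lambda>_def[abs_def])
  qed
  have lin_int: "(lin has_integral (c * 0 + (\<Sum>j\<in>(UNIV::'n set). 2 * C * y j q * (0 - 0)))) {0..2*pi}"
    unfolding lin_def
    by (intro has_integral_add has_integral_sum has_integral_mult_right has_integral_diff \<Lambda>int) auto
  have diff: "g q - g (q + cis \<theta> *s b) \<le> G \<theta>" for \<theta>
  proof -
    let ?l = "\<Lambda> k \<theta>"
    have "g q - g (q + cis \<theta> *s b) = c * ?l - \<delta> * ?l\<^sup>2 +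
       C * ((\<Sum>j\<in>UNIV. (y j q + (\<Lambda> j \<theta> - ?l))\<^sup>2) - (\<Sum>j\<in>UNIV. (y j q)\<^sup>2))"
      unfolding g_def X_def y_def L\<Lambda>
      by (simp add: X_def[symmetric] l_def c_def power2_eq_square algebra_simps)
    also have "(\<Sum>j\<in>UNIV. (y j q + (\<Lambda> j \<theta> - ?l))\<^sup>2) - (\<Sum>j\<in>UNIV. (y j q)\<^sup>2) =
        (\<Sum>j\<in>UNIV. 2 * y j q * (\<Lambda> j \<theta> - ?l)) + (\<Sum>j\<in>UNIV. (\<Lambda> j \<theta> - ?l)\<^sup>2)"
      unfolding sum_subtractf[symmetric] sum.distrib[symmetric] power2_sum by (intro sum.cong) auto
    also have "c * ?l - \<delta> * ?l\<^sup>2 + C * \<dots> = lin \<theta> - \<delta> * ?l\<^sup>2 + C * (\<Sum>j\<in>UNIV. (\<Lambda> j \<theta> - ?l)\<^sup>2)"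
      by (simp add: lin_def algebra_simps sum_distrib_left)
    also have "\<dots> \<le> lin \<theta> - \<delta> * ((\<rho> * cos \<theta>)\<^sup>2 / 2 - (2 * A * \<rho>\<^sup>2)\<^sup>2) + C * (\<Sum>j\<in>(UNIV::'n set). (4 * A * \<rho>\<^sup>2)\<^sup>2)"
    proof (intro add_mono diff_mono mult_left_mono sum_mono order_refl)
      show "(\<Lambda> j \<theta> - ?l)\<^sup>2 \<le> (4 * A * \<rho>\<^sup>2)\<^sup>2" for j
        using power_mono[OF \<mu>[of j \<theta>], of 2] by simp
      have "(?l - \<rho> * cos \<theta>)\<^sup>2 \<le> (2 * A * \<rho>\<^sup>2)\<^sup>2" using power_mono[OF \<Lambda>1[of k \<theta>], of 2] by simp
      moreover have "(\<rho> * cos \<theta>)\<^sup>2 / 2 \<le> ?l\<^sup>2 + (?l - \<rho> * cos \<theta>)\<^sup>2"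
        using zero_le_power2[of "2 * ?l - \<rho> * cos \<theta>"] by (simp add: power2_eq_square algebra_simps)
      ultimately show "(\<rho> * cos \<theta>)\<^sup>2 / 2 - (2 * A * \<rho>\<^sup>2)\<^sup>2 \<le> ?l\<^sup>2" by simp
    qed (use \<delta> C in auto)
    also have "\<dots> = G \<theta>" unfolding G_def D_def
      by (simp add: power_mult_distrib algebra_simps flip: power_mult)
    finally show ?thesis .
  qed
  have "0 \<le> (c * 0 + (\<Sum>j\<in>(UNIV::'n set). 2 * C * y j q * (0 - 0))) + (- (\<delta> * \<rho>\<^sup>2 / 2) * pi + (2 * pi - 0) *\<^sub>R (D * \<rho>^4))"
  proof (rule plurisubharmonic_touch[OF u \<Omega>(1)])
    show "q + \<tau> *s b \<in> \<Omega>" if "cmod \<tau> \<le> 1" for \<tau>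
    proof -
      have "cmod ((q + \<tau> *s b) $ j - x $ j) < exp (\<sigma>\<^sub>2 * a $ j)" for j
      proof -
        have "cmod (1 + of_real (\<rho> * a $ j) * \<tau>) \<le> 1 + \<rho> * a $ j * cmod \<tau>"
          using norm_triangle_ineq[of 1 "of_real (\<rho> * a $ j) * \<tau>"] \<rho>a[of j]
          by (simp only: norm_mult norm_one norm_of_real abs_of_pos)
        also have "\<dots> \<le> 1 + \<rho> * a $ j * 1"
          using that \<rho>a[of j] by (intro add_left_mono mult_left_mono) auto
        also have "\<dots> \<le> exp (\<rho> * a $ j)" using exp_ge_add_one_self[of "\<rho> * a $ j"] by simp
        finally have "cmod ((q + \<tau> *s b) $ j - x $ j) \<le> exp (L j q * a $ j) * exp (\<rho> * a $ j)"
          unfolding qb norm_mult norm_L[OF Knz[OF q]] by (intro mult_left_mono) auto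
        also have "\<dots> = exp ((L j q + \<rho>) * a $ j)" by (simp add: exp_add[symmetric] algebra_simps)
        also have "\<dots> < exp (\<sigma>\<^sub>2 * a $ j)"
        proof -
          have "L j q + \<rho> < \<sigma>\<^sub>2" using yq[of j] Xq \<rho>(3) s unfolding y_def by linarith
          then show ?thesis using a[of j] by simp
        qed
        finally show ?thesis .
      qed
      then show ?thesis using \<Omega>(2) by (auto simp: open_polydisc_def)
    qed
    show "(G has_integral (c * 0 + (\<Sum>j\<in>(UNIV::'n set). 2 * C * y j q * (0 - 0))) + (- (\<delta> * \<rho>\<^sup>2 / 2) * pi + (2 * pi - 0) *\<^sub>R (D * \<rho>^4))) {0..2*pi}"
      unfolding G_def using has_integral_const_real[of "D * \<rho>^4" 0 "2*pi"]
      by (intro has_integral_add lin_int has_integral_mult_right has_integral_cos_sq) simp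
    show "continuous_on {0..2*pi} G"
    proof -
      have "continuous_on {0..2*pi} (\<Lambda> j)" for j
        unfolding \<Lambda>_def using nz[of j] a[of j] by (intro continuous_intros) auto
      then show ?thesis unfolding G_def lin_def by (intro continuous_intros)
    qed
    show "u q \<noteq> -\<infinity>" using v by simp
    fix \<theta> assume "\<theta> \<in> {0..2*pi}"
    have "u (q + cis \<theta> *s b) + ereal (g (q + cis \<theta> *s b)) \<le> u q + ereal (g q)"
      by (intro max inK)
    then have "u (q + cis \<theta> *s b) \<le> u q + ereal (g q - g (q + cis \<theta> *s b))"
      using v by (cases "u (q + cis \<theta> *s b)") auto
    also have "\<dots> \<le> u q + ereal (G \<theta>)" using diff by (intro add_left_mono) simp
    finally show "u (q + cis \<theta> *s b) \<le> u q + ereal (G \<theta>)" .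
  qed
  then have "pi * \<rho>\<^sup>2 * \<delta> \<le> pi * \<rho>\<^sup>2 * (4 * D * \<rho>\<^sup>2)"
    by (simp add: power2_eq_square power4_eq_xxxx algebra_simps)
  moreover have "pi * \<rho>\<^sup>2 > 0" using \<rho>(1) by simp
  ultimately have "\<delta> \<le> 4 * D * \<rho>\<^sup>2" by (rule mult_left_le_imp_le)
  then show False using \<rho>(7) by simp
qed

section \<open>Growth of the supremum over polydiscs\<close>

definition polydisc_sup :: "(complex^'n \<Rightarrow> ereal) \<Rightarrow> complex^'n \<Rightarrow> real^'n \<Rightarrow> real \<Rightarrow> ereal" where
  "polydisc_sup u x a s = (SUP z\<in>open_polydisc x a s. u z)"

lemma polydisc_sup_upper: "z \<in> open_polydisc x a s \<Longrightarrow> u z \<le> polydisc_sup u x a s"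
  unfolding polydisc_sup_def by (rule SUP_upper)

lemma polydisc_sup_mono:
  "open_polydisc x a s \<subseteq> open_polydisc y b t \<Longrightarrow> polydisc_sup u x a s \<le> polydisc_sup u y b t"
  unfolding polydisc_sup_def by (rule SUP_subset_mono) auto

text \<open>An arbitrary affine majorant replaces the chord itself, so that the value -\<infinity>
  is allowed at the left end.\<close>

lemma polydisc_sup_three:
  fixes u :: "complex^'n \<Rightarrow> ereal"
  assumes u: "plurisubharmonic_on \<Omega> u" and \<Omega>: "open \<Omega>" "open_polydisc x a \<sigma>\<^sub>2 \<subseteq> \<Omega>"
    and a: "\<And>j. 0 < a $ j" and \<sigma>: "\<sigma>\<^sub>0 < \<sigma>\<^sub>1" "\<sigma>\<^sub>1 < \<sigma>\<^sub>2"
    and "polydisc_sup u x a \<sigma>\<^sub>0 \<le> ereal (\<alpha> * \<sigma>\<^sub>0 + \<beta>)"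
    and "polydisc_sup u x a \<sigma>\<^sub>2 \<le> ereal (\<alpha> * \<sigma>\<^sub>2 + \<beta>)"
  shows "polydisc_sup u x a \<sigma>\<^sub>1 \<le> ereal (\<alpha> * \<sigma>\<^sub>1 + \<beta>)"
  unfolding polydisc_sup_def
  by (intro SUP_least plurisubharmonic_three_polydiscs[OF u \<Omega> a \<sigma>])
     (use assms(7,8) order_trans[OF polydisc_sup_upper] in blast)+

text \<open>If the supremum at \<open>s\<close> were -\<infinity>, every affine function would be a
  majorant there. The line through the value at \<open>S\<close> and a point one below the value at
  \<open>t\<close> then contradicts the three polydiscs theorem at \<open>t\<close>.\<close>

lemma polydisc_sup_finite:
  fixes u :: "complex^'n \<Rightarrow> ereal"
  assumes u: "plurisubharmonic_on \<Omega> u" and \<Omega>: "open \<Omega>" "open_polydisc x a S \<subseteq> \<Omega>"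
    and a: "\<And>j. 0 < a $ j" and S: "polydisc_sup u x a S \<noteq> \<infinity>"
    and z: "t < S" "polydisc_sup u x a t \<noteq> -\<infinity>" and s: "s \<le> S"
  shows "\<bar>polydisc_sup u x a s\<bar> \<noteq> \<infinity>"
proof -
  let ?N = "polydisc_sup u x a"
  have mono: "?N p \<le> ?N q" if "p \<le> q" for p q
    using that by (intro polydisc_sup_mono open_polydisc_mono a)
  have up: "?N p \<noteq> \<infinity>" if "p \<le> S" for p
    using mono[OF that] S by auto
  obtain w where w: "?N t = ereal w" using up[of t] z by (cases "?N t") auto
  have "?N S \<noteq> -\<infinity>" using mono[of t S] z by auto
  then obtain B where B: "?N S = ereal B" using S by (cases "?N S") auto
  have "?N s \<noteq> -\<infinity>"
  proof
    assume s0: "?N s = -\<infinity>"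
    then have "s < t" using mono[of t s] z by (force simp: not_le[symmetric])
    define \<alpha> where "\<alpha> = (B - (w - 1)) / (S - t)"
    have al: "\<alpha> * S + (B - \<alpha> * S) = B" "\<alpha> * t + (B - \<alpha> * S) = w - 1"
    proof -
      have "\<alpha> * (S - t) = B - (w - 1)" using z by (simp add: \<alpha>_def)
      then show "\<alpha> * t + (B - \<alpha> * S) = w - 1" by (simp add: algebra_simps)
    qed simp
    have "?N t \<le> ereal (\<alpha> * t + (B - \<alpha> * S))"
      using s0 B al by (intro polydisc_sup_three[OF u \<Omega> a \<open>s < t\<close> z(1)]) auto
    then show False using w al by simp
  qed
  then show ?thesis using up[OF s] by (cases "?N s") auto
qed

lemma polydisc_sup_convex:
  fixes u :: "complex^'n \<Rightarrow> ereal"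
  assumes u: "plurisubharmonic_on \<Omega> u" and \<Omega>: "open \<Omega>" "open_polydisc x a S \<subseteq> \<Omega>"
    and a: "\<And>j. 0 < a $ j" and fin: "\<And>s. s \<le> S \<Longrightarrow> \<bar>polydisc_sup u x a s\<bar> \<noteq> \<infinity>"
  shows "convex_on {..S} (\<lambda>s. real_of_ereal (polydisc_sup u x a s))"
proof (rule convex_on_linorderI)
  let ?n = "\<lambda>s. real_of_ereal (polydisc_sup u x a s)"
  have N: "polydisc_sup u x a s = ereal (?n s)" if "s \<le> S" for s
    using fin[OF that] by (simp add: ereal_real)
  fix t p q :: real assume t: "0 < t" "t < 1" and pq: "p \<in> {..S}" "q \<in> {..S}" "p < q"
  define m where "m = (1 - t) * p + t * q"
  have m: "p < m" "m < q"
  proof -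
    have "m - p = t * (q - p)" "q - m = (1 - t) * (q - p)" by (auto simp: m_def algebra_simps)
    then show "p < m" "m < q" using t pq by (metis diff_gt_0_iff_gt mult_pos_pos)+
  qed
  define \<alpha> where "\<alpha> = (?n q - ?n p) / (q - p)"
  have \<alpha>: "\<alpha> * (q - p) = ?n q - ?n p" using pq by (simp add: \<alpha>_def)
  have "polydisc_sup u x a m \<le> ereal (\<alpha> * m + (?n p - \<alpha> * p))"
  proof (rule polydisc_sup_three[OF u \<Omega>(1) _ a m])
    show "open_polydisc x a q \<subseteq> \<Omega>" using open_polydisc_mono[OF a, of q S x] \<Omega> pq by auto
    show "polydisc_sup u x a p \<le> ereal (\<alpha> * p + (?n p - \<alpha> * p))" using N[of p] pq by simp
    have "\<alpha> * q + (?n p - \<alpha> * p) = ?n q" using \<alpha> by (simp add: algebra_simps)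
    then show "polydisc_sup u x a q \<le> ereal (\<alpha> * q + (?n p - \<alpha> * p))" using N[of q] pq by simp
  qed
  then have "?n m \<le> \<alpha> * m + (?n p - \<alpha> * p)" using N[of m] m pq
    by (metis atMost_iff ereal_less_eq(3) less_imp_le order_trans)
  also have "\<dots> = ?n p + t * (\<alpha> * (q - p))" by (simp add: m_def algebra_simps)
  also have "\<dots> = (1 - t) * ?n p + t * ?n q" unfolding \<alpha> by (simp add: algebra_simps)
  finally show "?n ((1 - t) *\<^sub>R p + t *\<^sub>R q) \<le> (1 - t) * ?n p + t * ?n q" by (simp add: m_def)
qed auto

text \<open>Both \<open>s + h\<close> and \<open>t\<close> lie between \<open>s\<close> and
  \<open>t + h\<close>, with complementary weights; the two convexity inequalities are added. This
  transports a bound on increments at one scale to all smaller scales.\<close>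

lemma convex_on_increment_mono:
  fixes f :: "real \<Rightarrow> real"
  assumes f: "convex_on {..S} f" and st: "s \<le> t" "0 \<le> h" "t + h \<le> S"
  shows "f (s + h) - f s \<le> f (t + h) - f t"
proof (cases "t + h = s")
  case False
  then have pos: "t + h - s > 0" using st by auto
  define l where "l = h / (t + h - s)"
  have l: "0 \<le> l" "l \<le> 1" using pos st by (auto simp: l_def)
  have lm: "l * (t + h - s) = h" using pos by (simp add: l_def)
  have "f ((1 - l) *\<^sub>R s + l *\<^sub>R (t + h)) \<le> (1 - l) * f s + l * f (t + h)"
    using st by (intro convex_onD[OF f l]) auto
  moreover have "f ((1 - (1 - l)) *\<^sub>R s + (1 - l) *\<^sub>R (t + h)) \<le> (1 - (1 - l)) * f s + (1 - l) * f (t + h)"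
    using st l by (intro convex_onD[OF f]) auto
  moreover have "(1 - l) *\<^sub>R s + l *\<^sub>R (t + h) = s + h" "(1 - (1 - l)) *\<^sub>R s + (1 - l) *\<^sub>R (t + h) = t"
    using lm by (auto simp: algebra_simps)
  ultimately show ?thesis by (simp add: algebra_simps)
qed (use st in auto)

text \<open>The slopes \<open>g s\<close> of the chords ending at \<open>S\<close> are nonnegative
  by monotonicity and nondecreasing in \<open>s\<close> by convexity, so at -\<infinity> they
  converge to their infimum; \<open>f s / s\<close> differs from \<open>g s\<close> by terms that
  vanish.\<close>

lemma convex_mono_ratio_limit:
  fixes f :: "real \<Rightarrow> real"
  assumes f: "convex_on {..S} f" and mono: "\<And>s t. s \<le> t \<Longrightarrow> t \<le> S \<Longrightarrow> f s \<le> f t"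
  obtains L where "((\<lambda>s. f s / s) \<longlongrightarrow> L) at_bot"
proof -
  define g where "g s = (f S - f s) / (S - s)" for s
  have g0: "g s \<ge> 0" if "s < S" for s using mono[of s S] that by (auto simp: g_def)
  have gm: "g s \<le> g t" if "s \<le> t" "t < S" for s t
  proof -
    define l where "l = (t - s) / (S - s)"
    have l: "0 \<le> l" "l \<le> 1" "l * (S - s) = t - s" using that by (auto simp: l_def)
    have eq: "(1 - l) *\<^sub>R s + l *\<^sub>R S = t" using l(3) by (simp add: algebra_simps)
    have "f ((1 - l) *\<^sub>R s + l *\<^sub>R S) \<le> (1 - l) * f s + l * f S"
      using that by (intro convex_onD[OF f l(1,2)]) auto
    then have "f t \<le> (1 - l) * f s + l * f S" unfolding eq .
    then have "(1 - l) * (f S - f s) \<le> f S - f t" by (simp add: algebra_simps)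
    moreover have "1 - l = (S - t) / (S - s)" using that by (simp add: l_def field_simps)
    ultimately have "(S - t) * (f S - f s) / (S - s) \<le> f S - f t" by simp
    then show ?thesis using that by (simp add: g_def field_simps)
  qed
  define L where "L = Inf (g ` {..<S})"
  have bdd: "bdd_below (g ` {..<S})" using g0 by (intro bdd_belowI[of _ 0]) auto
  have gL: "(g \<longlongrightarrow> L) at_bot"
  proof (rule order_tendstoI)
    fix c assume "c < L"
    have "\<forall>\<^sub>F s in at_bot. s < S" by (rule eventually_gt_at_bot)
    then show "\<forall>\<^sub>F s in at_bot. c < g s"
    proof eventually_elim
      case (elim s)
      then have "L \<le> g s" unfolding L_def by (intro cInf_lower bdd) auto
      then show ?case using \<open>c < L\<close> by simp
    qed
  next
    fix c assume "L < c"
    then obtain s0 where s0: "s0 < S" "g s0 < c"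
      unfolding L_def by (subst (asm) cInf_less_iff) (use bdd in auto)
    have "\<forall>\<^sub>F s in at_bot. s \<le> s0" by (rule eventually_le_at_bot)
    then show "\<forall>\<^sub>F s in at_bot. g s < c"
    proof eventually_elim
      case (elim s)
      then show ?case using gm[OF elim s0(1)] s0(2) by simp
    qed
  qed
  have inv: "((\<lambda>s::real. c / s) \<longlongrightarrow> 0) at_bot" for c :: real
    by (rule tendsto_divide_0[OF tendsto_const] filterlim_mono[OF filterlim_ident at_bot_le_at_infinity order_refl])+
  have "((\<lambda>s. f S / s + g s * (1 - S / s)) \<longlongrightarrow> 0 + L * (1 - 0)) at_bot"
    by (intro tendsto_intros gL inv)
  moreover have "\<forall>\<^sub>F s in at_bot. f S / s + g s * (1 - S / s) = f s / s"
    using eventually_gt_at_bot[of S] eventually_gt_at_bot[of 0]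
  proof eventually_elim
    case (elim s)
    have "g s * (S - s) = f S - f s" using elim by (simp add: g_def)
    then have "f s = f S - g s * (S - s)" by simp
    then show ?case using elim by (simp add: field_simps)
  qed
  ultimately have "((\<lambda>s. f s / s) \<longlongrightarrow> L) at_bot"
    by (simp add: tendsto_cong)
  then show thesis by (rule that)
qed

text \<open>The error \<open>C\<close> and the shift of the scale by 1 both disappear after division
  by ln r, which is negative and so reverses the inequalities. The shift makes up for the closed
  polydiscs in the theorem, as the suprema are taken over open ones.\<close>

lemma ratio_limit_sandwich:
  fixes f :: "real \<Rightarrow> real" and X :: "real \<Rightarrow> ereal"
  assumes L: "((\<lambda>s. f s / s) \<longlongrightarrow> L) at_bot"
    and lower: "\<forall>\<^sub>F r in at_right 0. ereal (f (ln r) - C) \<le> X r"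
    and upper: "\<forall>\<^sub>F r in at_right 0. X r \<le> ereal (f (ln r + 1) + C)"
  shows "((\<lambda>r. X r / ereal (ln r)) \<longlongrightarrow> ereal L) (at_right 0)"
proof -
  have inv: "((\<lambda>s::real. c / s) \<longlongrightarrow> 0) at_bot" for c :: real
    by (rule tendsto_divide_0[OF tendsto_const] filterlim_mono[OF filterlim_ident at_bot_le_at_infinity order_refl])+
  have 1: "((\<lambda>s. (f s - C) / s) \<longlongrightarrow> L - 0) at_bot"
    unfolding diff_divide_distrib by (intro tendsto_intros L inv)
  have shift: "filterlim (\<lambda>s::real. s + 1) at_bot at_bot"
    unfolding filterlim_at_bot
  proof
    fix Z :: real
    show "\<forall>\<^sub>F s in at_bot. s + 1 \<le> Z"
      using eventually_le_at_bot[of "Z - 1"] by eventually_elim simp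
  qed
  have "((\<lambda>s. f (s + 1) / (s + 1) * (1 + 1 / s) + C / s) \<longlongrightarrow> L * (1 + 0) + 0) at_bot"
    by (intro tendsto_intros filterlim_compose[OF L shift] inv)
  moreover have "\<forall>\<^sub>F s in at_bot. f (s + 1) / (s + 1) * (1 + 1 / s) + C / s = (f (s + 1) + C) / s"
    using eventually_gt_at_bot[of "-1"]
  proof eventually_elim
    case (elim s)
    have "1 + 1 / s = (s + 1) / s" using elim by (simp add: field_simps)
    moreover have "f (s + 1) / (s + 1) * ((s + 1) / s) = f (s + 1) / s" using elim by simp
    ultimately show ?case by (simp only: add_divide_distrib[of "f (s + 1)"])
  qed
  ultimately have 2: "((\<lambda>s. (f (s + 1) + C) / s) \<longlongrightarrow> L) at_bot"
    by (simp add: tendsto_cong)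
  have neg: "\<forall>\<^sub>F r in at_right 0. ln r < (0::real)"
    by (rule eventually_compose_filterlim[OF eventually_gt_at_bot ln_at_0])
  have div: "x / ereal l \<le> y / ereal l" if "y \<le> x" "l < 0" for x y l
    using that by (cases x; cases y) (auto simp: divide_right_mono_neg)
  show ?thesis
  proof (rule tendsto_sandwich)
    show "((\<lambda>r. ereal ((f (ln r + 1) + C) / ln r)) \<longlongrightarrow> ereal L) (at_right 0)"
      using filterlim_compose[OF 2 ln_at_0] by simp
    show "((\<lambda>r. ereal ((f (ln r) - C) / ln r)) \<longlongrightarrow> ereal L) (at_right 0)"
      using filterlim_compose[OF 1 ln_at_0] by simp
    show "\<forall>\<^sub>F r in at_right 0. ereal ((f (ln r + 1) + C) / ln r) \<le> X r / ereal (ln r)"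
      using neg upper
    proof eventually_elim
      case (elim r)
      then show ?case using div[OF elim(2,1)] by simp
    qed
    show "\<forall>\<^sub>F r in at_right 0. X r / ereal (ln r) \<le> ereal ((f (ln r) - C) / ln r)"
      using neg lower
    proof eventually_elim
      case (elim r)
      then show ?case using div[OF elim(2,1)] by simp
    qed
  qed
qed

section \<open>Volume mean values\<close>

lemma nn_integral_lborel_shift:
  fixes f :: "'a::euclidean_space \<Rightarrow> ennreal"
  assumes [measurable]: "f \<in> borel_measurable borel"
  shows "(\<integral>\<^sup>+x. f (c + x) \<partial>lborel) = (\<integral>\<^sup>+x. f x \<partial>lborel)"
proof -
  have "(\<integral>\<^sup>+x. f x \<partial>lborel) = (\<integral>\<^sup>+x. f x \<partial>distr lborel borel ((+) c))"
    by (simp add: lborel_distr_plus)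
  also have "\<dots> = (\<integral>\<^sup>+x. f (c + x) \<partial>lborel)" by (subst nn_integral_distr) auto
  finally show ?thesis by simp
qed

text \<open>Uniqueness of Haar measure: comparing both sides with a ball, by Tonelli.\<close>

lemma nn_integral_lborel_isometry:
  fixes f :: "'a::euclidean_space \<Rightarrow> ennreal" and T T' :: "'a \<Rightarrow> 'a"
  assumes f[measurable]: "f \<in> borel_measurable borel"
    and T: "\<And>x y. T (x + y) = T x + T y" "\<And>x. norm (T x) = norm x" "\<And>x. T (T' x) = x"
  shows "(\<integral>\<^sup>+x. f (T x) \<partial>lborel) = (\<integral>\<^sup>+x. f x \<partial>lborel)"
proof -
  have Tdiff: "T (x - y) = T x - T y" for x y using T(1)[of "x - y" y] by simp
  have "continuous_on UNIV T"
    by (rule continuous_onI) (metis Tdiff T(2) dist_norm less_imp_le)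
  then have [measurable]: "T \<in> borel_measurable borel" by (rule borel_measurable_continuous_onI)
  define \<beta> :: "'a \<Rightarrow> ennreal" where "\<beta> = indicator (ball 0 1)"
  have [measurable]: "\<beta> \<in> borel_measurable borel" unfolding \<beta>_def
    by (rule borel_measurable_indicator) simp
  define c where "c = ennreal (unit_ball_vol (real DIM('a)))"
  have c: "c \<noteq> 0" "c \<noteq> \<infinity>"
  proof -
    have "0 < unit_ball_vol (real DIM('a))" by (rule unit_ball_vol_pos) simp
    then have "0 < c" unfolding c_def by (simp only: ennreal_less_zero_iff)
    then show "c \<noteq> 0" by simp
  qed (simp add: c_def)
  have cball: "emeasure lborel (ball x 1) = c" for x :: 'a
    unfolding c_def by (simp add: emeasure_ball)
  have \<beta>c: "(\<integral>\<^sup>+y. \<beta> y \<partial>lborel) = c" unfolding \<beta>_def by (simp add: cball)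
  have "(\<integral>\<^sup>+x. f (T x) \<partial>lborel) * c = (\<integral>\<^sup>+y. (\<integral>\<^sup>+x. f (T x) \<partial>lborel) * \<beta> y \<partial>lborel)"
    unfolding \<beta>c[symmetric] by (subst nn_integral_cmult) auto
  also have "\<dots> = (\<integral>\<^sup>+y. (\<integral>\<^sup>+x. f (T x + y) * \<beta> y \<partial>lborel) \<partial>lborel)"
  proof (rule nn_integral_cong)
    fix y
    have "(\<integral>\<^sup>+x. f (T x) \<partial>lborel) = (\<integral>\<^sup>+x. f (T (T' y + x)) \<partial>lborel)"
      by (subst nn_integral_lborel_shift[of "\<lambda>x. f (T x)"]) auto
    also have "\<dots> = (\<integral>\<^sup>+x. f (T x + y) \<partial>lborel)" by (simp add: T add.commute)
    finally show "(\<integral>\<^sup>+x. f (T x) \<partial>lborel) * \<beta> y = (\<integral>\<^sup>+x. f (T x + y) * \<beta> y \<partial>lborel)"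
      by (simp add: nn_integral_multc)
  qed
  also have "\<dots> = (\<integral>\<^sup>+x. (\<integral>\<^sup>+y. f (T x + y) * \<beta> y \<partial>lborel) \<partial>lborel)"
    by (rule lborel_pair.Fubini') measurable
  also have "\<dots> = (\<integral>\<^sup>+x. (\<integral>\<^sup>+y. f y * \<beta> (y - T x) \<partial>lborel) \<partial>lborel)"
  proof (rule nn_integral_cong)
    fix x
    show "(\<integral>\<^sup>+y. f (T x + y) * \<beta> y \<partial>lborel) = (\<integral>\<^sup>+y. f y * \<beta> (y - T x) \<partial>lborel)"
      by (subst nn_integral_lborel_shift[of "\<lambda>y. f y * \<beta> (y - T x)" "T x", symmetric]) auto
  qed
  also have "\<dots> = (\<integral>\<^sup>+y. (\<integral>\<^sup>+x. f y * \<beta> (y - T x) \<partial>lborel) \<partial>lborel)"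
    by (rule lborel_pair.Fubini') measurable
  also have "\<dots> = (\<integral>\<^sup>+y. f y * c \<partial>lborel)"
  proof (rule nn_integral_cong)
    fix y
    have "norm (y - T x) = norm (T' y - x)" for x using T(2)[of "T' y - x"] by (simp add: Tdiff T)
    then have "y - T x \<in> ball 0 1 \<longleftrightarrow> x \<in> ball (T' y) 1" for x
      by (simp only: mem_ball_0) (simp add: dist_norm)
    then have "\<beta> (y - T x) = indicator (ball (T' y) 1) x" for x
      unfolding \<beta>_def indicator_def by simp
    then have "(\<integral>\<^sup>+x. f y * \<beta> (y - T x) \<partial>lborel) = (\<integral>\<^sup>+x. f y * indicator (ball (T' y) 1) x \<partial>lborel)"
      by simp
    also have "\<dots> = f y * c" by (simp add: nn_integral_cmult_indicator cball)
    finally show "(\<integral>\<^sup>+x. f y * \<beta> (y - T x) \<partial>lborel) = f y * c" .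
  qed
  also have "\<dots> = (\<integral>\<^sup>+y. f y \<partial>lborel) * c" by (rule nn_integral_multc) measurable
  finally show ?thesis using c
    by (metis ennreal_mult_divide_eq infinity_ennreal_def)
qed

lemma norm_cis_smult: "norm (cis \<theta> *s (b::complex^'n)) = norm b"
  by (simp add: norm_vec_def norm_mult)

text \<open>Each rotation is an isometry and preserves volume, so Tonelli gives the factor 2 pi.
  Inequalities on circles about the origin thereby become inequalities on volumes, without polar
  coordinates.\<close>

lemma nn_integral_circle_average:
  fixes h :: "complex^'n \<Rightarrow> ennreal"
  assumes h[measurable]: "h \<in> borel_measurable borel"
  shows "(\<integral>\<^sup>+b. (\<integral>\<^sup>+\<theta>\<in>{0..2*pi}. h (cis \<theta> *s b) \<partial>lborel) \<partial>lborel) = ennreal (2*pi) * (\<integral>\<^sup>+b. h b \<partial>lborel)"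
proof -
  have "(\<lambda>(b,\<theta>). cis \<theta> *s (b::complex^'n)) = (\<lambda>p. \<chi> j. cis (snd p) * fst p $ j)"
    by (auto simp: vec_eq_iff fun_eq_iff)
  moreover have "continuous_on UNIV (\<lambda>p. \<chi> j. cis (snd p) * (fst p :: complex^'n) $ j)"
    by (intro continuous_intros)
  ultimately have [measurable]: "(\<lambda>(b,\<theta>). cis \<theta> *s (b::complex^'n)) \<in> borel_measurable (borel \<Otimes>\<^sub>M borel)"
    unfolding borel_prod by (intro borel_measurable_continuous_onI) simp
  have m: "(\<lambda>(b,\<theta>). h (cis \<theta> *s b) * indicator {0..2*pi} \<theta>) \<in> borel_measurable (lborel \<Otimes>\<^sub>M lborel)"
  proof -
    have "(\<lambda>p. h (case p of (b,\<theta>) \<Rightarrow> cis \<theta> *s b) * indicator {0..2*pi} (snd p)) \<in> borel_measurable (lborel \<Otimes>\<^sub>M lborel)"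
      by measurable
    then show ?thesis by (simp add: case_prod_beta')
  qed
  have "(\<integral>\<^sup>+b. (\<integral>\<^sup>+\<theta>\<in>{0..2*pi}. h (cis \<theta> *s b) \<partial>lborel) \<partial>lborel) =
     (\<integral>\<^sup>+\<theta>. (\<integral>\<^sup>+b. h (cis \<theta> *s b) * indicator {0..2*pi} \<theta> \<partial>lborel) \<partial>lborel)"
    using m by (intro lborel_pair.Fubini'[symmetric]) (simp cong: measurable_cong_sets)
  also have "\<dots> = (\<integral>\<^sup>+\<theta>. (\<integral>\<^sup>+b. h b \<partial>lborel) * indicator {0..2*pi} \<theta> \<partial>lborel)"
  proof (intro nn_integral_cong)
    fix \<theta> :: real
    have "(\<integral>\<^sup>+b. h (cis \<theta> *s b) \<partial>lborel) = (\<integral>\<^sup>+b. h b \<partial>lborel)"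
      by (rule nn_integral_lborel_isometry[where T' = "\<lambda>b. cis (-\<theta>) *s b"])
         (auto simp: norm_cis_smult vector_add_ldistrib vec_eq_iff cis_mult simp flip: mult.assoc)
    then show "(\<integral>\<^sup>+b. h (cis \<theta> *s b) * indicator {0..2*pi} \<theta> \<partial>lborel) = (\<integral>\<^sup>+b. h b \<partial>lborel) * indicator {0..2*pi} \<theta>"
      by (cases "\<theta> \<in> {0..2*pi}") auto
  qed
  also have "\<dots> = (\<integral>\<^sup>+b. h b \<partial>lborel) * emeasure lborel {0..2*pi}"
    by (rule nn_integral_cmult_indicator) simp
  finally show ?thesis by (simp add: mult.commute)
qed

text \<open>The circle inequality is integrated over all \<open>b\<close> in \<open>B\<close>; as
  \<open>B\<close> is balanced, the discs spanned by \<open>b\<close> stay in it. The deficit form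
  keeps the integrand nonnegative and permits \<open>u y\<close> to be -\<infinity>.\<close>

lemma plurisubharmonic_volume_submean:
  fixes u :: "complex^'n \<Rightarrow> ereal"
  assumes u: "plurisubharmonic_on \<Omega> u" and \<Omega>: "open \<Omega>" "\<And>b. b \<in> B \<Longrightarrow> y + b \<in> \<Omega>"
    and B[measurable]: "B \<in> sets borel" and bal: "\<And>b \<tau>. b \<in> B \<Longrightarrow> cmod \<tau> \<le> 1 \<Longrightarrow> \<tau> *s b \<in> B"
    and C: "\<And>b. b \<in> B \<Longrightarrow> u (y + b) \<le> ereal C"
  shows "(\<integral>\<^sup>+b\<in>B. e2ennreal (ereal C - u (y + b)) \<partial>lborel) \<le> emeasure lborel B * e2ennreal (ereal C - u y)"
proof -
  have usc: "upper_semicontinuous_on \<Omega> u"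
    using u unfolding plurisubharmonic_on_def by auto
  define U where "U = (\<lambda>z. if z \<in> \<Omega> then u z else 0)"
  have [measurable]: "U \<in> borel_measurable borel" unfolding U_def by (rule usc_borel_measurable[OF \<Omega>(1) usc])
  define h where "h b = e2ennreal (ereal C - U (y + b)) * indicator B b" for b
  have [measurable]: "h \<in> borel_measurable borel" unfolding h_def by measurable
  have circ: "cis \<theta> *s b \<in> B \<longleftrightarrow> b \<in> B" for \<theta> b
  proof
    assume "cis \<theta> *s b \<in> B"
    from bal[OF this, of "cis (-\<theta>)"] show "b \<in> B" by (simp add: vector_smult_assoc cis_mult)
  qed (auto intro: bal)
  have "ennreal (2*pi) * (\<integral>\<^sup>+b. h b \<partial>lborel) = (\<integral>\<^sup>+b. (\<integral>\<^sup>+\<theta>\<in>{0..2*pi}. h (cis \<theta> *s b) \<partial>lborel) \<partial>lborel)"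
    by (rule nn_integral_circle_average[symmetric]) measurable
  also have "\<dots> \<le> (\<integral>\<^sup>+b. ennreal (2*pi) * e2ennreal (ereal C - u y) * indicator B b \<partial>lborel)"
  proof (intro nn_integral_mono)
    fix b :: "complex^'n"
    show "(\<integral>\<^sup>+\<theta>\<in>{0..2*pi}. h (cis \<theta> *s b) \<partial>lborel) \<le> ennreal (2*pi) * e2ennreal (ereal C - u y) * indicator B b"
    proof (cases "b \<in> B")
      case False
      then show ?thesis by (simp add: h_def circ)
    next
      case True
      define J where "J = (\<integral>\<^sup>+\<theta>\<in>{0..2*pi}. e2ennreal (ereal C - u (y + cis \<theta> *s b)) \<partial>lborel)"
      have "ereal (2*pi) * u y \<le> ereal (integral {0..2*pi} (\<lambda>\<theta>. C)) - enn2ereal J"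
        unfolding J_def using True
        by (intro plurisubharmonic_submean[OF u \<Omega>(1)] \<Omega>(2) bal C continuous_intros) auto
      then have le: "ereal (2*pi) * u y \<le> ereal (2*pi*C) - enn2ereal J" by simp
      have "y \<in> \<Omega>" using \<Omega>(2)[OF bal[OF True, of 0]] by simp
      have "J \<le> ennreal (2*pi) * e2ennreal (ereal C - u y)"
      proof (cases "u y")
        case MInf
        then show ?thesis by (simp add: ennreal_mult_top)
      next
        case PInf
        then show ?thesis using u \<open>y \<in> \<Omega>\<close> unfolding plurisubharmonic_on_def by auto
      next
        case (real v)
        then obtain j where j: "J = ennreal j" "j \<ge> 0" using le by (cases J) auto
        then have "j \<le> 2*pi*(C - v)" using le real by (simp add: algebra_simps)
        then show ?thesis using j real by (simp add: ennreal_leI flip: ennreal_mult')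
      qed
      moreover have "(\<integral>\<^sup>+\<theta>\<in>{0..2*pi}. h (cis \<theta> *s b) \<partial>lborel) = J"
        using True \<Omega>(2) unfolding J_def h_def by (intro nn_integral_cong) (simp add: circ U_def)
      ultimately show ?thesis using True by simp
    qed
  qed
  also have "\<dots> = ennreal (2*pi) * (emeasure lborel B * e2ennreal (ereal C - u y))"
    by (subst nn_integral_cmult_indicator) (auto simp: mult_ac)
  finally have "(\<integral>\<^sup>+b. h b \<partial>lborel) \<le> emeasure lborel B * e2ennreal (ereal C - u y)"
    by (subst (asm) ennreal_mult_le_mult_iff) auto
  moreover have "(\<integral>\<^sup>+b. h b \<partial>lborel) = (\<integral>\<^sup>+b\<in>B. e2ennreal (ereal C - u (y + b)) \<partial>lborel)"
    using \<Omega>(2) by (intro nn_integral_cong) (auto simp: h_def U_def indicator_def)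
  ultimately show ?thesis by simp
qed

text \<open>The linear lower bound for \<open>|f|\<^sup>2\<close> at \<open>f 0\<close> replaces the Cauchy-Schwarz inequality.\<close>

lemma holomorphic_volume_submean:
  fixes f :: "complex^'n \<Rightarrow> complex"
  assumes f: "f \<in> holomorphic_functions B" and B: "open B"
    and bal: "\<And>b \<tau>. b \<in> B \<Longrightarrow> cmod \<tau> \<le> 1 \<Longrightarrow> \<tau> *s b \<in> B"
  shows "emeasure lborel B * ennreal ((cmod (f 0))\<^sup>2) \<le> (\<integral>\<^sup>+b\<in>B. ennreal ((cmod (f b))\<^sup>2) \<partial>lborel)"
proof -
  have fc: "continuous_on B f"
    using f unfolding holomorphic_functions_def
    by (auto intro!: continuous_at_imp_continuous_on dest!: has_derivative_continuous)
  define h where "h b = ennreal ((cmod (indicator B b *\<^sub>R f b))\<^sup>2)" for b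
  have [measurable]: "h \<in> borel_measurable borel"
  proof -
    have [measurable]: "(\<lambda>b. indicator B b *\<^sub>R f b) \<in> borel_measurable borel"
      using fc B by (intro borel_measurable_continuous_on_indicator) auto
    show ?thesis unfolding h_def by measurable
  qed
  have "ennreal (2*pi) * (emeasure lborel B * ennreal ((cmod (f 0))\<^sup>2)) =
      (\<integral>\<^sup>+b. ennreal (2 * pi * (cmod (f 0))\<^sup>2) * indicator B b \<partial>lborel)"
    using B by (subst nn_integral_cmult_indicator) (auto simp: ennreal_mult mult_ac)
  also have "\<dots> \<le> (\<integral>\<^sup>+b. (\<integral>\<^sup>+\<theta>\<in>{0..2*pi}. h (cis \<theta> *s b) \<partial>lborel) \<partial>lborel)"
  proof (intro nn_integral_mono)
    fix b :: "complex^'n"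
    show "ennreal (2 * pi * (cmod (f 0))\<^sup>2) * indicator B b \<le> (\<integral>\<^sup>+\<theta>\<in>{0..2*pi}. h (cis \<theta> *s b) \<partial>lborel)"
    proof (cases "b \<in> B")
      case True
      define S where "S = (\<lambda>\<tau>. \<tau> *s b) -` B"
      have cont: "continuous_on UNIV (\<lambda>\<tau>. \<tau> *s b)"
      proof -
        have "(\<lambda>\<tau>. \<tau> *s b) = (\<lambda>\<tau>. \<chi> j. \<tau> * b $ j)" by (auto simp: vec_eq_iff)
        then show ?thesis by (simp only:) (intro continuous_intros)
      qed
      have S: "open S" "cball 0 1 \<subseteq> S"
        unfolding S_def using cont B bal[OF True] by (auto simp: open_vimage continuous_on_eq_continuous_at intro!: open_vimage)
      have hol: "(\<lambda>\<tau>. f (\<tau> *s b)) holomorphic_on S"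
      proof (rule holomorphic_onI)
        fix \<tau> assume "\<tau> \<in> S"
        then obtain f' where f': "(f has_derivative f') (at (\<tau> *s b))" "\<And>c v. f' (c *s v) = c * f' v"
          using f unfolding S_def holomorphic_functions_def by blast
        have lin: "((\<lambda>\<tau>. \<tau> *s b) has_derivative (\<lambda>h. h *s b)) (at \<tau>)"
        proof (rule bounded_linear_imp_has_derivative, rule bounded_linear_intro[where K = "norm b"])
          show "norm (x *s b) \<le> norm x * norm b" for x :: complex
            by (simp add: norm_vec_def norm_mult L2_set_right_distrib)
        qed (auto simp: vec_eq_iff algebra_simps)
        have "((\<lambda>\<tau>. f (\<tau> *s b)) has_derivative (\<lambda>h. f' (h *s b))) (at \<tau>)"
          using has_derivative_compose[OF lin, of f f'] f'(1) by simp
        moreover have "(\<lambda>h. f' (h *s b)) = (*) (f' b)" by (simp add: fun_eq_iff f'(2))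
        ultimately have "((\<lambda>\<tau>. f (\<tau> *s b)) has_field_derivative f' b) (at \<tau>)"
          unfolding has_field_derivative_def by simp
        then show "(\<lambda>\<tau>. f (\<tau> *s b)) field_differentiable at \<tau> within S"
          using field_differentiable_def field_differentiable_at_within by blast
      qed
      define F where "F \<theta> = f (cis \<theta> *s b)" for \<theta>
      have mean: "(F has_integral 2 * pi * f 0) {0..2*pi}"
        using holomorphic_circle_mean_value[OF hol S] by (simp add: F_def[abs_def])
      have Fc: "continuous_on {0..2*pi} F"
      proof -
        have "continuous_on {0..2*pi} (\<lambda>\<theta>. 0 + cis \<theta> *s b)"
          by (rule continuous_on_subset[OF continuous_cis_smult]) auto
        then show ?thesis unfolding F_def
          using bal[OF True] by (intro continuous_on_compose2[OF fc]) auto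
      qed
      have qc: "continuous_on {0..2*pi} (\<lambda>\<theta>. (cmod (F \<theta>))\<^sup>2)" using Fc by (intro continuous_intros)
      then have qi: "set_integrable lborel {0..2*pi} (\<lambda>\<theta>. (cmod (F \<theta>))\<^sup>2)"
        by (rule borel_integrable_atLeastAtMost')
      have "((\<lambda>\<theta>. 2 * Re (cnj (f 0) * F \<theta>) - (cmod (f 0))\<^sup>2) has_integral
          2 * Re (cnj (f 0) * (2 * pi * f 0)) - (2*pi - 0) *\<^sub>R (cmod (f 0))\<^sup>2) {0..2*pi}"
        using has_integral_const_real[of "(cmod (f 0))\<^sup>2" 0 "2*pi"]
        by (intro has_integral_diff has_integral_mult_right has_integral_Re mean) simp
      moreover have "((\<lambda>\<theta>. (cmod (F \<theta>))\<^sup>2) has_integral integral {0..2*pi} (\<lambda>\<theta>. (cmod (F \<theta>))\<^sup>2)) {0..2*pi}"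
        using qc by (intro integrable_integral integrable_continuous_real)
      moreover have "2 * Re (cnj (f 0) * F \<theta>) - (cmod (f 0))\<^sup>2 \<le> (cmod (F \<theta>))\<^sup>2" for \<theta>
      proof -
        have "0 \<le> (Re (F \<theta>) - Re (f 0))\<^sup>2 + (Im (F \<theta>) - Im (f 0))\<^sup>2" by simp
        then show ?thesis unfolding cmod_power2 by (simp add: power2_eq_square algebra_simps)
      qed
      ultimately have "2 * Re (cnj (f 0) * (2 * pi * f 0)) - (2*pi - 0) *\<^sub>R (cmod (f 0))\<^sup>2
          \<le> integral {0..2*pi} (\<lambda>\<theta>. (cmod (F \<theta>))\<^sup>2)"
        by (rule has_integral_le)
      moreover have "Re (cnj (f 0) * (2 * pi * f 0)) = 2 * pi * (cmod (f 0))\<^sup>2"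
        unfolding cmod_power2 by (simp add: power2_eq_square algebra_simps)
      ultimately have "2 * pi * (cmod (f 0))\<^sup>2 \<le> integral {0..2*pi} (\<lambda>\<theta>. (cmod (F \<theta>))\<^sup>2)"
        by simp
      also have "\<dots> = (LINT \<theta>|lborel. indicator {0..2*pi} \<theta> * (cmod (F \<theta>))\<^sup>2)"
        using set_borel_integral_eq_integral(2)[OF qi] by (simp add: set_lebesgue_integral_def)
      finally have "ennreal (2 * pi * (cmod (f 0))\<^sup>2) \<le> ennreal (LINT \<theta>|lborel. indicator {0..2*pi} \<theta> * (cmod (F \<theta>))\<^sup>2)"
        by (rule ennreal_leI)
      also have "\<dots> = (\<integral>\<^sup>+\<theta>. ennreal (indicator {0..2*pi} \<theta> * (cmod (F \<theta>))\<^sup>2) \<partial>lborel)"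
        using qi unfolding set_integrable_def by (intro nn_integral_eq_integral[symmetric]) auto
      also have "\<dots> = (\<integral>\<^sup>+\<theta>\<in>{0..2*pi}. h (cis \<theta> *s b) \<partial>lborel)"
        using bal[OF True] by (intro nn_integral_cong) (auto simp: h_def F_def indicator_def)
      finally show ?thesis using True by simp
    qed auto
  qed
  also have "\<dots> = ennreal (2*pi) * (\<integral>\<^sup>+b. h b \<partial>lborel)"
    by (rule nn_integral_circle_average) measurable
  finally have "emeasure lborel B * ennreal ((cmod (f 0))\<^sup>2) \<le> (\<integral>\<^sup>+b. h b \<partial>lborel)"
    by (subst (asm) ennreal_mult_le_mult_iff) auto
  also have "\<dots> = (\<integral>\<^sup>+b\<in>B. ennreal ((cmod (f b))\<^sup>2) \<partial>lborel)"
    by (intro nn_integral_cong) (auto simp: h_def indicator_def)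
  finally show ?thesis .
qed

section \<open>A John-Nirenberg inequality\<close>

text \<open>The labels \<open>q x\<close> live in a bare type, so measurability is checked on single
  cells, where everything determined by the label is constant, and passes to \<open>S\<close> as a
  finite sum.\<close>

lemma nn_integral_finite_partition:
  assumes "finite (q ` S)"
    and "\<And>v. v \<in> q ` S \<Longrightarrow> (\<lambda>x. f x * indicator {x\<in>S. q x = v} x) \<in> borel_measurable M"
  shows "(\<integral>\<^sup>+x\<in>S. f x \<partial>M) = (\<Sum>v\<in>q ` S. \<integral>\<^sup>+x\<in>{x\<in>S. q x = v}. f x \<partial>M)"
    and "(\<lambda>x. f x * indicator S x) \<in> borel_measurable M"
proof -
  have eq: "(\<Sum>v\<in>q ` S. f x * indicator {x\<in>S. q x = v} x) = f x * indicator S x" for x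
  proof (cases "x \<in> S")
    case True
    have "(\<Sum>v\<in>q ` S. f x * indicator {x\<in>S. q x = v} x) = (\<Sum>v\<in>q ` S. if v = q x then f x else 0)"
      using True by (intro sum.cong) auto
    then show ?thesis using True assms(1) by simp
  qed simp
  show "(\<integral>\<^sup>+x\<in>S. f x \<partial>M) = (\<Sum>v\<in>q ` S. \<integral>\<^sup>+x\<in>{x\<in>S. q x = v}. f x \<partial>M)"
    unfolding eq[symmetric] using assms by (intro nn_integral_sum) auto
  show "(\<lambda>x. f x * indicator S x) \<in> borel_measurable M"
    unfolding eq[symmetric] using assms by (intro borel_measurable_sum) auto
qed

text \<open>One refinement step on a cell of measure \<open>p\<close>, where \<open>w\<close> is the
  integral of the deficit and \<open>d\<close> the drop of \<open>m\<close>. Since exp x \<le> 1 + 2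
  x for 0 \<le> x \<le> 1/2 and p + w / A \<le> 2 p, the exponential factor adds at most 4
  \<epsilon> d p. By 4 \<epsilon> A \<le> 1 this is at most d p / A, the simultaneous loss in the
  deficit term.\<close>

lemma exp_le_linear_mean:
  fixes \<epsilon> :: real
  assumes "0 < A" "0 \<le> d" "d \<le> A" "0 \<le> \<epsilon>" "4 * \<epsilon> * A \<le> 1" "0 \<le> p" "0 \<le> w" "w \<le> A * p"
  shows "exp (\<epsilon> * d) * (p + w / A) \<le> p + d / A * p + w / A"
proof -
  have ed: "0 \<le> \<epsilon> * d" "\<epsilon> * d \<le> \<epsilon> * A" using assms by (auto intro: mult_left_mono)
  then have "norm (exp (\<epsilon> * d)) \<le> 1 + 2 * norm (\<epsilon> * d)" using assms by (intro exp_bound_lemma) auto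
  then have "exp (\<epsilon> * d) - 1 \<le> 2 * (\<epsilon> * d)" using ed by simp
  moreover have "0 \<le> p + w / A" "p + w / A \<le> 2 * p" using assms by (auto simp: field_simps)
  ultimately have "(exp (\<epsilon> * d) - 1) * (p + w / A) \<le> (2 * (\<epsilon> * d)) * (2 * p)"
    using ed by (intro mult_mono) auto
  also have "\<dots> = (4 * \<epsilon>) * (d * p)" by simp
  also have "\<dots> \<le> (1 / A) * (d * p)" using assms by (intro mult_right_mono) (auto simp: field_simps)
  finally show ?thesis by (simp add: algebra_simps)
qed

text \<open>A John-Nirenberg inequality for an increasing process with bounded potential. The quantity
  \<open>Z k = \<integral> exp (\<epsilon> (m\<^sub>0 - m\<^sub>k)) (1 + (m\<^sub>k - u) / A)\<close> decreases in \<open>k\<close>: on each cell of the partition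
  at level \<open>k + 1\<close>, all functions but \<open>u\<close> are constant.\<close>

lemma exp_integral_le_of_bounded_potential:
  fixes q :: "nat \<Rightarrow> 'a \<Rightarrow> 'b" and F :: "nat \<Rightarrow> 'b \<Rightarrow> real" and u :: "'a \<Rightarrow> ereal"
  defines "m \<equiv> \<lambda>k x. F k (q k x)"
  assumes S[measurable]: "S \<in> sets M" "emeasure M S \<noteq> \<infinity>"
    and fin: "\<And>k. finite (q k ` S)"
    and cell[measurable]: "\<And>k v. {x\<in>S. q k x = v} \<in> sets M"
    and refine: "\<And>k x y. q (Suc k) x = q (Suc k) y \<Longrightarrow> q k x = q k y"
    and u[measurable]: "u \<in> borel_measurable M"
    and um: "\<And>k x. x \<in> S \<Longrightarrow> u x \<le> ereal (m k x)"
    and step: "\<And>k x. x \<in> S \<Longrightarrow> m (Suc k) x \<le> m k x" "\<And>k x. x \<in> S \<Longrightarrow> m k x \<le> m (Suc k) x + A"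
    and pot: "\<And>k y. y \<in> S \<Longrightarrow> (\<integral>\<^sup>+x\<in>{x\<in>S. q k x = q k y}. e2ennreal (ereal (m k y) - u x) \<partial>M)
        \<le> ennreal A * emeasure M {x\<in>S. q k x = q k y}"
    and A: "0 < A" and \<epsilon>: "0 \<le> \<epsilon>" "4 * \<epsilon> * A \<le> 1"
  shows "(\<integral>\<^sup>+x\<in>S. liminf (\<lambda>k. ennreal (exp (\<epsilon> * (m 0 x - m k x)))) \<partial>M) \<le> 2 * emeasure M S \<and>
    (\<lambda>x. liminf (\<lambda>k. ennreal (exp (\<epsilon> * (m 0 x - m k x)))) * indicator S x) \<in> borel_measurable M"
proof -
  let ?Q = "\<lambda>k v. {x\<in>S. q k x = v}"
  define V where "V k x = e2ennreal (ereal (m k x) - u x)" for k x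
  define E where "E k x = ennreal (exp (\<epsilon> * (m 0 x - m k x)))" for k x
  define f where "f k x = E k x * (1 + ennreal (1 / A) * V k x)" for k x
  define Z where "Z k = (\<integral>\<^sup>+x\<in>S. f k x \<partial>M)" for k
  have q0: "q 0 x = q 0 y" if "q k x = q k y" for k x y
    using that by (induction k) (auto dest: refine)
  have mconst: "m k x = m k y" "m 0 x = m 0 y" if "q k x = q k y" for k x y
    using that q0[OF that] by (auto simp: m_def)
  have Vc: "V k x = e2ennreal (ereal (m k y) - u x)" if "q k x = q k y" for k x y
    unfolding V_def using mconst(1)[OF that] by simp
  have fc: "f k x = E k y * (1 + ennreal (1 / A) * e2ennreal (ereal (m k y) - u x))" if "q k x = q k y" for k x y
    unfolding f_def E_def using Vc[OF that] mconst[OF that] by simp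
  have fmeas: "(\<lambda>x. f k x * indicator (?Q k v) x) \<in> borel_measurable M" if "v \<in> q k ` S" for k v
  proof -
    obtain y where y: "y \<in> S" "v = q k y" using \<open>v \<in> q k ` S\<close> by auto
    have "(\<lambda>x. f k x * indicator (?Q k v) x) = 
      (\<lambda>x. E k y * (1 + ennreal (1 / A) * e2ennreal (ereal (m k y) - u x)) * indicator (?Q k v) x)"
      using y by (auto simp: indicator_def fc[of k _ y])
    then show ?thesis by simp
  qed
  have Zdec: "Z (Suc k) \<le> Z k" for k
  proof -
    have meas: "(\<lambda>x. f k x * indicator (?Q (Suc k) v) x) \<in> borel_measurable M" if "v \<in> q (Suc k) ` S" for v
    proof -
      obtain y where y: "y \<in> S" "v = q (Suc k) y" using \<open>v \<in> q (Suc k) ` S\<close> by auto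
      have "(\<lambda>x. f k x * indicator (?Q (Suc k) v) x) = 
        (\<lambda>x. E k y * (1 + ennreal (1 / A) * e2ennreal (ereal (m k y) - u x)) * indicator (?Q (Suc k) v) x)"
        using y by (auto simp: indicator_def fc[OF refine, of k _ y])
      then show ?thesis by simp
    qed
    \<comment> \<open>On a finer cell \<open>m\<close> drops by a constant \<open>d\<close>, and the
      deficit at level \<open>k\<close> is that at level \<open>Suc k\<close> plus \<open>d\<close>.
      Both integrals thus become explicit in the measure \<open>p\<close> and the finer deficit
      \<open>w\<close>.\<close>
    have cellwise: "(\<integral>\<^sup>+x\<in>?Q (Suc k) v. f (Suc k) x \<partial>M) \<le> (\<integral>\<^sup>+x\<in>?Q (Suc k) v. f k x \<partial>M)"
      if "v \<in> q (Suc k) ` S" for v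
    proof -
      obtain y where y: "y \<in> S" "v = q (Suc k) y" using \<open>v \<in> q (Suc k) ` S\<close> by auto
      let ?R = "?Q (Suc k) v"
      define d where "d = m k y - m (Suc k) y"
      have d: "0 \<le> d" "d \<le> A" using step[OF y(1), of k] by (auto simp: d_def)
      define W where "W = (\<integral>\<^sup>+x\<in>?R. e2ennreal (ereal (m (Suc k) y) - u x) \<partial>M)"
      have Wle: "W \<le> ennreal A * emeasure M ?R" unfolding W_def y(2) by (rule pot[OF y(1)])
      have "emeasure M ?R \<noteq> \<infinity>" using emeasure_mono[of ?R S M] S by (auto simp: top_unique)
      then obtain p where p: "emeasure M ?R = ennreal p" "p \<ge> 0" by (cases "emeasure M ?R") auto
      have "W \<noteq> \<infinity>" using Wle p by (auto simp: top_unique ennreal_mult_eq_top_iff)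
      then obtain w where w: "W = ennreal w" "w \<ge> 0" by (cases W) auto
      have wp: "w \<le> A * p" using Wle p w A by (simp flip: ennreal_mult')
      have Es: "E (Suc k) y = E k y * ennreal (exp (\<epsilon> * d))"
        unfolding E_def d_def by (simp add: algebra_simps flip: ennreal_mult' exp_add)
      have "(\<integral>\<^sup>+x\<in>?R. f (Suc k) x \<partial>M) =
         (\<integral>\<^sup>+x. E (Suc k) y * (indicator ?R x + ennreal (1 / A) * (e2ennreal (ereal (m (Suc k) y) - u x) * indicator ?R x)) \<partial>M)"
        using y by (intro nn_integral_cong) (auto simp: indicator_def fc[of "Suc k" _ y])
      also have "\<dots> = E (Suc k) y * (emeasure M ?R + ennreal (1 / A) * W)"
        unfolding W_def by (simp add: nn_integral_cmult nn_integral_add)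
      also have "\<dots> = E k y * ennreal (exp (\<epsilon> * d) * (p + w / A))"
        unfolding Es p w using p(2) w(2) A by (simp add: mult.assoc flip: ennreal_mult' ennreal_plus)
      also have "\<dots> \<le> E k y * ennreal (p + d / A * p + w / A)"
        using exp_le_linear_mean[OF A d \<epsilon> p(2) w(2) wp] by (intro mult_left_mono ennreal_leI) auto
      also have "\<dots> = E k y * (emeasure M ?R + (ennreal (d / A) * emeasure M ?R + ennreal (1 / A) * W))"
        unfolding p w using p(2) w(2) A d by (simp add: add.assoc flip: ennreal_mult' ennreal_plus)
      also have "\<dots> = (\<integral>\<^sup>+x. E k y * (indicator ?R x + (ennreal (d / A) * indicator ?R x +
          ennreal (1 / A) * (e2ennreal (ereal (m (Suc k) y) - u x) * indicator ?R x))) \<partial>M)"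
        unfolding W_def by (simp add: nn_integral_cmult nn_integral_add)
      also have "\<dots> = (\<integral>\<^sup>+x\<in>?R. f k x \<partial>M)"
      proof (intro nn_integral_cong)
        fix x
        show "E k y * (indicator ?R x + (ennreal (d / A) * indicator ?R x +
          ennreal (1 / A) * (e2ennreal (ereal (m (Suc k) y) - u x) * indicator ?R x))) = f k x * indicator ?R x"
        proof (cases "x \<in> ?R")
          case True
          then have x: "x \<in> S" "q (Suc k) x = q (Suc k) y" using y by auto
          have ux: "u x \<le> ereal (m (Suc k) y)" using um[OF x(1), of "Suc k"] mconst(1)[OF x(2)] by simp
          have "V k x = e2ennreal (ereal (d + m (Suc k) y) - u x)"
            using Vc[OF refine[OF x(2)]] by (simp add: d_def)
          also have "\<dots> = ennreal d + e2ennreal (ereal (m (Suc k) y) - u x)"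
            using ux d by (cases "u x") (auto simp flip: ennreal_plus)
          finally have "ennreal (1 / A) * V k x = ennreal (d / A) + ennreal (1 / A) * e2ennreal (ereal (m (Suc k) y) - u x)"
            using A d by (simp add: distrib_left flip: ennreal_mult')
          moreover have "E k x = E k y" using mconst[OF refine[OF x(2)]] by (simp add: E_def)
          ultimately show ?thesis using True by (simp add: f_def)
        qed auto
      qed
      finally show ?thesis .
    qed
    have "Z (Suc k) = (\<Sum>v\<in>q (Suc k) ` S. \<integral>\<^sup>+x\<in>?Q (Suc k) v. f (Suc k) x \<partial>M)"
      unfolding Z_def by (rule nn_integral_finite_partition(1)[OF fin fmeas])
    also have "\<dots> \<le> (\<Sum>v\<in>q (Suc k) ` S. \<integral>\<^sup>+x\<in>?Q (Suc k) v. f k x \<partial>M)"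
      by (intro sum_mono cellwise)
    also have "\<dots> = Z k"
      unfolding Z_def by (rule nn_integral_finite_partition(1)[OF fin meas, symmetric])
    finally show ?thesis .
  qed
  have Z0: "Z 0 \<le> 2 * emeasure M S"
  proof -
    have "Z 0 = (\<Sum>v\<in>q 0 ` S. \<integral>\<^sup>+x\<in>?Q 0 v. f 0 x \<partial>M)"
      unfolding Z_def by (rule nn_integral_finite_partition(1)[OF fin fmeas])
    also have "\<dots> \<le> (\<Sum>v\<in>q 0 ` S. \<integral>\<^sup>+x\<in>?Q 0 v. 2 \<partial>M)"
    proof (rule sum_mono)
      fix v assume "v \<in> q 0 ` S"
      then obtain y where y: "y \<in> S" "v = q 0 y" by auto
      let ?W = "\<integral>\<^sup>+x\<in>?Q 0 v. e2ennreal (ereal (m 0 y) - u x) \<partial>M"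
      have "(\<integral>\<^sup>+x\<in>?Q 0 v. f 0 x \<partial>M) =
         (\<integral>\<^sup>+x. indicator (?Q 0 v) x + ennreal (1 / A) * (e2ennreal (ereal (m 0 y) - u x) * indicator (?Q 0 v) x) \<partial>M)"
        using y by (intro nn_integral_cong) (auto simp: indicator_def fc[of 0 _ y] E_def)
      also have "\<dots> = emeasure M (?Q 0 v) + ennreal (1 / A) * ?W"
        by (simp add: nn_integral_cmult nn_integral_add)
      also have "\<dots> \<le> emeasure M (?Q 0 v) + ennreal (1 / A) * (ennreal A * emeasure M (?Q 0 v))"
        using pot[OF y(1), of 0] y by (intro add_left_mono mult_left_mono) auto
      also have "\<dots> = 2 * emeasure M (?Q 0 v)"
        using A by (simp add: mult_2 flip: ennreal_mult' mult.assoc)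
      also have "\<dots> = (\<integral>\<^sup>+x\<in>?Q 0 v. 2 \<partial>M)" by (simp add: nn_integral_cmult_indicator)
      finally show "(\<integral>\<^sup>+x\<in>?Q 0 v. f 0 x \<partial>M) \<le> (\<integral>\<^sup>+x\<in>?Q 0 v. 2 \<partial>M)" .
    qed
    also have "\<dots> = (\<integral>\<^sup>+x\<in>S. 2 \<partial>M)"
      by (rule nn_integral_finite_partition(1)[OF fin, symmetric]) simp
    also have "\<dots> = 2 * emeasure M S" by (simp add: nn_integral_cmult_indicator)
    finally show ?thesis .
  qed
  have Zk: "Z k \<le> 2 * emeasure M S" for k
    using Z0 Zdec order_trans by (induction k) blast+
  have Em: "(\<lambda>x. E k x * indicator S x) \<in> borel_measurable M" for k
  proof (rule nn_integral_finite_partition(2)[OF fin])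
    fix v assume "v \<in> q k ` S"
    then obtain y where y: "y \<in> S" "v = q k y" by auto
    have "(\<lambda>x. E k x * indicator (?Q k v) x) = (\<lambda>x. E k y * indicator (?Q k v) x)"
    proof
      fix x
      have "E k x = E k y" if "x \<in> ?Q k v"
        using mconst[of k x y] that y by (simp add: E_def)
      then show "E k x * indicator (?Q k v) x = E k y * indicator (?Q k v) x"
        by (cases "x \<in> ?Q k v") auto
    qed
    then show "(\<lambda>x. E k x * indicator (?Q k v) x) \<in> borel_measurable M" by simp
  qed
  have eq: "liminf (\<lambda>k. E k x) * indicator S x = liminf (\<lambda>k. E k x * indicator S x)" for x
    by (auto simp: indicator_def Liminf_const)
  \<comment> \<open>Part of the conclusion because the constant exp (- \<epsilon> w) is later pulled
    out of this integral.\<close>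
  have meas: "(\<lambda>x. liminf (\<lambda>k. ennreal (exp (\<epsilon> * (m 0 x - m k x)))) * indicator S x) \<in> borel_measurable M"
    using Em unfolding E_def[symmetric] eq by measurable
  \<comment> \<open>Fatou's lemma. The deficit factor in \<open>f k\<close> is at least 1, so the
    bound on \<open>Z k\<close> also bounds the integral of \<open>E k\<close>.\<close>
  have "(\<integral>\<^sup>+x\<in>S. liminf (\<lambda>k. E k x) \<partial>M) = (\<integral>\<^sup>+x. liminf (\<lambda>k. E k x * indicator S x) \<partial>M)"
    unfolding eq ..
  also have "\<dots> \<le> liminf (\<lambda>k. \<integral>\<^sup>+x. E k x * indicator S x \<partial>M)"
    by (rule nn_integral_liminf) (rule Em)
  also have "\<dots> \<le> liminf (\<lambda>k. 2 * emeasure M S)"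
  proof (intro Liminf_mono always_eventually allI)
    fix k
    have "E k x \<le> f k x" for x unfolding f_def by (simp add: distrib_left)
    then have "(\<integral>\<^sup>+x. E k x * indicator S x \<partial>M) \<le> Z k"
      unfolding Z_def by (intro nn_integral_mono mult_right_mono) auto
    then show "(\<integral>\<^sup>+x. E k x * indicator S x \<partial>M) \<le> 2 * emeasure M S" using Zk order_trans by blast
  qed
  also have "\<dots> = 2 * emeasure M S" by (simp add: Liminf_const)
  finally show ?thesis using meas unfolding E_def by blast
qed

section \<open>Uniform exponential integrability\<close>

lemma mem_isotropic_polydisc:
  "0 < \<rho> \<Longrightarrow> z \<in> open_polydisc x 1 (ln \<rho>) \<longleftrightarrow> (\<forall>j. cmod (z $ j - x $ j) < \<rho>)"
  by (simp add: open_polydisc_def)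

lemma isotropic_polydisc_subset:
  assumes "0 < \<rho>" "\<And>j. cmod (x $ j - y $ j) + \<rho> \<le> \<rho>'"
  shows "open_polydisc x 1 (ln \<rho>) \<subseteq> open_polydisc y 1 (ln \<rho>')"
proof
  fix z assume z: "z \<in> open_polydisc x 1 (ln \<rho>)"
  have "\<rho>' > 0" using assms(1) assms(2)[of undefined] norm_ge_zero[of "x $ undefined - y $ undefined"] by linarith
  moreover have "cmod (z $ j - y $ j) < \<rho>'" for j
  proof -
    have "cmod (z $ j - y $ j) \<le> cmod (z $ j - x $ j) + cmod (x $ j - y $ j)"
      using norm_triangle_ineq[of "z $ j - x $ j" "x $ j - y $ j"] by simp
    then show ?thesis using z assms(2)[of j] unfolding mem_isotropic_polydisc[OF assms(1)] by (smt (verit))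
  qed
  ultimately show "z \<in> open_polydisc y 1 (ln \<rho>')" by (simp add: mem_isotropic_polydisc)
qed

lemma cmod_component_less:
  fixes z :: "complex^'n"
  assumes "\<And>i. i \<in> Basis \<Longrightarrow> \<bar>z \<bullet> i\<bar> < h"
  shows "cmod (z $ j) < 2 * h"
proof -
  have "\<bar>z \<bullet> axis j 1\<bar> < h" "\<bar>z \<bullet> axis j \<i>\<bar> < h"
    by (rule assms; auto simp: Basis_vec_def Basis_complex_def)+
  then have "\<bar>Re (z $ j)\<bar> < h" "\<bar>Im (z $ j)\<bar> < h"
    by (auto simp: inner_axis inner_complex_def)
  then show ?thesis using cmod_le[of "z $ j"] by linarith
qed

lemma inner_Basis_le_cmod:
  fixes z :: "complex^'n"
  assumes "i \<in> Basis" "\<And>j. cmod (z $ j) < h"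
  shows "\<bar>z \<bullet> i\<bar> < h"
proof -
  obtain j b where i: "i = axis j b" "b \<in> Basis" using assms(1) unfolding Basis_vec_def by auto
  then have "\<bar>z \<bullet> i\<bar> \<le> cmod (z $ j)"
    using abs_Re_le_cmod[of "z $ j"] abs_Im_le_cmod[of "z $ j"]
    by (auto simp: inner_axis inner_complex_def Basis_complex_def)
  then show ?thesis using assms(2)[of j] by simp
qed

text \<open>Rounds each real coordinate down to a multiple of 2^-k. The level sets are the half-open
  dyadic cubes of side 2^-k, labelled by their lower corners.\<close>

definition dyadic_corner :: "nat \<Rightarrow> 'a::euclidean_space \<Rightarrow> 'a" where
  "dyadic_corner k x = (\<Sum>i\<in>Basis. (of_int \<lfloor>2 ^ k * (x \<bullet> i)\<rfloor> / 2 ^ k) *\<^sub>R i)"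

lemma dyadic_corner_inner:
  "i \<in> Basis \<Longrightarrow> dyadic_corner k x \<bullet> i = of_int \<lfloor>2 ^ k * (x \<bullet> i)\<rfloor> / 2 ^ k"
  unfolding dyadic_corner_def by (simp add: inner_sum_left inner_Basis if_distrib sum.If_cases cong: if_cong)

lemma dyadic_corner_bounds:
  assumes "i \<in> Basis"
  shows "dyadic_corner k x \<bullet> i \<le> x \<bullet> i" "x \<bullet> i < dyadic_corner k x \<bullet> i + 1 / 2 ^ k"
proof -
  show "dyadic_corner k x \<bullet> i \<le> x \<bullet> i"
    unfolding dyadic_corner_inner[OF assms] by (simp add: field_simps)
  have "2 ^ k * (x \<bullet> i) < of_int \<lfloor>2 ^ k * (x \<bullet> i)\<rfloor> + 1" by simp
  then show "x \<bullet> i < dyadic_corner k x \<bullet> i + 1 / 2 ^ k"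
    unfolding dyadic_corner_inner[OF assms] by (simp add: field_simps)
qed

lemma dyadic_corner_eq_iff:
  "dyadic_corner k x = dyadic_corner k y \<longleftrightarrow> (\<forall>i\<in>Basis. \<lfloor>2 ^ k * (x \<bullet> i)\<rfloor> = \<lfloor>2 ^ k * (y \<bullet> i)\<rfloor>)"
proof
  assume eq: "dyadic_corner k x = dyadic_corner k y"
  show "\<forall>i\<in>Basis. \<lfloor>2 ^ k * (x \<bullet> i)\<rfloor> = \<lfloor>2 ^ k * (y \<bullet> i)\<rfloor>"
  proof
    fix i :: 'a assume i: "i \<in> Basis"
    have "dyadic_corner k x \<bullet> i = dyadic_corner k y \<bullet> i" using eq by simp
    then show "\<lfloor>2 ^ k * (x \<bullet> i)\<rfloor> = \<lfloor>2 ^ k * (y \<bullet> i)\<rfloor>" by (simp add: dyadic_corner_inner[OF i])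
  qed
qed (simp add: dyadic_corner_def)

lemma dyadic_corner_refine:
  assumes "dyadic_corner (Suc k) x = dyadic_corner (Suc k) y"
  shows "dyadic_corner k x = dyadic_corner k y"
proof -
  have "\<lfloor>2 ^ k * t\<rfloor> = \<lfloor>2 ^ Suc k * t\<rfloor> div 2" for t :: real
    using floor_divide_real_eq_div[of 2 "2 ^ Suc k * t"] by simp
  then show ?thesis using assms unfolding dyadic_corner_eq_iff by simp
qed

lemma borel_measurable_dyadic_corner: "dyadic_corner k \<in> borel_measurable borel"
  unfolding dyadic_corner_def by measurable

lemma mem_cube:
  fixes l :: "'a::euclidean_space"
  shows "x \<in> cbox l (l + h *\<^sub>R One) \<longleftrightarrow> (\<forall>i\<in>Basis. l \<bullet> i \<le> x \<bullet> i \<and> x \<bullet> i \<le> l \<bullet> i + h)"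
    and "x \<in> box l (l + h *\<^sub>R One) \<longleftrightarrow> (\<forall>i\<in>Basis. l \<bullet> i < x \<bullet> i \<and> x \<bullet> i < l \<bullet> i + h)"
  by (simp_all add: mem_box inner_add_left)

lemma emeasure_lborel_cube:
  fixes l :: "'a::euclidean_space"
  assumes "0 \<le> h"
  shows "emeasure lborel (cbox l (l + h *\<^sub>R One)) = ennreal (h ^ DIM('a))"
    and "emeasure lborel (box l (l + h *\<^sub>R One)) = ennreal (h ^ DIM('a))"
proof -
  have "(\<Prod>i\<in>Basis. (l + h *\<^sub>R One - l) \<bullet> i) = (\<Prod>i\<in>(Basis::'a set). h)"
    by (intro prod.cong) auto
  then have *: "(\<Prod>i\<in>Basis. (l + h *\<^sub>R One - l) \<bullet> i) = h ^ DIM('a)" by simp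
  have "l \<bullet> i \<le> (l + h *\<^sub>R One) \<bullet> i" if "i \<in> Basis" for i
    using assms that by (simp add: inner_add_left)
  then show "emeasure lborel (cbox l (l + h *\<^sub>R One)) = ennreal (h ^ DIM('a))"
      "emeasure lborel (box l (l + h *\<^sub>R One)) = ennreal (h ^ DIM('a))"
    unfolding *[symmetric] by (auto intro!: emeasure_lborel_cbox emeasure_lborel_box)
qed

text \<open>On each dyadic cube, \<open>m\<close> is the supremum of \<open>u\<close> over a polydisc that contains the cube. By the
  three polydiscs theorem, its oscillation at all small scales is bounded by that at scale 1, so the
  potential of \<open>u\<close> is bounded too, by the submean inequality.\<close>

lemma plurisubharmonic_exp_integral_bound:
  fixes u :: "complex^'n \<Rightarrow> ereal"
  defines "N \<equiv> DIM(complex^'n)"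
  assumes u: "plurisubharmonic_on \<Omega> u" and \<Omega>: "open \<Omega>" "open_polydisc 0 1 (ln 14) \<subseteq> \<Omega>"
    and N1: "polydisc_sup u 0 1 0 = ereal w" and N14: "polydisc_sup u 0 1 (ln 14) \<le> ereal (w + C)"
    and C: "0 \<le> C" and \<epsilon>: "0 < \<epsilon>" "4 * \<epsilon> * (12 ^ N * (C + 1)) \<le> 1"
  shows "(\<integral>\<^sup>+x\<in>unit_polydisc. exp_ext (- (ereal \<epsilon> * u x)) \<partial>lborel) \<le> ennreal (2 * 2 ^ N * exp (- \<epsilon> * w))"
proof -

  \<comment> \<open>Suprema around points of the unit scale\<close>
  let ?D = "\<lambda>x \<rho>. open_polydisc x 1 (ln \<rho>)"
  define n where "n x \<rho> = real_of_ereal (polydisc_sup u x 1 (ln \<rho>))" for x \<rho>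
  have one: "0 < (1::real^'n) $ j" for j by simp
  have usc: "upper_semicontinuous_on \<Omega> u" and fin: "\<And>z. z \<in> \<Omega> \<Longrightarrow> u z \<noteq> \<infinity>"
    using u unfolding plurisubharmonic_on_def by auto
  define G where "G = {v::complex^'n. \<forall>j. cmod (v $ j) \<le> 2}"
  \<comment> \<open>\<open>G\<close> contains the corners of all cells used. The radius 14 is 2 +
    12, and 4 \<ge> 2 + 1; so around every corner the suprema at the radii 4 and 12 lie between
    \<open>w\<close> and \<open>w + C\<close>.\<close>
  have sub14: "?D v \<rho> \<subseteq> ?D 0 14" if "v \<in> G" "0 < \<rho>" "\<rho> \<le> 12" for v \<rho>
  proof (rule isotropic_polydisc_subset)
    show "cmod (v $ j - 0 $ j) + \<rho> \<le> 14" for j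
      using that unfolding G_def by (smt (verit, best) diff_zero mem_Collect_eq zero_index)
  qed (use that in auto)
  have sub1: "?D 0 1 \<subseteq> ?D v 4" if "v \<in> G" for v
  proof (rule isotropic_polydisc_subset)
    show "cmod (0 $ j - v $ j) + 1 \<le> 4" for j
      using that unfolding G_def by (smt (verit, best) diff_0 mem_Collect_eq norm_minus_cancel zero_index)
  qed auto
  have up: "polydisc_sup u v 1 (ln 12) \<le> ereal (w + C)" if "v \<in> G" for v
    using polydisc_sup_mono[OF sub14[OF that, of 12]] N14 order_trans by auto
  have low: "ereal w \<le> polydisc_sup u v 1 (ln 4)" if "v \<in> G" for v
    using polydisc_sup_mono[OF sub1[OF that], of u] N1 by simp
  have finS: "\<bar>polydisc_sup u v 1 s\<bar> \<noteq> \<infinity>" if "v \<in> G" "s \<le> ln 12" for v s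
  proof (rule polydisc_sup_finite[OF u \<Omega>(1) _ one _ _ _ that(2)])
    show "?D v 12 \<subseteq> \<Omega>" using sub14[OF that(1), of 12] \<Omega>(2) by auto
    show "polydisc_sup u v 1 (ln 12) \<noteq> \<infinity>" using up[OF that(1)] by auto
    show "polydisc_sup u v 1 (ln 4) \<noteq> -\<infinity>" using low[OF that(1)] by auto
  qed simp
  have n: "polydisc_sup u v 1 (ln \<rho>) = ereal (n v \<rho>)" if "v \<in> G" "0 < \<rho>" "\<rho> \<le> 12" for v \<rho>
    using finS[OF that(1), of "ln \<rho>"] that unfolding n_def by (simp add: ereal_real)
  have nmono: "n v \<rho> \<le> n v' \<rho>'"
    if "v \<in> G" "v' \<in> G" "0 < \<rho>" "\<rho> \<le> 12" "\<rho>' \<le> 12" "\<And>j. cmod (v $ j - v' $ j) + \<rho> \<le> \<rho>'" for v v' \<rho> \<rho>'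
  proof -
    have "\<rho> \<le> \<rho>'" using that(6)[of undefined] norm_ge_zero[of "v $ undefined - v' $ undefined"] by linarith
    then have "ereal (n v \<rho>) \<le> ereal (n v' \<rho>')"
      using polydisc_sup_mono[OF isotropic_polydisc_subset[OF that(3,6)], of u] that
      by (simp add: n)
    then show ?thesis by simp
  qed
  \<comment> \<open>On the logarithmic scale the step has constant length ln 3, so convexity
    compares it with the step from 4 to 12.\<close>
  have slope: "n v (3 * t) - n v t \<le> C" if v: "v \<in> G" and t: "0 < t" "t \<le> 4" for v t
  proof -
    have cv: "convex_on {..ln 12} (\<lambda>s. real_of_ereal (polydisc_sup u v 1 s))"
      using sub14[OF v, of 12] \<Omega>(2) by (intro polydisc_sup_convex[OF u \<Omega>(1) _ one finS[OF v]]) auto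
    have l: "ln (3 * t) = ln t + ln 3" "ln 12 = ln 4 + ln (3::real)"
      using t ln_mult[of 3 t] ln_mult[of 4 "3::real"] by auto
    have "n v (3 * t) - n v t \<le> n v 12 - n v 4"
      unfolding n_def l using t l
      by (intro convex_on_increment_mono[OF cv]) auto
    moreover have "n v 12 \<le> w + C" using up[OF v] by (simp add: n[OF v])
    moreover have "w \<le> n v 4" using low[OF v] by (simp add: n[OF v])
    ultimately show ?thesis by simp
  qed
  \<comment> \<open>Half-open, so that at every level it is an exact union of dyadic cells, and each
    cell has its full measure in the potential bound.\<close>
  define S where "S = {x::complex^'n. \<forall>i\<in>Basis. -1 \<le> x \<bullet> i \<and> x \<bullet> i < 1}"
  have Sm[measurable]: "S \<in> sets borel"
  proof -
    have "S = (\<Inter>i\<in>Basis. {x. -1 \<le> x \<bullet> i} \<inter> {x. x \<bullet> i < 1})" by (auto simp: S_def)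
    moreover have "{x. -1 \<le> x \<bullet> i} \<inter> {x. x \<bullet> i < 1} \<in> sets borel" for i :: "complex^'n"
      by measurable
    ultimately show ?thesis by (auto intro!: sets.finite_INT)
  qed
  have Se: "emeasure lborel S \<le> ennreal (2 ^ N)"
  proof -
    have "S \<subseteq> cbox (- One) (- One + 2 *\<^sub>R One)" unfolding S_def mem_cube subset_iff by (auto simp: less_imp_le)
    then have "emeasure lborel S \<le> emeasure lborel (cbox (- One) (- One + 2 *\<^sub>R One :: complex^'n))"
      by (intro emeasure_mono) auto
    also have "\<dots> = ennreal (2 ^ N)"
      unfolding N_def by (rule emeasure_lborel_cube) simp
    finally show ?thesis .
  qed
  have qS: "-1 \<le> dyadic_corner k x \<bullet> i" "dyadic_corner k x \<bullet> i + 1 / 2 ^ k \<le> 1" if x: "x \<in> S" and i: "i \<in> Basis" for x i k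
  proof -
    have xi: "-1 \<le> x \<bullet> i" "x \<bullet> i < 1" using x i by (auto simp: S_def)
    have "- (2 ^ k) \<le> \<lfloor>2 ^ k * (x \<bullet> i)\<rfloor>"
      unfolding le_floor_iff using mult_left_mono[OF xi(1), of "2 ^ k"] by simp
    then have "real_of_int (- (2 ^ k)) \<le> real_of_int \<lfloor>2 ^ k * (x \<bullet> i)\<rfloor>" by (rule of_int_le_iff[THEN iffD2])
    then show "-1 \<le> dyadic_corner k x \<bullet> i"
      unfolding dyadic_corner_inner[OF i] by (simp add: field_simps)
    have "\<lfloor>2 ^ k * (x \<bullet> i)\<rfloor> < 2 ^ k"
      unfolding floor_less_iff using mult_strict_left_mono[OF xi(2), of "2 ^ k"] by simp
    then have "real_of_int (\<lfloor>2 ^ k * (x \<bullet> i)\<rfloor> + 1) \<le> real_of_int (2 ^ k)" by (intro of_int_le_iff[THEN iffD2]) simp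
    then show "dyadic_corner k x \<bullet> i + 1 / 2 ^ k \<le> 1"
      unfolding dyadic_corner_inner[OF i] by (simp add: field_simps)
  qed
  define h where "h k = 1 / (2::real) ^ k" for k :: nat
  have h: "0 < h k" "h k \<le> 1" "h (Suc k) = h k / 2" for k by (auto simp: h_def field_simps)
  have qG: "dyadic_corner k x \<in> G" if "x \<in> S" for k x
  proof -
    have "cmod (dyadic_corner k x $ j) \<le> 2" for j
    proof (rule field_le_epsilon)
      \<comment> \<open>The corner may have coordinates equal to -1, while
        \<open>cmod_component_less\<close> asks for a strict bound.\<close>
      fix e :: real assume "0 < e"
      have "\<bar>dyadic_corner k x \<bullet> i\<bar> < 1 + e / 2" if "i \<in> Basis" for i
        using qS[OF \<open>x \<in> S\<close> that, of k] h[of k] \<open>0 < e\<close> unfolding h_def by linarith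
      then have "cmod (dyadic_corner k x $ j) < 2 * (1 + e / 2)" by (rule cmod_component_less)
      then show "cmod (dyadic_corner k x $ j) \<le> 2 + e" by simp
    qed
    then show ?thesis by (simp add: G_def)
  qed
  have near: "cmod ((x - dyadic_corner k x) $ j) < 2 * h k" for x :: "complex^'n" and k j
  proof (rule cmod_component_less)
    fix i :: "complex^'n" assume "i \<in> Basis"
    from dyadic_corner_bounds[OF this, where k = k and x = x] show "\<bar>(x - dyadic_corner k x) \<bullet> i\<bar> < h k"
      by (simp add: inner_diff_left h_def)
  qed
  have near': "cmod ((dyadic_corner (Suc k) x - dyadic_corner k x) $ j) < 2 * h k"
    for x :: "complex^'n" and k j
  proof (rule cmod_component_less)
    fix i :: "complex^'n" assume i: "i \<in> Basis"
    have "dyadic_corner l x \<bullet> i \<le> x \<bullet> i" "x \<bullet> i < dyadic_corner l x \<bullet> i + h l" for l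
      unfolding h_def by (rule dyadic_corner_bounds[OF i])+
    from this[of k] this[of "Suc k"] h[of k]
    show "\<bar>(dyadic_corner (Suc k) x - dyadic_corner k x) \<bullet> i\<bar> < h k"
      unfolding inner_diff_left by linarith
  qed
  \<comment> \<open>Radius 4 h: the corner of a child cell is within 2 h of that of its parent, so
    the child polydisc, of radius 2 h, is nested in the parent's. The reverse inclusion takes radius
    2 h + 4 h, three times the child radius, which is the factor in \<open>slope\<close>.\<close>
  define F where "F k v = n v (4 * h k)" for k :: nat and v
  define m where "m k x = F k (dyadic_corner k x)" for k x
  define U where "U z = (if z \<in> \<Omega> then u z else 0)" for z
  have Um[measurable]: "U \<in> borel_measurable borel" unfolding U_def by (rule usc_borel_measurable[OF \<Omega>(1) usc])
  have S\<Omega>: "x \<in> \<Omega>" if "x \<in> S" for x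
  proof -
    have "cmod (x $ j) < 14" for j
    proof -
      have "\<bar>x \<bullet> i\<bar> < 2" if "i \<in> Basis" for i using \<open>x \<in> S\<close> that by (force simp: S_def)
      then have "cmod (x $ j) < 2 * 2" by (rule cmod_component_less)
      then show ?thesis by simp
    qed
    then have "x \<in> ?D 0 14" by (simp add: mem_isotropic_polydisc)
    then show ?thesis using \<Omega>(2) by auto
  qed
  \<comment> \<open>The factor \<open>12 ^ N\<close> compares the volume of a cube of side 12 h
    around the polydisc \<open>B\<close> below with that of a cell; \<open>C + 1\<close> bounds the
    deficit at the centre \<open>z\<close> of the submean inequality.\<close>
  define A where "A = 12 ^ N * (C + 1)"
  have "1 \<le> (12::real) ^ N" by simp
  then have "1 * (C + 1) \<le> A" unfolding A_def using C by (intro mult_right_mono) auto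
  then have A: "0 < A" "C \<le> A" using C by auto
  have um: "u x \<le> ereal (m k x)" if x: "x \<in> S" for x k
  proof -
    have "x \<in> ?D (dyadic_corner k x) (4 * h k)"
      unfolding mem_isotropic_polydisc[OF mult_pos_pos[OF zero_less_numeral h(1)]]
    proof
      show "cmod (x $ j - dyadic_corner k x $ j) < 4 * h k" for j
        using near[of x k j] h[of k] by simp
    qed
    then have "u x \<le> polydisc_sup u (dyadic_corner k x) 1 (ln (4 * h k))" by (rule polydisc_sup_upper)
    also have "\<dots> = ereal (m k x)" unfolding m_def F_def using h[of k] by (intro n qG x) auto
    finally show ?thesis .
  qed

  \<comment> \<open>Hypotheses of the John-Nirenberg inequality\<close>
  have JN: "(\<integral>\<^sup>+x\<in>S. liminf (\<lambda>k. ennreal (exp (\<epsilon> * (m 0 x - m k x)))) \<partial>lborel) \<le> 2 * emeasure lborel S \<and>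
    (\<lambda>x. liminf (\<lambda>k. ennreal (exp (\<epsilon> * (m 0 x - m k x)))) * indicator S x) \<in> borel_measurable lborel"
    unfolding m_def
  proof (rule exp_integral_le_of_bounded_potential[where u = U and A = A and q = dyadic_corner and F = F])
    show "S \<in> sets lborel" "emeasure lborel S \<noteq> \<infinity>" using Se by (auto simp: top_unique)
    show "finite (dyadic_corner k ` S)" for k
    proof (rule finite_subset)
      let ?P = "PiE (Basis :: (complex^'n) set) (\<lambda>_. {- (2 ^ k)..2 ^ k :: int})"
      show "finite ((\<lambda>f. \<Sum>i\<in>Basis. (of_int (f i) / 2 ^ k) *\<^sub>R i) ` ?P)" by (intro finite_imageI finite_PiE) auto
      show "dyadic_corner k ` S \<subseteq> (\<lambda>f. \<Sum>i\<in>Basis. (of_int (f i) / 2 ^ k) *\<^sub>R i) ` ?P"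
      proof
        fix v assume "v \<in> dyadic_corner k ` S"
        then obtain x where x: "x \<in> S" "v = dyadic_corner k x" by auto
        define f where "f = restrict (\<lambda>i. \<lfloor>2 ^ k * (x \<bullet> i)\<rfloor>) Basis"
        have "v = (\<Sum>i\<in>Basis. (of_int (f i) / 2 ^ k) *\<^sub>R i)"
          unfolding x dyadic_corner_def f_def by (intro sum.cong) auto
        moreover have "f \<in> ?P"
        proof (unfold f_def, rule restrict_PiE_iff[THEN iffD2], rule ballI)
          fix i :: "complex^'n" assume i: "i \<in> Basis"
          have "-1 \<le> x \<bullet> i" "x \<bullet> i < 1" using x i by (auto simp: S_def)
          then have "- (2 ^ k) \<le> 2 ^ k * (x \<bullet> i)" "2 ^ k * (x \<bullet> i) < 2 ^ k"
            using mult_left_mono[of "-1" "x \<bullet> i" "2 ^ k"] by auto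
          then have "2 ^ k * (x \<bullet> i) < 2 ^ k + 1" by linarith
          with \<open>- (2 ^ k) \<le> 2 ^ k * (x \<bullet> i)\<close> show "\<lfloor>2 ^ k * (x \<bullet> i)\<rfloor> \<in> {- (2 ^ k)..2 ^ k}"
            by (auto simp: le_floor_iff floor_le_iff)
        qed
        ultimately show "v \<in> (\<lambda>f. \<Sum>i\<in>Basis. (of_int (f i) / 2 ^ k) *\<^sub>R i) ` ?P" by blast
      qed
    qed
    show cell: "{x \<in> S. dyadic_corner k x = v} \<in> sets lborel" for k v
      using borel_measurable_dyadic_corner[of k, measurable] by measurable
    show "dyadic_corner k x = dyadic_corner k y" if "dyadic_corner (Suc k) x = dyadic_corner (Suc k) y"
      for k and x y :: "complex^'n" using that by (rule dyadic_corner_refine)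
    show "U \<in> borel_measurable lborel" by simp
    show "U x \<le> ereal (F k (dyadic_corner k x))" if "x \<in> S" for k x
      using um[OF that, of k] S\<Omega>[OF that] by (simp add: U_def m_def)
    show "F (Suc k) (dyadic_corner (Suc k) x) \<le> F k (dyadic_corner k x)" if x: "x \<in> S" for k x
      unfolding F_def
    proof (rule nmono[OF qG[OF x] qG[OF x]])
      show "cmod (dyadic_corner (Suc k) x $ j - dyadic_corner k x $ j) + 4 * h (Suc k) \<le> 4 * h k" for j
        using near'[of k x j] h[of k] by simp
    qed (use h[of k] in auto)
    show "F k (dyadic_corner k x) \<le> F (Suc k) (dyadic_corner (Suc k) x) + A" if x: "x \<in> S" for k x
    proof -
      have "F k (dyadic_corner k x) \<le> n (dyadic_corner (Suc k) x) (3 * (4 * h (Suc k)))"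
        unfolding F_def
      proof (rule nmono[OF qG[OF x] qG[OF x]])
        show "cmod (dyadic_corner k x $ j - dyadic_corner (Suc k) x $ j) + 4 * h k \<le> 3 * (4 * h (Suc k))" for j
          using near'[of k x j] h[of k] by (simp add: norm_minus_commute)
      qed (use h[of k] in auto)
      also have "\<dots> \<le> F (Suc k) (dyadic_corner (Suc k) x) + C"
        using slope[OF qG[OF x, of "Suc k"], of "4 * h (Suc k)"] h[of "Suc k"] unfolding F_def by simp
      finally show ?thesis using A by simp
    qed
    show "(\<integral>\<^sup>+x\<in>{x \<in> S. dyadic_corner k x = dyadic_corner k y}. e2ennreal (ereal (F k (dyadic_corner k y)) - U x) \<partial>lborel)
        \<le> ennreal A * emeasure lborel {x \<in> S. dyadic_corner k x = dyadic_corner k y}" if y: "y \<in> S" for k y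
    proof -
      define v where "v = dyadic_corner k y"
      define Q where "Q = {x \<in> S. dyadic_corner k x = v}"
      have v: "v \<in> G" unfolding v_def by (rule qG[OF y])
      \<comment> \<open>The submean inequality is centred where \<open>u\<close> nearly attains its
        supremum, because \<open>u\<close> may be -\<infinity> at the corner. The slack 1 reappears
        in \<open>C + 1\<close>.\<close>
      have "ereal (F k v - 1) < polydisc_sup u v 1 (ln (4 * h k))"
        using n[OF v, of "4 * h k"] h[of k] by (simp add: F_def)
      then obtain z where z: "z \<in> ?D v (4 * h k)" "ereal (F k v - 1) < u z"
        unfolding polydisc_sup_def less_SUP_iff by auto
      \<comment> \<open>Seen from \<open>z\<close>, radius 6 h = 2 h + 4 h covers the cell, and 4 h
        + 6 h \<le> 12 h stays where \<open>slope\<close> controls the supremum.\<close>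
      define B where "B = ?D (0::complex^'n) (6 * h k)"
      have B: "b \<in> B \<longleftrightarrow> (\<forall>j. cmod (b $ j) < 6 * h k)" for b
        unfolding B_def using h[of k] by (simp add: mem_isotropic_polydisc)
      have zv: "cmod (z $ j - v $ j) < 4 * h k" for j using z(1) h[of k] by (simp add: mem_isotropic_polydisc)
      have zB: "z + b \<in> ?D v (12 * h k)" if "b \<in> B" for b
      proof -
        have "cmod ((z + b) $ j - v $ j) < 12 * h k" for j
        proof -
          have "cmod ((z + b) $ j - v $ j) \<le> cmod (z $ j - v $ j) + cmod (b $ j)"
            using norm_triangle_ineq[of "z $ j - v $ j" "b $ j"] by (simp add: algebra_simps)
          then show ?thesis using zv[of j] that h[of k] unfolding B by (smt (verit))
        qed
        then show ?thesis using h[of k] by (simp add: mem_isotropic_polydisc)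
      qed
      have uB: "u (z + b) \<le> ereal (n v (12 * h k))" if "b \<in> B" for b
        using polydisc_sup_upper[OF zB[OF that], of u] n[OF v, of "12 * h k"] h[of k] by simp
      have QB: "x - z \<in> B" if "x \<in> Q" for x
        unfolding B
      proof
        fix j
        have "cmod (x $ j - v $ j) < 2 * h k" using near[of x k j] that by (simp add: Q_def h_def)
        moreover have "cmod ((x - z) $ j) \<le> cmod (x $ j - v $ j) + cmod (z $ j - v $ j)"
          using norm_triangle_ineq4[of "x $ j - v $ j" "z $ j - v $ j"] by simp
        ultimately show "cmod ((x - z) $ j) < 6 * h k" using zv[of j] by simp
      qed
      have Bm[measurable]: "B \<in> sets borel" unfolding B_def by (intro borel_open open_open_polydisc)
      have Qm[measurable]: "Q \<in> sets borel" unfolding Q_def using cell[of k v] by simp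
      have Be: "emeasure lborel B \<le> ennreal ((12 * h k) ^ N)"
      proof -
        let ?l = "- ((6 * h k) *\<^sub>R One) :: complex^'n"
        have "B \<subseteq> cbox ?l (?l + (12 * h k) *\<^sub>R One)"
        proof
          fix b assume b: "b \<in> B"
          have "\<bar>b \<bullet> i\<bar> < 6 * h k" if "i \<in> Basis" for i
            using inner_Basis_le_cmod[OF that, of b "6 * h k"] b B by auto
          then show "b \<in> cbox ?l (?l + (12 * h k) *\<^sub>R One)"
            unfolding mem_cube
            by (auto simp: abs_less_iff less_imp_le) (smt (verit))
        qed
        then have "emeasure lborel B \<le> emeasure lborel (cbox ?l (?l + (12 * h k) *\<^sub>R One))"
          by (intro emeasure_mono) auto
        also have "\<dots> = ennreal ((12 * h k) ^ N)"
          unfolding N_def using h[of k] by (intro emeasure_lborel_cube) simp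
        finally show ?thesis .
      qed
      have Qe: "ennreal (h k ^ N) \<le> emeasure lborel Q"
      proof -
        have "box v (v + h k *\<^sub>R One) \<subseteq> Q"
        proof
          fix x assume "x \<in> box v (v + h k *\<^sub>R One)"
          then have x: "v \<bullet> i < x \<bullet> i" "x \<bullet> i < v \<bullet> i + h k" if "i \<in> Basis" for i
            using that unfolding mem_cube by auto
          have "\<lfloor>2 ^ k * (x \<bullet> i)\<rfloor> = \<lfloor>2 ^ k * (y \<bullet> i)\<rfloor>" if i: "i \<in> Basis" for i
          proof -
            define f where "f = \<lfloor>2 ^ k * (y \<bullet> i)\<rfloor>"
            have "v \<bullet> i = of_int f / 2 ^ k" unfolding v_def f_def by (rule dyadic_corner_inner[OF i])
            then have vi: "2 ^ k * (v \<bullet> i) = of_int f" "2 ^ k * (v \<bullet> i + h k) = of_int f + 1"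
              by (simp_all add: h_def field_simps)
            have "2 ^ k * (v \<bullet> i) < 2 ^ k * (x \<bullet> i)" "2 ^ k * (x \<bullet> i) < 2 ^ k * (v \<bullet> i + h k)"
              using x[OF i] by (intro mult_strict_left_mono; simp)+
            then have "of_int f < 2 ^ k * (x \<bullet> i)" "2 ^ k * (x \<bullet> i) < of_int f + 1"
              unfolding vi by auto
            then show ?thesis unfolding f_def[symmetric] by (intro floor_unique) auto
          qed
          then have "dyadic_corner k x = v" unfolding v_def dyadic_corner_eq_iff by simp
          moreover have "x \<in> S"
            unfolding S_def using x qS[OF y, of _ k] by (force simp: v_def h_def)
          ultimately show "x \<in> Q" by (simp add: Q_def)
        qed
        then have "emeasure lborel (box v (v + h k *\<^sub>R One)) \<le> emeasure lborel Q" by (intro emeasure_mono) auto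
        moreover have "emeasure lborel (box v (v + h k *\<^sub>R One)) = ennreal (h k ^ N)"
          unfolding N_def using h[of k] by (intro emeasure_lborel_cube) simp
        ultimately show ?thesis by simp
      qed
      have FC: "F k v \<le> n v (12 * h k)" "n v (12 * h k) - F k v \<le> C"
        using slope[OF v, of "4 * h k"] nmono[OF v v, of "4 * h k" "12 * h k"] h[of k] by (auto simp: F_def)
      have "(\<integral>\<^sup>+x\<in>Q. e2ennreal (ereal (F k v) - U x) \<partial>lborel)
          \<le> (\<integral>\<^sup>+x. e2ennreal (ereal (n v (12 * h k)) - U x) * indicator B (x - z) \<partial>lborel)"
      proof (rule nn_integral_mono)
        fix x
        show "e2ennreal (ereal (F k v) - U x) * indicator Q x \<le> e2ennreal (ereal (n v (12 * h k)) - U x) * indicator B (x - z)"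
          using QB[of x] FC(1) by (auto simp: indicator_def intro!: e2ennreal_mono ereal_minus_mono)
      qed
      also have "\<dots> = (\<integral>\<^sup>+b. e2ennreal (ereal (n v (12 * h k)) - U (z + b)) * indicator B (z + b - z) \<partial>lborel)"
        by (rule nn_integral_lborel_shift[symmetric]) measurable
      also have "\<dots> = (\<integral>\<^sup>+b\<in>B. e2ennreal (ereal (n v (12 * h k)) - u (z + b)) \<partial>lborel)"
      proof (rule nn_integral_cong)
        fix b
        have "z + b \<in> \<Omega>" if "b \<in> B" using zB[OF that] sub14[OF v, of "12 * h k"] h[of k] \<Omega>(2) by auto
        then show "e2ennreal (ereal (n v (12 * h k)) - U (z + b)) * indicator B (z + b - z) =
           e2ennreal (ereal (n v (12 * h k)) - u (z + b)) * indicator B b"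
          by (auto simp: U_def indicator_def)
      qed
      also have "\<dots> \<le> emeasure lborel B * e2ennreal (ereal (n v (12 * h k)) - u z)"
      proof (rule plurisubharmonic_volume_submean[OF u \<Omega>(1) _ Bm _ uB])
        show "z + b \<in> \<Omega>" if "b \<in> B" for b using zB[OF that] sub14[OF v, of "12 * h k"] h[of k] \<Omega>(2) by auto
        show "\<tau> *s b \<in> B" if "b \<in> B" "cmod \<tau> \<le> 1" for b \<tau>
          unfolding B
        proof
          fix j
          have "cmod ((\<tau> *s b) $ j) \<le> 1 * cmod (b $ j)"
            using that by (simp add: norm_mult mult_left_le_one_le)
          then show "cmod ((\<tau> *s b) $ j) < 6 * h k" using that(1) unfolding B by (smt (verit))
        qed
      qed
      also have "\<dots> \<le> ennreal ((12 * h k) ^ N) * ennreal (C + 1)"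
      proof (intro mult_mono Be)
        have "ereal (n v (12 * h k)) - u z \<le> ereal (n v (12 * h k)) - ereal (F k v - 1)"
          using z(2) by (intro ereal_minus_mono) auto
        also have "\<dots> \<le> ereal (C + 1)" using FC(2) by simp
        finally show "e2ennreal (ereal (n v (12 * h k)) - u z) \<le> ennreal (C + 1)"
          using e2ennreal_mono by fastforce
      qed auto
      also have "\<dots> = ennreal ((12 * h k) ^ N * (C + 1))"
        using C h[of k] by (intro ennreal_mult[symmetric]) auto
      also have "(12 * h k) ^ N * (C + 1) = A * h k ^ N"
        by (simp add: A_def power_mult_distrib mult_ac)
      also have "ennreal \<dots> = ennreal A * ennreal (h k ^ N)"
        using A h[of k] by (intro ennreal_mult) auto
      also have "\<dots> \<le> ennreal A * emeasure lborel Q" by (intro mult_left_mono Qe) auto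
      finally show ?thesis unfolding Q_def v_def .
    qed
  qed (use A \<epsilon> in \<open>auto simp: A_def\<close>)

  \<comment> \<open>Passage from cell suprema to pointwise values\<close>
  have pt: "exp_ext (- (ereal \<epsilon> * u x)) \<le> ennreal (exp (- \<epsilon> * w)) * liminf (\<lambda>k. ennreal (exp (\<epsilon> * (m 0 x - m k x))))"
    (is "_ \<le> ?R") if x: "x \<in> S" for x
  proof -
    have m0: "w \<le> m 0 x" using low[OF qG[OF x, of 0]] n[OF qG[OF x], of 4 0] by (simp add: m_def F_def h_def)
    \<comment> \<open>By upper semicontinuity \<open>u < c\<close> on a ball around
      \<open>x\<close>, into which the polydiscs defining \<open>m k x\<close> shrink; in
      \<open>?d\<close>, 6 is 4 + 2 and the cardinality passes from coordinates to the norm. Then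
      \<open>m0\<close> turns \<open>m 0 x\<close> into \<open>w\<close>.\<close>
    have lb: "ennreal (exp (- \<epsilon> * c)) \<le> ?R" if c: "u x < ereal c" for c
    proof -
      have "open {z \<in> \<Omega>. u z < ereal c}" by (rule usc_open_sublevel[OF \<Omega>(1) usc])
      moreover have "x \<in> {z \<in> \<Omega>. u z < ereal c}" using S\<Omega>[OF x] c by simp
      ultimately obtain e where e: "e > 0" "ball x e \<subseteq> {z \<in> \<Omega>. u z < ereal c}"
        unfolding open_contains_ball by blast
      let ?d = "real CARD('n) * 6"
      have "(\<lambda>k. ?d * (1 / 2) ^ k) \<longlonglongrightarrow> ?d * 0" by (intro tendsto_intros) simp
      then have "(\<lambda>k. ?d * h k) \<longlonglongrightarrow> ?d * 0" by (simp add: h_def power_one_over)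
      then have "\<forall>\<^sub>F k in sequentially. ?d * h k < e" using e by (intro order_tendstoD(2)) auto
      then have "\<forall>\<^sub>F k in sequentially. m k x \<le> c"
      proof eventually_elim
        case (elim k)
        have "u z \<le> ereal c" if z: "z \<in> ?D (dyadic_corner k x) (4 * h k)" for z
        proof -
          have "cmod ((z - x) $ j) \<le> 6 * h k" for j
          proof -
            have "cmod (z $ j - dyadic_corner k x $ j) < 4 * h k"
              using z h[of k] by (subst (asm) mem_isotropic_polydisc) auto
            moreover have "cmod ((z - x) $ j) \<le> cmod (z $ j - dyadic_corner k x $ j) + cmod ((x - dyadic_corner k x) $ j)"
              using norm_triangle_ineq4[of "z $ j - dyadic_corner k x $ j" "(x - dyadic_corner k x) $ j"] by simp
            ultimately show ?thesis using near[of x k j] by simp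
          qed
          then have "(\<Sum>j\<in>UNIV. cmod ((z - x) $ j)) \<le> (\<Sum>j\<in>(UNIV::'n set). 6 * h k)" by (intro sum_mono) auto
          moreover have "norm (z - x) \<le> (\<Sum>j\<in>UNIV. cmod ((z - x) $ j))"
            unfolding norm_vec_def by (rule L2_set_le_sum) auto
          ultimately have "norm (z - x) < e" using elim by simp
          then have "z \<in> ball x e" by (simp add: dist_norm norm_minus_commute)
          then show ?thesis using e by (auto simp: less_imp_le)
        qed
        then have "polydisc_sup u (dyadic_corner k x) 1 (ln (4 * h k)) \<le> ereal c"
          unfolding polydisc_sup_def by (intro SUP_least)
        then show ?case using n[OF qG[OF x, of k], of "4 * h k"] h[of k] by (simp add: m_def F_def)
      qed
      then have "\<forall>\<^sub>F k in sequentially. ennreal (exp (\<epsilon> * (m 0 x - c))) \<le> ennreal (exp (\<epsilon> * (m 0 x - m k x)))"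
        by eventually_elim (use \<epsilon> in \<open>auto intro!: ennreal_leI\<close>)
      then have "ennreal (exp (\<epsilon> * (m 0 x - c))) \<le> liminf (\<lambda>k. ennreal (exp (\<epsilon> * (m 0 x - m k x))))"
        by (rule Liminf_bounded)
      then have R: "ennreal (exp (- \<epsilon> * w)) * ennreal (exp (\<epsilon> * (m 0 x - c))) \<le> ?R"
        by (rule mult_left_mono) simp
      have "exp (- \<epsilon> * c) \<le> exp (- \<epsilon> * w) * exp (\<epsilon> * (m 0 x - c))"
        unfolding exp_add[symmetric] using mult_left_mono[OF m0, of \<epsilon>] \<epsilon> by (simp add: algebra_simps)
      then have "ennreal (exp (- \<epsilon> * c)) \<le> ennreal (exp (- \<epsilon> * w) * exp (\<epsilon> * (m 0 x - c)))"
        by (rule ennreal_leI)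
      also have "\<dots> = ennreal (exp (- \<epsilon> * w)) * ennreal (exp (\<epsilon> * (m 0 x - c)))"
        by (rule ennreal_mult) auto
      also note R
      finally show ?thesis .
    qed
    show ?thesis
    proof (cases "?R = \<infinity>")
      case False
      then obtain r where r: "?R = ennreal r" "0 \<le> r" by (cases ?R) auto
      have ufin: "u x \<noteq> \<infinity>" using fin S\<Omega>[OF x] by auto
      then obtain c where "u x < ereal c" using ereal_dense2[of "u x" \<infinity>] by auto
      have lb': "exp (- \<epsilon> * c) \<le> r" if "u x < ereal c" for c
        using lb[OF that] unfolding r(1) ennreal_le_iff[OF r(2)] .
      from \<open>u x < ereal c\<close> have "exp (- \<epsilon> * c) \<le> r" by (rule lb')
      then have "r > 0" using exp_gt_zero less_le_trans by blast
      \<comment> \<open>With r = exp (- \<epsilon> c0), the bounds for all c > u x yield c0 \<le> u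
        x; in particular \<open>u x\<close> is not -\<infinity>.\<close>
      define c0 where "c0 = - ln r / \<epsilon>"
      have rc: "r = exp (- \<epsilon> * c0)" using \<open>r > 0\<close> \<epsilon> by (simp add: c0_def)
      have "c0 \<le> c" if "u x < ereal c" for c
        using lb'[OF that] \<epsilon> unfolding rc by simp
      then have "ereal c0 \<le> u x" by (meson ereal_less_eq(3) ereal_dense2 less_le_trans linorder_not_le)
      then obtain t where t: "u x = ereal t" "c0 \<le> t" using ufin by (cases "u x") auto
      then show ?thesis unfolding r(1) rc using \<epsilon> by (simp add: exp_ext_def ennreal_leI)
    qed simp
  qed
  have "unit_polydisc \<subseteq> S"
  proof
    fix x :: "complex^'n" assume "x \<in> unit_polydisc"
    then have "\<bar>x \<bullet> i\<bar> < 1" if "i \<in> Basis" for i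
      using inner_Basis_le_cmod[OF that, of x 1] by (auto simp: unit_polydisc_def)
    then show "x \<in> S" by (force simp: S_def abs_less_iff)
  qed
  then have "(\<integral>\<^sup>+x\<in>unit_polydisc. exp_ext (- (ereal \<epsilon> * u x)) \<partial>lborel)
      \<le> (\<integral>\<^sup>+x. ennreal (exp (- \<epsilon> * w)) * (liminf (\<lambda>k. ennreal (exp (\<epsilon> * (m 0 x - m k x)))) * indicator S x) \<partial>lborel)"
    using pt by (intro nn_integral_mono) (auto simp: indicator_def)
  also have "\<dots> = ennreal (exp (- \<epsilon> * w)) * (\<integral>\<^sup>+x\<in>S. liminf (\<lambda>k. ennreal (exp (\<epsilon> * (m 0 x - m k x)))) \<partial>lborel)"
    using JN by (intro nn_integral_cmult) auto
  also have "\<dots> \<le> ennreal (exp (- \<epsilon> * w)) * (2 * ennreal (2 ^ N))"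
    using order_trans[OF conjunct1[OF JN] mult_left_mono[OF Se]] by (intro mult_left_mono) auto
  also have "\<dots> = ennreal (2 * 2 ^ N * exp (- \<epsilon> * w))"
    by (simp add: mult_ac flip: ennreal_mult' ennreal_numeral)
  finally show ?thesis .
qed

section \<open>Bergman kernels at the origin\<close>

lemma ln_ext_lower: "0 < x \<Longrightarrow> ennreal x \<le> k \<Longrightarrow> ereal (ln x) \<le> ln_ext k"
  by (cases k) (auto simp: ln_ext_def)

lemma ln_ext_upper: "0 < x \<Longrightarrow> k \<le> ennreal x \<Longrightarrow> ln_ext k \<le> ereal (ln x)"
  by (cases k) (auto simp: ln_ext_def top_unique)

lemma exp_ext_scaled_lower:
  assumes "0 < \<epsilon>" "x \<le> ereal c"
  shows "ennreal (exp (- \<epsilon> * c)) \<le> exp_ext (- (ereal \<epsilon> * x))"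
  using assms by (cases x) (auto simp: exp_ext_def intro!: ennreal_leI)

lemma unit_polydisc_eq: "unit_polydisc = open_polydisc 0 a 0"
  by (simp add: unit_polydisc_def open_polydisc_def)

text \<open>\<open>T\<close> is complex linear and maps complex lines to lines or points. The full
  preimage is kept as domain because the integral bound uses the dilated function on the polydisc of
  radius 14.\<close>

lemma plurisubharmonic_dilate:
  fixes t :: "complex^'n"
  assumes u: "plurisubharmonic_on \<Omega> u" and \<Omega>: "open \<Omega>"
  defines "T \<equiv> \<lambda>z. \<chi> j. t $ j * z $ j"
  shows "open {z. T z \<in> \<Omega>}" "plurisubharmonic_on {z. T z \<in> \<Omega>} (dilate u t)"
proof -
  have Tc: "continuous_on UNIV T" unfolding T_def by (intro continuous_intros)
  show op: "open {z. T z \<in> \<Omega>}" using open_vimage[OF \<Omega> Tc] by (simp add: vimage_def)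
  have dil: "dilate u t z = u (T z)" for z by (simp add: dilate_def T_def)
  have usc: "upper_semicontinuous_on \<Omega> u" using u by (simp add: plurisubharmonic_on_def)
  have "upper_semicontinuous_on {z. T z \<in> \<Omega>} (dilate u t)"
  proof (rule usc_onI_open[OF op])
    fix c
    have "{z \<in> {z. T z \<in> \<Omega>}. dilate u t z < c} = T -` {z\<in>\<Omega>. u z < c}" by (auto simp: dil)
    then show "open {z \<in> {z. T z \<in> \<Omega>}. dilate u t z < c}"
      using open_vimage[OF usc_open_sublevel[OF \<Omega> usc] Tc] by simp
  qed
  moreover have "subharmonic_on {\<tau>. a + \<tau> *s b \<in> {z. T z \<in> \<Omega>}} (\<lambda>\<tau>. dilate u t (a + \<tau> *s b))" for a b
  proof -
    have "T (a + \<tau> *s b) = T a + \<tau> *s T b" for \<tau> by (simp add: T_def vec_eq_iff algebra_simps)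
    then show ?thesis using u unfolding plurisubharmonic_on_def dil by simp
  qed
  ultimately show "plurisubharmonic_on {z. T z \<in> \<Omega>} (dilate u t)"
    using u unfolding plurisubharmonic_on_def dil by auto
qed

text \<open>The weight is at least exp (- \<epsilon> c), so a competitor has unweighted squared norm
  at most exp (\<epsilon> c), and the volume mean value inequality bounds it at 0.\<close>

lemma bergman_kernel_at_0_upper:
  fixes \<phi> :: "complex^'n \<Rightarrow> ereal"
  assumes V: "emeasure lborel (unit_polydisc :: (complex^'n) set) = ennreal V" "0 < V" and \<epsilon>: "0 < \<epsilon>"
    and le: "\<And>w. w \<in> unit_polydisc \<Longrightarrow> \<phi> w \<le> ereal c"
  shows "bergman_kernel (\<lambda>z. ereal \<epsilon> * \<phi> z) unit_polydisc 0 \<le> ennreal (exp (\<epsilon> * c) / V)"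
  unfolding bergman_kernel_def
proof (rule SUP_least)
  fix f :: "complex^'n \<Rightarrow> complex"
  assume "f \<in> {f \<in> holomorphic_functions unit_polydisc.
     (\<integral>\<^sup>+w\<in>unit_polydisc. ennreal ((cmod (f w))\<^sup>2) * exp_ext (- (ereal \<epsilon> * \<phi> w)) \<partial>lborel) \<le> 1}"
  then have f: "f \<in> holomorphic_functions unit_polydisc"
    and int: "(\<integral>\<^sup>+w\<in>unit_polydisc. ennreal ((cmod (f w))\<^sup>2) * exp_ext (- (ereal \<epsilon> * \<phi> w)) \<partial>lborel) \<le> 1"
    by auto
  \<comment> \<open>Half of the exponent, because the factor gets squared. Carrying it inside
    \<open>f\<close> avoids pulling a constant out of an integral.\<close>
  define e where "e = exp (- \<epsilon> * c / 2)"
  have e2: "e\<^sup>2 = exp (- \<epsilon> * c)" by (simp add: e_def power2_eq_square flip: exp_add)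
  have "(\<lambda>z. of_real e * f z) \<in> holomorphic_functions unit_polydisc"
    unfolding holomorphic_functions_def
  proof (intro CollectI ballI)
    fix z :: "complex^'n" assume "z \<in> unit_polydisc"
    then obtain f' where "(f has_derivative f') (at z)" "\<And>c v. f' (c *s v) = c * f' v"
      using f unfolding holomorphic_functions_def by blast
    then show "\<exists>f'. ((\<lambda>z. of_real e * f z) has_derivative f') (at z) \<and> (\<forall>c v. f' (c *s v) = c * f' v)"
      by (intro exI[of _ "\<lambda>v. of_real e * f' v"]) (auto intro!: has_derivative_mult_right)
  qed
  then have "ennreal V * ennreal ((cmod (of_real e * f 0))\<^sup>2)
      \<le> (\<integral>\<^sup>+w\<in>unit_polydisc. ennreal ((cmod (of_real e * f w))\<^sup>2) \<partial>lborel)"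
    unfolding V(1)[symmetric]
  proof (rule holomorphic_volume_submean)
    show "open (unit_polydisc :: (complex^'n) set)" unfolding unit_polydisc_eq[of 1] by (rule open_open_polydisc)
    show "\<tau> *s b \<in> unit_polydisc" if "b \<in> unit_polydisc" "cmod \<tau> \<le> 1" for b :: "complex^'n" and \<tau>
      unfolding unit_polydisc_def
    proof (intro CollectI allI)
      fix j
      have "cmod ((\<tau> *s b) $ j) \<le> 1 * cmod (b $ j)"
        using that by (simp add: norm_mult mult_left_le_one_le)
      then show "cmod ((\<tau> *s b) $ j) < 1"
        using that(1) unfolding unit_polydisc_def by (smt (verit) mem_Collect_eq)
    qed
  qed
  also have "\<dots> \<le> (\<integral>\<^sup>+w\<in>unit_polydisc. ennreal ((cmod (f w))\<^sup>2) * exp_ext (- (ereal \<epsilon> * \<phi> w)) \<partial>lborel)"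
  proof (rule nn_integral_mono)
    fix w :: "complex^'n"
    show "ennreal ((cmod (of_real e * f w))\<^sup>2) * indicator unit_polydisc w
       \<le> ennreal ((cmod (f w))\<^sup>2) * exp_ext (- (ereal \<epsilon> * \<phi> w)) * indicator unit_polydisc w"
    proof (cases "w \<in> unit_polydisc")
      case True
      have "ennreal ((cmod (of_real e * f w))\<^sup>2) = ennreal ((cmod (f w))\<^sup>2) * ennreal (exp (- \<epsilon> * c))"
        unfolding e2[symmetric] by (simp add: norm_mult power_mult_distrib mult.commute flip: ennreal_mult')
      also have "\<dots> \<le> ennreal ((cmod (f w))\<^sup>2) * exp_ext (- (ereal \<epsilon> * \<phi> w))"
        by (intro mult_left_mono exp_ext_scaled_lower \<epsilon> le[OF True]) auto
      finally show ?thesis using True by simp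
    qed simp
  qed
  also note int
  finally have "V * (cmod (of_real e * f 0))\<^sup>2 \<le> 1"
    using V(2) by (simp flip: ennreal_mult')
  then have "V * (exp (- \<epsilon> * c) * (cmod (f 0))\<^sup>2) \<le> 1"
    unfolding e2[symmetric] by (simp add: norm_mult power_mult_distrib)
  then have "(cmod (f 0))\<^sup>2 \<le> exp (\<epsilon> * c) / V"
    using V(2) by (simp add: exp_minus field_simps)
  then show "ennreal ((cmod (f 0))\<^sup>2) \<le> ennreal (exp (\<epsilon> * c) / V)" by (rule ennreal_leI)
qed

lemma borel_measurable_exp_ext [measurable]: "exp_ext \<in> borel_measurable borel"
  unfolding exp_ext_def[abs_def] by measurable

lemma bergman_kernel_lower:
  fixes u :: "complex^'n \<Rightarrow> ereal"
  assumes \<Omega>: "open \<Omega>" "upper_semicontinuous_on \<Omega> u"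
    and I: "(\<integral>\<^sup>+w\<in>\<Omega>. exp_ext (- (ereal \<epsilon> * u w)) \<partial>lborel) \<le> ennreal I" "0 < I"
  shows "ennreal (1 / I) \<le> bergman_kernel (\<lambda>z. ereal \<epsilon> * u z) \<Omega> z"
proof -
  define f :: "complex^'n \<Rightarrow> complex" where "f = (\<lambda>_. of_real (sqrt (1 / I)))"
  have f2: "(cmod (f w))\<^sup>2 = 1 / I" for w using I(2) by (simp only: f_def norm_of_real power2_abs) simp
  have "f \<in> holomorphic_functions \<Omega>"
    unfolding holomorphic_functions_def f_def by (auto intro!: exI[of _ "\<lambda>_. 0"])
  moreover have "(\<integral>\<^sup>+w\<in>\<Omega>. ennreal ((cmod (f w))\<^sup>2) * exp_ext (- (ereal \<epsilon> * u w)) \<partial>lborel) \<le> 1"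
  proof -
    define U where "U z = (if z \<in> \<Omega> then u z else 0)" for z
    have [measurable]: "U \<in> borel_measurable borel" unfolding U_def by (rule usc_borel_measurable[OF \<Omega>])
    have [measurable]: "\<Omega> \<in> sets borel" using \<Omega> by simp
    have "exp_ext (- (ereal \<epsilon> * u w)) * indicator \<Omega> w = exp_ext (- (ereal \<epsilon> * U w)) * indicator \<Omega> w" for w
      by (auto simp: U_def indicator_def)
    then have "(\<lambda>w. exp_ext (- (ereal \<epsilon> * u w)) * indicator \<Omega> w) \<in> borel_measurable lborel" by simp
    then have "(\<integral>\<^sup>+w\<in>\<Omega>. ennreal ((cmod (f w))\<^sup>2) * exp_ext (- (ereal \<epsilon> * u w)) \<partial>lborel)
        = ennreal (1 / I) * (\<integral>\<^sup>+w\<in>\<Omega>. exp_ext (- (ereal \<epsilon> * u w)) \<partial>lborel)"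
      unfolding f2 mult.assoc by (rule nn_integral_cmult)
    also have "\<dots> \<le> ennreal (1 / I) * ennreal I" by (intro mult_left_mono I) simp
    also have "\<dots> = 1" using I(2) by (simp flip: ennreal_mult')
    finally show ?thesis .
  qed
  ultimately have "ennreal ((cmod (f z))\<^sup>2) \<le> bergman_kernel (\<lambda>z. ereal \<epsilon> * u z) \<Omega> z"
    unfolding bergman_kernel_def by (intro SUP_upper) auto
  then show ?thesis unfolding f2 .
qed

theorem theorem1p3:
  fixes \<phi> :: "complex ^ 'n \<Rightarrow> ereal" and a :: "real ^ 'n"
  assumes "\<phi> \<in> PSH unit_polydisc"
    and "\<And>j. 0 < a $ j"
  shows "\<exists>\<epsilon>\<^sub>0::real. 0 < \<epsilon>\<^sub>0 \<and> (\<forall>\<epsilon>::real. 0 < \<epsilon> \<and> \<epsilon> \<le> \<epsilon>\<^sub>0 \<longrightarrow>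
    (\<exists>L::real.
      ((\<lambda>r::real. (SUP t \<in> weighted_polydisc a r.
            log_bergman (\<lambda>z. ereal \<epsilon> * \<phi> z) t 0 / ereal \<epsilon>) / ereal (ln r))
        \<longlongrightarrow> ereal L) (at_right 0) \<and>
      ((\<lambda>r::real. (SUP z \<in> weighted_polydisc a r. \<phi> z) / ereal (ln r))
        \<longlongrightarrow> ereal L) (at_right 0)))"
proof -

  \<comment> \<open>The growth function and the choice of constants\<close>
  let ?\<Omega> = "unit_polydisc :: (complex^'n) set"
  let ?S = "polydisc_sup \<phi> 0 a"
  define n where "n s = real_of_ereal (?S s)" for s
  have psh: "plurisubharmonic_on ?\<Omega> \<phi>" and nz: "\<exists>z\<in>?\<Omega>. \<phi> z \<noteq> -\<infinity>"
    using assms(1) unfolding PSH_def by auto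
  have usc: "upper_semicontinuous_on ?\<Omega> \<phi>" and fin: "\<And>z. z \<in> ?\<Omega> \<Longrightarrow> \<phi> z \<noteq> \<infinity>"
    using psh unfolding plurisubharmonic_on_def by auto
  have \<Omega>a: "?\<Omega> = open_polydisc 0 a 0" by (rule unit_polydisc_eq)
  have op: "open ?\<Omega>" unfolding \<Omega>a by (rule open_open_polydisc)
  have sub\<Omega>: "open_polydisc 0 a s \<subseteq> ?\<Omega>" if "s \<le> 0" for s
    unfolding \<Omega>a by (rule open_polydisc_mono[OF assms(2) that])
  \<comment> \<open>Scale 0 is excluded since \<phi> may be unbounded above near the boundary; at
    negative scales the closed polydisc is compact in the domain.\<close>
  have S_less: "?S s \<noteq> \<infinity>" if "s < 0" for s
  proof -
    have sub: "closed_polydisc 0 a s \<subseteq> ?\<Omega>" unfolding \<Omega>a by (rule closed_polydisc_subset_open[OF assms(2) that])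
    have "0 \<in> closed_polydisc 0 a s" by (simp add: closed_polydisc_def)
    then obtain p where p: "p \<in> closed_polydisc 0 a s"
        "\<And>z. z \<in> closed_polydisc 0 a s \<Longrightarrow> \<phi> z + ereal 0 \<le> \<phi> p + ereal 0"
      using usc_attains_sup[OF compact_closed_polydisc _ sub usc fin continuous_on_const] by blast
    have "\<phi> z \<le> \<phi> p" if "z \<in> open_polydisc 0 a s" for z
      using p(2)[OF subsetD[OF open_polydisc_subset_closed that]] by simp
    then have "?S s \<le> \<phi> p" unfolding polydisc_sup_def by (rule SUP_least)
    then show ?thesis using fin[of p] sub p(1) by auto
  qed
  obtain z where z: "z \<in> ?\<Omega>" "\<phi> z \<noteq> -\<infinity>" using nz by auto
  then obtain \<eta> where \<eta>: "\<eta> > 0" "z \<in> open_polydisc 0 a (0 - \<eta>)"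
    unfolding \<Omega>a by (blast elim: open_polydisc_shrink)
  \<comment> \<open>The point \<open>z\<close> rules out -\<infinity> at scale -\<eta>. The
    reference scale \<open>max s (- \<eta> / 2)\<close> is negative, not below \<open>s\<close> and
    strictly above -\<eta>.\<close>
  have S_fin: "\<bar>?S s\<bar> \<noteq> \<infinity>" if "s < 0" for s
  proof (rule polydisc_sup_finite[OF psh op _ assms(2)])
    show "open_polydisc 0 a (max s (- \<eta> / 2)) \<subseteq> ?\<Omega>" using that \<eta> by (intro sub\<Omega>) auto
    show "?S (max s (- \<eta> / 2)) \<noteq> \<infinity>" using that \<eta> by (intro S_less) auto
    show "?S (0 - \<eta>) \<noteq> -\<infinity>" using polydisc_sup_upper[OF \<eta>(2), of \<phi>] z(2) by auto
  qed (use that \<eta> in auto)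
  have Sn: "?S s = ereal (n s)" if "s < 0" for s
    using S_fin[OF that] by (simp add: n_def ereal_real)
  have n_mono: "n s \<le> n t" if "s \<le> t" "t < 0" for s t
    using polydisc_sup_mono[OF open_polydisc_mono[OF assms(2) that(1)], of \<phi> 0] that by (simp add: Sn)
  have n_convex: "convex_on {..-1} n"
    unfolding n_def[abs_def] using sub\<Omega>[of "-1"] by (intro polydisc_sup_convex[OF psh op _ assms(2)] S_fin) auto
  obtain L where L: "((\<lambda>s. n s / s) \<longlongrightarrow> L) at_bot"
    using convex_mono_ratio_limit[OF n_convex] n_mono by (metis le_less_trans neg_less_0_iff_less zero_less_one)
  \<comment> \<open>Chosen with exp (H a_j) \<ge> 14 for all j, so that dilation maps the isotropic
    polydisc of radius 14 into the weighted one at scale \<open>s + H\<close>. The sum serves as an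
    upper bound for the maximum.\<close>
  define H where "H = (\<Sum>j\<in>UNIV. ln 14 / a $ j)"
  have H: "ln 14 \<le> H * a $ j" for j
  proof -
    have "ln 14 / a $ j \<le> H" unfolding H_def
      using less_imp_le[OF assms(2)] by (intro member_le_sum) auto
    then show ?thesis using assms(2)[of j] by (simp add: field_simps)
  qed
  have "H \<ge> 0" unfolding H_def using less_imp_le[OF assms(2)] by (intro sum_nonneg) auto
  \<comment> \<open>By convexity this rightmost increment bounds all increments of length
    \<open>H\<close> further left, uniformly in r.\<close>
  define C where "C = n (-1) - n (-1 - H)"
  have C: "C \<ge> 0" using n_mono[of "-1 - H" "-1"] \<open>H \<ge> 0\<close> by (simp add: C_def)
  define N where "N = DIM(complex^'n)"
  define \<epsilon>\<^sub>0 where "\<epsilon>\<^sub>0 = 1 / (4 * (12 ^ N * (C + 1)))"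
  have \<epsilon>0: "\<epsilon>\<^sub>0 > 0" using C by (simp add: \<epsilon>\<^sub>0_def)
  obtain V where V: "emeasure lborel ?\<Omega> = ennreal V" "0 < V"
  proof -
    have "?\<Omega> \<subseteq> closed_polydisc 0 a 0" unfolding \<Omega>a by (rule open_polydisc_subset_closed)
    then have "bounded ?\<Omega>" using compact_imp_bounded[OF compact_closed_polydisc] bounded_subset by blast
    then have "emeasure lborel ?\<Omega> \<noteq> \<infinity>" using emeasure_bounded_finite by (metis infinity_ennreal_def less_irrefl)
    moreover have "emeasure lborel ?\<Omega> \<noteq> 0"
    proof
      assume "emeasure lborel ?\<Omega> = 0"
      then have "?\<Omega> \<in> null_sets lborel" using op by (simp add: null_sets_def)
      moreover have "0 \<in> ?\<Omega>" by (simp add: unit_polydisc_def)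
      ultimately show False using open_not_negligible[OF op] negligible_iff_null_sets null_sets_completionI by blast
    qed
    ultimately show thesis using that
      by (cases "emeasure lborel ?\<Omega>") (auto simp: less_le)
  qed
  define K where "K = 2 * 2 ^ N * (1::real)"
  have K: "K > 0" by (simp add: K_def)
  show ?thesis
  proof (rule exI[of _ \<epsilon>\<^sub>0], intro conjI allI impI)
    show "0 < \<epsilon>\<^sub>0" by (rule \<epsilon>0)
    fix \<epsilon> :: real assume "0 < \<epsilon> \<and> \<epsilon> \<le> \<epsilon>\<^sub>0"
    then have \<epsilon>: "0 < \<epsilon>" "\<epsilon> \<le> \<epsilon>\<^sub>0" by auto
    have \<epsilon>': "4 * \<epsilon> * (12 ^ N * (C + 1)) \<le> 1"
      using \<epsilon>(2) C unfolding \<epsilon>\<^sub>0_def by (subst (asm) pos_le_divide_eq) (auto simp: mult_ac)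
    \<comment> \<open>Keeps ln r, ln r + 1 and ln r + H at most -1, where \<open>n\<close> is finite
      and convex.\<close>
    have small: "\<forall>\<^sub>F r in at_right (0::real). ln r \<le> - 2 - H"
      by (rule eventually_compose_filterlim[OF eventually_le_at_bot ln_at_0])
    have pos: "\<forall>\<^sub>F r in at_right (0::real). 0 < r" by (rule eventually_at_right_less)
    have mem: "exp (ln r * a $ j) = r powr (a $ j)" if "0 < r" for r :: real and j
      using that by (simp add: powr_def)
    \<comment> \<open>Absorbs the constants from the volume and from the integral bound; as
      \<epsilon> is fixed, it vanishes after division by ln r.\<close>
    define B where "B = (\<bar>ln K\<bar> + \<bar>ln V\<bar>) / \<epsilon>"
    have B: "ln K / \<epsilon> \<le> B" "- ln V / \<epsilon> \<le> B" "0 \<le> B"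
      using \<epsilon> by (auto simp: B_def field_simps)
    have div_mono: "x / ereal \<epsilon> \<le> y / ereal \<epsilon>" if "x \<le> y" for x y
      using \<epsilon> that by (intro ereal_divide_right_mono) auto
    have dil: "dilate (\<lambda>z. ereal \<epsilon> * \<phi> z) t = (\<lambda>z. ereal \<epsilon> * dilate \<phi> t z)" for t
      by (simp add: dilate_def fun_eq_iff)

    \<comment> \<open>The quotient of Bergman kernels\<close>
    let ?X = "\<lambda>r. SUP t \<in> weighted_polydisc a r. log_bergman (\<lambda>z. ereal \<epsilon> * \<phi> z) t 0 / ereal \<epsilon>"
    have lim1: "((\<lambda>r. ?X r / ereal (ln r)) \<longlongrightarrow> ereal L) (at_right 0)"
    proof (rule ratio_limit_sandwich[OF L])
      show "\<forall>\<^sub>F r in at_right 0. ?X r \<le> ereal (n (ln r + 1) + B)"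
        using small pos
      proof eventually_elim
        case (elim r)
        show ?case
        proof (rule SUP_least)
          fix t assume t: "t \<in> weighted_polydisc a r"
          have "dilate \<phi> t w \<le> ereal (n (ln r))" if w: "w \<in> ?\<Omega>" for w
          proof -
            have "cmod (t $ j * w $ j) < exp (ln r * a $ j)" for j
            proof -
              have "cmod (t $ j) * cmod (w $ j) \<le> r powr (a $ j) * cmod (w $ j)"
                using t by (intro mult_right_mono) (auto simp: weighted_polydisc_def)
              also have "\<dots> < r powr (a $ j) * 1"
                using w elim by (intro mult_strict_left_mono) (auto simp: unit_polydisc_def)
              finally show ?thesis using mem[OF elim(2)] by (simp add: norm_mult)
            qed
            then have "(\<chi> j. t $ j * w $ j) \<in> open_polydisc 0 a (ln r)" by (simp add: open_polydisc_def)
            moreover have "ln r < 0" using elim \<open>H \<ge> 0\<close> by linarith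
            ultimately show ?thesis using polydisc_sup_upper[of _ 0 a "ln r" \<phi>] unfolding dilate_def by (metis Sn)
          qed
          then have "bergman_kernel (dilate (\<lambda>z. ereal \<epsilon> * \<phi> z) t) ?\<Omega> 0 \<le> ennreal (exp (\<epsilon> * n (ln r)) / V)"
            unfolding dil by (rule bergman_kernel_at_0_upper[OF V \<epsilon>(1)])
          then have "log_bergman (\<lambda>z. ereal \<epsilon> * \<phi> z) t 0 \<le> ereal (ln (exp (\<epsilon> * n (ln r)) / V))"
            unfolding log_bergman_def using V by (intro ln_ext_upper) auto
          also have "ln (exp (\<epsilon> * n (ln r)) / V) = \<epsilon> * n (ln r) - ln V"
            using V by (simp add: ln_div)
          finally have "log_bergman (\<lambda>z. ereal \<epsilon> * \<phi> z) t 0 / ereal \<epsilon> \<le> ereal (\<epsilon> * n (ln r) - ln V) / ereal \<epsilon>"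
            by (rule div_mono)
          also have "\<dots> = ereal (n (ln r) - ln V / \<epsilon>)" using \<epsilon> by (simp add: diff_divide_distrib)
          also have "\<dots> \<le> ereal (n (ln r + 1) + B)"
            using n_mono[of "ln r" "ln r + 1"] elim \<open>H \<ge> 0\<close> B(2) by simp
          finally show "log_bergman (\<lambda>z. ereal \<epsilon> * \<phi> z) t 0 / ereal \<epsilon> \<le> ereal (n (ln r + 1) + B)" .
        qed
      qed
      show "\<forall>\<^sub>F r in at_right 0. ereal (n (ln r) - B) \<le> ?X r"
        using small pos
      proof eventually_elim
        case (elim r)
        define s where "s = ln r"
        have s: "s \<le> -2 - H" using elim by (simp add: s_def)
        \<comment> \<open>The point with the largest admissible moduli. Its entries are nonzero, so
          the dilation maps the unit polydisc onto the weighted one at scale \<open>s\<close>, and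
          \<open>S1\<close> is an equality.\<close>
        define t :: "complex^'n" where "t = (\<chi> j. of_real (exp (s * a $ j)))"
        have t: "t \<in> weighted_polydisc a r"
          using mem[OF elim(2)] by (simp add: t_def weighted_polydisc_def s_def)
        define \<Omega>' where "\<Omega>' = {z. (\<chi> j. t $ j * z $ j) \<in> ?\<Omega>}"
        have \<Omega>': "open \<Omega>'" "plurisubharmonic_on \<Omega>' (dilate \<phi> t)"
          unfolding \<Omega>'_def by (rule plurisubharmonic_dilate[OF psh op])+
        have sc: "(\<chi> j. t $ j * z $ j) \<in> open_polydisc 0 a (s + h)" if "z \<in> open_polydisc 0 1 l" "\<And>j. l \<le> h * a $ j" for z h l
          unfolding open_polydisc_def
        proof (intro CollectI allI)
          fix j
          have "exp (s * a $ j) * cmod (z $ j) < exp (s * a $ j) * exp l"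
            using that(1) by (intro mult_strict_left_mono) (auto simp: open_polydisc_def)
          also have "\<dots> \<le> exp ((s + h) * a $ j)"
            using that(2)[of j] by (simp add: algebra_simps flip: exp_add)
          finally show "cmod ((\<chi> j. t $ j * z $ j) $ j - 0 $ j) < exp ((s + h) * a $ j)"
            by (simp add: t_def norm_mult)
        qed
        have S1: "polydisc_sup (dilate \<phi> t) 0 1 0 = ereal (n s)"
        proof (rule antisym)
          have "dilate \<phi> t z \<le> ?S (s + 0)" if "z \<in> open_polydisc 0 1 0" for z
            unfolding dilate_def by (intro polydisc_sup_upper sc[OF that]) simp
          then show "polydisc_sup (dilate \<phi> t) 0 1 0 \<le> ereal (n s)"
            unfolding polydisc_sup_def[of "dilate \<phi> t"] using Sn[of s] s \<open>H \<ge> 0\<close> by (intro SUP_least) auto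
          have "\<phi> z \<le> polydisc_sup (dilate \<phi> t) 0 1 0" if z: "z \<in> open_polydisc 0 a s" for z
          proof -
            define z' where "z' = (\<chi> j. z $ j / t $ j)"
            have "z' \<in> open_polydisc 0 1 0" using z
              by (simp add: z'_def t_def open_polydisc_def norm_divide)
            moreover have "dilate \<phi> t z' = \<phi> z"
              by (simp add: dilate_def z'_def t_def)
            ultimately show ?thesis using polydisc_sup_upper by metis
          qed
          then have "?S s \<le> polydisc_sup (dilate \<phi> t) 0 1 0"
            unfolding polydisc_sup_def[of \<phi>] by (rule SUP_least)
          then show "ereal (n s) \<le> polydisc_sup (dilate \<phi> t) 0 1 0" using Sn[of s] s \<open>H \<ge> 0\<close> by simp
        qed
        have in14: "(\<chi> j. t $ j * z $ j) \<in> open_polydisc 0 a (s + H)" if "z \<in> open_polydisc 0 1 (ln 14)" for z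
          by (rule sc[OF that H])
        have "polydisc_sup (dilate \<phi> t) 0 1 (ln 14) \<le> ereal (n (s + H))"
          unfolding polydisc_sup_def[of "dilate \<phi> t"] dilate_def
          using Sn[of "s + H"] s polydisc_sup_upper[OF in14, of _ \<phi>] by (intro SUP_least) auto
        also have "n (s + H) \<le> n s + C"
          using convex_on_increment_mono[OF n_convex, of s "-1 - H" H] s \<open>H \<ge> 0\<close> by (simp add: C_def)
        finally have S14: "polydisc_sup (dilate \<phi> t) 0 1 (ln 14) \<le> ereal (n s + C)" by simp
        have sub: "open_polydisc 0 1 (ln 14) \<subseteq> \<Omega>'"
          using in14 sub\<Omega>[of "s + H"] s unfolding \<Omega>'_def by auto
        have "?\<Omega> \<subseteq> \<Omega>'"
          using sub open_polydisc_mono[of 1 0 "ln 14" 0] unfolding unit_polydisc_eq[of 1] by auto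
        define I where "I = K * exp (- \<epsilon> * n s)"
        have I: "I > 0" using K by (simp add: I_def)
        have "(\<integral>\<^sup>+x\<in>?\<Omega>. exp_ext (- (ereal \<epsilon> * dilate \<phi> t x)) \<partial>lborel) \<le> ennreal I"
          using plurisubharmonic_exp_integral_bound[OF \<Omega>'(2,1) sub S1 S14 C \<epsilon>(1)] \<epsilon>'
          by (simp add: I_def K_def N_def)
        moreover have "upper_semicontinuous_on ?\<Omega> (dilate \<phi> t)"
          using \<Omega>'(2) \<open>?\<Omega> \<subseteq> \<Omega>'\<close> unfolding plurisubharmonic_on_def upper_semicontinuous_on_def
          by (meson at_le filter_leD subsetD)
        ultimately have "ennreal (1 / I) \<le> bergman_kernel (dilate (\<lambda>z. ereal \<epsilon> * \<phi> z) t) ?\<Omega> 0"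
          unfolding dil using op I by (intro bergman_kernel_lower)
        then have "ereal (ln (1 / I)) \<le> log_bergman (\<lambda>z. ereal \<epsilon> * \<phi> z) t 0"
          unfolding log_bergman_def using I by (intro ln_ext_lower) auto
        then have "ereal (ln (1 / I)) / ereal \<epsilon> \<le> log_bergman (\<lambda>z. ereal \<epsilon> * \<phi> z) t 0 / ereal \<epsilon>"
          by (rule div_mono)
        also have "\<dots> \<le> ?X r" by (rule SUP_upper[OF t])
        finally have "ereal (ln (1 / I)) / ereal \<epsilon> \<le> ?X r" .
        moreover have "ln (1 / I) = \<epsilon> * n s - ln K"
          using K by (simp add: I_def ln_div ln_mult)
        then have "ereal (ln (1 / I)) / ereal \<epsilon> = ereal (n s - ln K / \<epsilon>)" using \<epsilon> by (simp add: diff_divide_distrib)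
        moreover have "ereal (n (ln r) - B) \<le> ereal (n s - ln K / \<epsilon>)" using B(1) by (simp add: s_def)
        ultimately show ?case by (metis order_trans)
      qed
    qed

    \<comment> \<open>The quotient for \<phi> itself\<close>
    have lim2: "((\<lambda>r. (SUP z \<in> weighted_polydisc a r. \<phi> z) / ereal (ln r)) \<longlongrightarrow> ereal L) (at_right 0)"
    proof (rule ratio_limit_sandwich[OF L, where C = 0])
      show "\<forall>\<^sub>F r in at_right 0. ereal (n (ln r) - 0) \<le> (SUP z \<in> weighted_polydisc a r. \<phi> z)"
        using small pos
      proof eventually_elim
        case (elim r)
        have "open_polydisc 0 a (ln r) \<subseteq> weighted_polydisc a r"
          by (auto simp: open_polydisc_def weighted_polydisc_def mem[OF elim(2)] less_imp_le)
        then have "?S (ln r) \<le> (SUP z \<in> weighted_polydisc a r. \<phi> z)"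
          unfolding polydisc_sup_def by (rule SUP_subset_mono) simp
        moreover have "ln r < 0" using elim \<open>H \<ge> 0\<close> by linarith
        ultimately show ?case by (simp only: Sn diff_zero)
      qed
      show "\<forall>\<^sub>F r in at_right 0. (SUP z \<in> weighted_polydisc a r. \<phi> z) \<le> ereal (n (ln r + 1) + 0)"
        using small pos
      proof eventually_elim
        case (elim r)
        have "weighted_polydisc a r \<subseteq> closed_polydisc 0 a (ln r)"
          by (auto simp: closed_polydisc_def weighted_polydisc_def mem[OF elim(2)])
        also have "\<dots> \<subseteq> open_polydisc 0 a (ln r + 1)" by (rule closed_polydisc_subset_open[OF assms(2)]) simp
        finally have "(SUP z \<in> weighted_polydisc a r. \<phi> z) \<le> ?S (ln r + 1)"
          unfolding polydisc_sup_def by (rule SUP_subset_mono) simp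
        then show ?case using Sn[of "ln r + 1"] elim \<open>H \<ge> 0\<close> by simp
      qed
    qed
    from lim1 lim2 show "\<exists>L::real. ((\<lambda>r. ?X r / ereal (ln r)) \<longlongrightarrow> ereal L) (at_right 0) \<and>
        ((\<lambda>r. (SUP z \<in> weighted_polydisc a r. \<phi> z) / ereal (ln r)) \<longlongrightarrow> ereal L) (at_right 0)"
      by blast
  qed
qed

end
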